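(* Let $E$ be a real Banach space and let $F$ be a real Banach space of type $2$. Then $\mathrm{PS}_2(E;F)=\gamma(E;F)$; that is, a bounded linear operator $u:E\to F$ is pre-Hilbert-Schmidt if and only if it is $\gamma$-radonifying.
   Context: $(r_n)_{n\ge1}$ denotes a sequence of independent Rademacher variables (values $\pm1$ with probability $1/2$ each) and $(\gamma_n)_{n\ge1}$ a sequence of independent real standard Gaussian variables on a probability space $\Omega$. A Banach space $F$ is of type $2$ if there is $c>0$ such that $\left(\mathbb{E}\left\|\sum_{n=1}^N r_nx_n\right\|^2\right)^{1/2}\le c\left(\sum_{n=1}^N\|x_n\|^2\right)^{1/2}$ for every finite family $x_1,\dots,x_N\in F$. A sequence $(x_n)_{n\ge1}$ in a Banach space $E$ is weakly $2$-summable, written $(x_n)\in\ell_2^{\mathrm{weak}}(E)$, if $\sup_{\|x^*\|\le1}\sum_{n}|\langle x_n,x^*\rangle|^2<\infty$, the supremum being over $x^*\in E^*$. A bounded operator $u:E\to F$ is $\gamma$-radonifying, written $u\in\gamma(E;F)$, if for every $(x_n)_{n\ge 1}\in\ell_2^{\mathrm{weak}}(E)$ the series $\sum_n\gamma_n\,ux_n$ converges in $L_2(\Omega;F)$. (Here $E$ is an arbitrary Banach space.) A bounded operator $u:E\to F$ is pre-Hilbert-Schmidt, written $u\in\mathrm{PS}_2(E;F)$, if for all Hilbert spaces $H_1,H_2$ and all bounded operators $v:H_1\to E$ and $w:F\to H_2$, the operator $w\circ u\circ v:H_1\to H_2$ is Hilbert-Schmidt (i.e. $\sum_{i}\|(w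 u v)e_i\|^2<\infty$ for an orthonormal basis $(e_i)$ of $H_1$). *)

theory Defs
  imports "HOL-Probability.Probability" "HOL-Library.Equipollence"
begin

text \<open>
  The class \<open>banach\<close> supplies the real Banach spaces. The definition of pre-Hilbert-Schmidt
  operators, however, quantifies over all Hilbert spaces inside a formula, which is impossible for
  types of the classes \<open>real_inner\<close> and \<open>complete_space\<close>. Hilbert spaces are therefore
  represented here by explicit carrier sets with operations; only the values of the operations on
  the carrier matter.
\<close>

record 'h hilbert =
  carr :: "'h set"
  hzero :: 'h
  hadd :: "'h \<Rightarrow> 'h \<Rightarrow> 'h"
  hscale :: "real \<Rightarrow> 'h \<Rightarrow> 'h"
  hinner :: "'h \<Rightarrow> 'h \<Rightarrow> real"

definition hnorm :: "'h hilbert \<Rightarrow> 'h \<Rightarrow> real" where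
  "hnorm H x = sqrt (hinner H x x)"

definition hdist :: "'h hilbert \<Rightarrow> 'h \<Rightarrow> 'h \<Rightarrow> real" where
  "hdist H x y = hnorm H (hadd H x (hscale H (-1) y))"

locale hilbert_space =
  fixes H :: "'h hilbert"
  assumes zero_closed: "hzero H \<in> carr H"
    and add_closed: "\<lbrakk>x \<in> carr H; y \<in> carr H\<rbrakk> \<Longrightarrow> hadd H x y \<in> carr H"
    and scale_closed: "x \<in> carr H \<Longrightarrow> hscale H a x \<in> carr H"
    and add_assoc: "\<lbrakk>x \<in> carr H; y \<in> carr H; z \<in> carr H\<rbrakk>
          \<Longrightarrow> hadd H (hadd H x y) z = hadd H x (hadd H y z)"
    and add_commute: "\<lbrakk>x \<in> carr H; y \<in> carr H\<rbrakk> \<Longrightarrow> hadd H x y = hadd H y x"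
    and add_zero: "x \<in> carr H \<Longrightarrow> hadd H x (hzero H) = x"
    and add_neg: "x \<in> carr H \<Longrightarrow> hadd H x (hscale H (-1) x) = hzero H"
    and scale_add_right: "\<lbrakk>x \<in> carr H; y \<in> carr H\<rbrakk>
          \<Longrightarrow> hscale H a (hadd H x y) = hadd H (hscale H a x) (hscale H a y)"
    and scale_add_left: "x \<in> carr H
          \<Longrightarrow> hscale H (a + b) x = hadd H (hscale H a x) (hscale H b x)"
    and scale_scale: "x \<in> carr H \<Longrightarrow> hscale H a (hscale H b x) = hscale H (a * b) x"
    and scale_one: "x \<in> carr H \<Longrightarrow> hscale H 1 x = x"
    and inner_commute: "\<lbrakk>x \<in> carr H; y \<in> carr H\<rbrakk> \<Longrightarrow> hinner H x y = hinner H y x"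
    and inner_add_left: "\<lbrakk>x \<in> carr H; y \<in> carr H; z \<in> carr H\<rbrakk>
          \<Longrightarrow> hinner H (hadd H x y) z = hinner H x z + hinner H y z"
    and inner_scale_left: "\<lbrakk>x \<in> carr H; y \<in> carr H\<rbrakk>
          \<Longrightarrow> hinner H (hscale H a x) y = a * hinner H x y"
    and inner_pos: "\<lbrakk>x \<in> carr H; x \<noteq> hzero H\<rbrakk> \<Longrightarrow> 0 < hinner H x x"
    and complete: "Metric_space.mcomplete (carr H) (hdist H)"

lemma hilbert_space_type:
  "hilbert_space \<lparr>carr = (UNIV :: 'a::{real_inner,complete_space} set), hzero = 0,
     hadd = (+), hscale = (*\<^sub>R), hinner = (\<bullet>)\<rparr>"
proof -
  have "hdist \<lparr>carr = (UNIV :: 'a set), hzero = 0,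
     hadd = (+), hscale = (*\<^sub>R), hinner = (\<bullet>)\<rparr> = dist"
    by (intro ext) (simp add: hdist_def hnorm_def dist_norm norm_eq_sqrt_inner)
  moreover have "Metric_space.mcomplete (UNIV :: 'a set) dist"
    using mcomplete_iff_complete[where 'a='a] complete_UNIV by blast
  ultimately show ?thesis
    by unfold_locales (auto simp: algebra_simps inner_commute inner_add_left)
qed

text \<open>An orthonormal basis is a maximal orthonormal set; it may be uncountable.\<close>

definition orthonormal_basis :: "'h hilbert \<Rightarrow> 'h set \<Rightarrow> bool" where
  "orthonormal_basis H B \<longleftrightarrow> B \<subseteq> carr H
     \<and> (\<forall>b\<in>B. \<forall>c\<in>B. hinner H b c = (if b = c then 1 else 0))
     \<and> (\<forall>x\<in>carr H. (\<forall>b\<in>B. hinner H x b = 0) \<longrightarrow> x = hzero H)"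

definition hilbert_schmidt :: "'h hilbert \<Rightarrow> 'k hilbert \<Rightarrow> ('h \<Rightarrow> 'k) \<Rightarrow> bool" where
  "hilbert_schmidt H1 H2 T \<longleftrightarrow>
     (\<exists>B. orthonormal_basis H1 B \<and> (\<lambda>b. (hnorm H2 (T b))\<^sup>2) summable_on B)"

definition bounded_op_from :: "'h hilbert \<Rightarrow> ('h \<Rightarrow> 'e::real_normed_vector) \<Rightarrow> bool" where
  "bounded_op_from H v \<longleftrightarrow>
     (\<forall>x\<in>carr H. \<forall>y\<in>carr H. v (hadd H x y) = v x + v y)
     \<and> (\<forall>a. \<forall>x\<in>carr H. v (hscale H a x) = a *\<^sub>R v x)
     \<and> (\<exists>K. \<forall>x\<in>carr H. norm (v x) \<le> K * hnorm H x)"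

definition bounded_op_into :: "'h hilbert \<Rightarrow> ('f::real_normed_vector \<Rightarrow> 'h) \<Rightarrow> bool" where
  "bounded_op_into H w \<longleftrightarrow>
     (\<forall>x. w x \<in> carr H)
     \<and> (\<forall>x y. w (x + y) = hadd H (w x) (w y))
     \<and> (\<forall>a x. w (a *\<^sub>R x) = hscale H a (w x))
     \<and> (\<exists>K. \<forall>x. hnorm H (w x) \<le> K * norm x)"

text \<open>
  \<open>PS\<^sub>2(E;F)\<close>, where the Hilbert spaces range over all those whose underlying set consists of
  elements of the universe type \<open>'h\<close>. Statements should be polymorphic in \<open>'h\<close>. A nonzero real
  Hilbert space has at least continuum many elements, so universes smaller than that contain only
  zero spaces and have to be excluded.
\<close>

definition pre_hilbert_schmidt ::
    "'h itself \<Rightarrow> ('e::real_normed_vector \<Rightarrow>\<^sub>L 'f::real_normed_vector) set" where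
  "pre_hilbert_schmidt _ =
     {u. \<forall>(H1 :: 'h hilbert) (H2 :: 'h hilbert) v w.
           hilbert_space H1 \<longrightarrow> hilbert_space H2 \<longrightarrow>
           bounded_op_from H1 v \<longrightarrow> bounded_op_into H2 w \<longrightarrow>
           hilbert_schmidt H1 H2 (w \<circ> blinfun_apply u \<circ> v)}"

definition rademacher_sequence :: "'w measure \<Rightarrow> (nat \<Rightarrow> 'w \<Rightarrow> real) \<Rightarrow> bool" where
  "rademacher_sequence M r \<longleftrightarrow>
     prob_space.indep_vars M (\<lambda>_. borel) r UNIV
     \<and> (\<forall>n. measure M {\<omega> \<in> space M. r n \<omega> = 1} = 1 / 2
            \<and> measure M {\<omega> \<in> space M. r n \<omega> = -1} = 1 / 2)"

definition gaussian_sequence :: "'w measure \<Rightarrow> (nat \<Rightarrow> 'w \<Rightarrow> real) \<Rightarrow> bool" where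
  "gaussian_sequence M g \<longleftrightarrow>
     prob_space.indep_vars M (\<lambda>_. borel) g UNIV
     \<and> (\<forall>n. distributed M lborel (g n) std_normal_density)"

definition type_2 ::
    "'w measure \<Rightarrow> (nat \<Rightarrow> 'w \<Rightarrow> real) \<Rightarrow> 'f::real_normed_vector itself \<Rightarrow> bool" where
  "type_2 M r _ \<longleftrightarrow>
     (\<exists>c>0. \<forall>N. \<forall>x :: nat \<Rightarrow> 'f.
        sqrt (\<integral>\<omega>. (norm (\<Sum>n<N. r n \<omega> *\<^sub>R x n))\<^sup>2 \<partial>M) \<le> c * sqrt (\<Sum>n<N. (norm (x n))\<^sup>2))"

definition weakly_2_summable :: "(nat \<Rightarrow> 'e::real_normed_vector) \<Rightarrow> bool" where
  "weakly_2_summable x \<longleftrightarrow>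
     (SUP f \<in> {f :: 'e \<Rightarrow>\<^sub>L real. norm f \<le> 1}.
        \<Sum>n. ennreal (\<bar>blinfun_apply f (x n)\<bar>\<^sup>2)) < \<infinity>"

text \<open>
  The Bochner integral of the library requires a second countable range type, and for
  non-separable \<open>F\<close> Borel measurability is weaker than the strong measurability required of
  elements of \<open>L\<^sub>2(\<Omega>;F)\<close>. Hence strong measurability is spelled out. Taking limits everywhere
  rather than almost everywhere only selects a representative of the equivalence class.
\<close>

definition strongly_measurable :: "'w measure \<Rightarrow> ('w \<Rightarrow> 'f::real_normed_vector) \<Rightarrow> bool" where
  "strongly_measurable M X \<longleftrightarrow>
     (\<exists>s. (\<forall>i. simple_function M (s i)) \<and> (\<forall>\<omega>\<in>space M. (\<lambda>i::nat. s i \<omega>) \<longlonglongrightarrow> X \<omega>))"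

definition in_L2 :: "'w measure \<Rightarrow> ('w \<Rightarrow> 'f::real_normed_vector) \<Rightarrow> bool" where
  "in_L2 M X \<longleftrightarrow> strongly_measurable M X \<and> (\<integral>\<^sup>+\<omega>. ennreal ((norm (X \<omega>))\<^sup>2) \<partial>M) < \<infinity>"

definition series_converges_L2 ::
    "'w measure \<Rightarrow> (nat \<Rightarrow> 'w \<Rightarrow> 'f::real_normed_vector) \<Rightarrow> bool" where
  "series_converges_L2 M Y \<longleftrightarrow>
     (\<forall>n. in_L2 M (Y n))
     \<and> (\<exists>X. in_L2 M X
          \<and> (\<lambda>N. \<integral>\<^sup>+\<omega>. ennreal ((norm ((\<Sum>n<N. Y n \<omega>) - X \<omega>))\<^sup>2) \<partial>M) \<longlonglongrightarrow> 0)"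

definition gamma_radonifying ::
    "'w measure \<Rightarrow> (nat \<Rightarrow> 'w \<Rightarrow> real) \<Rightarrow>
     ('e::real_normed_vector \<Rightarrow>\<^sub>L 'f::real_normed_vector) set" where
  "gamma_radonifying M g =
     {u. \<forall>x. weakly_2_summable x \<longrightarrow>
           series_converges_L2 M (\<lambda>n \<omega>. g n \<omega> *\<^sub>R blinfun_apply u (x n))}"

end

theory Submission
  imports Defs
begin

text \<open>
  \<^bold>\<open>From \<open>\<gamma>\<close>-radonifying to pre-Hilbert-Schmidt.\<close> If \<open>b\<^sub>n\<close> are orthonormal in \<open>H\<^sub>1\<close>, then
  the vectors \<open>v b\<^sub>n\<close> are weakly 2-summable by Bessel's inequality, so that the Gaussian series of
  \<open>u v b\<^sub>n\<close> converges in \<open>L\<^sub>2\<close>. In the Hilbert space \<open>H\<^sub>2\<close> the second moment of a Gaussian sum is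
  the sum of the squared norms; the sums of \<open>\<parallel>w u v b\<^sub>n\<parallel>\<^sup>2\<close> are therefore bounded. This gives the
  summability over countable parts of an orthonormal basis, hence over the whole basis.

  \<^bold>\<open>From pre-Hilbert-Schmidt to \<open>\<gamma>\<close>-radonifying.\<close> The core is \<open>hilbertian_domination\<close>: in a space
  of type 2 with constant \<open>c\<close> there are, for given vectors \<open>y\<^sub>1, \<dots>, y\<^sub>N\<close>, finitely many linear
  functionals \<open>h\<^sub>k\<close> with \<open>\<Sum>\<^sub>k h\<^sub>k(x)\<^sup>2 \<le> c\<^sup>2\<parallel>x\<parallel>\<^sup>2\<close> for all \<open>x\<close> and
  \<open>E\<parallel>\<Sum>\<^sub>n \<gamma>\<^sub>n y\<^sub>n\<parallel>\<^sup>2 \<le> \<Sum>\<^sub>n \<Sum>\<^sub>k h\<^sub>k(y\<^sub>n)\<^sup>2\<close>. So the Gaussian sum is controlled by a single operator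
  \<open>x \<mapsto> (h\<^sub>k(x))\<^sub>k\<close> into a Hilbert space. This is a Hahn-Banach argument on the commutative monoid of
  finite multisets of vectors. Call \<open>A\<close> dominated by \<open>Z\<close> if exchanging \<open>A\<close> for \<open>Z\<close> never decreases the
  second moment of the Gaussian sum, whatever other vectors are present, and assign to \<open>A\<close> the infimum of
  \<open>c\<^sup>2 \<Sum>\<^sub>z\<^sub>\<in>\<^sub>Z \<parallel>z\<parallel>\<^sup>2\<close> over all \<open>Z\<close> dominating \<open>A\<close>. This functional is sublinear and, by type 2, at least the
  second moment. An additive functional below it that agrees with it at \<open>{y\<^sub>1, \<dots>, y\<^sub>N}\<close> has the form
  \<open>A \<mapsto> \<Sum>\<^sub>x\<^sub>\<in>\<^sub>A q(x)\<close> with \<open>q(x) \<le> c\<^sup>2\<parallel>x\<parallel>\<^sup>2\<close>. Gaussian sums do not change if \<open>x, y\<close> is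
  replaced by \<open>(x+y)/\<surd>2, (x-y)/\<surd>2\<close>; hence \<open>q\<close> satisfies the parallelogram law, so it is a
  quadratic form, and completing squares at \<open>y\<^sub>1, \<dots>, y\<^sub>N\<close> produces the \<open>h\<^sub>k\<close>.

  Let \<open>u\<close> be pre-Hilbert-Schmidt and \<open>(x\<^sub>n)\<close> weakly 2-summable. Then \<open>e\<^sub>n \<mapsto> x\<^sub>n\<close> extends to an operator
  \<open>\<ell>\<^sub>2 \<rightarrow> E\<close>. If the second moments of the partial sums of the Gaussian series of \<open>u x\<^sub>n\<close> were
  unbounded, the functionals dominating larger and larger partial sums could be glued, with
  geometric weights, to one operator \<open>F \<rightarrow> \<ell>\<^sub>2\<close> violating the Hilbert-Schmidt condition
  (\<open>pre_hilbert_schmidt_gsq_bounded\<close>). Type 2 is used once more to turn boundedness into the Cauchy property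
  (\<open>gsq_bounded_imp_Cauchy\<close>), and the completeness of \<open>L\<^sub>2\<close> ends the proof.
\<close>

section \<open>Hahn-Banach theorem for preordered commutative monoids\<close>

text \<open>
  Finite multisets of vectors have no additive inverses. The last axiom keeps what Hahn-Banach
  arguments need of them, namely that sublinear functionals are bounded below. It holds with
  \<open>b' = - b\<close> for a group ordered by equality, and with \<open>b' = 0\<close> if \<open>0\<close> is the least element; both
  cases occur below.
\<close>

locale preordered_monoid =
  fixes R :: "'a::comm_monoid_add \<Rightarrow> 'a \<Rightarrow> bool"  (infix "\<sqsubseteq>" 50)
  assumes R_refl: "a \<sqsubseteq> a"
    and R_trans: "a \<sqsubseteq> b \<Longrightarrow> b \<sqsubseteq> d \<Longrightarrow> a \<sqsubseteq> d"
    and R_add: "a \<sqsubseteq> b \<Longrightarrow> a + d \<sqsubseteq> b + d"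
    and R_compl: "\<exists>b'. 0 \<sqsubseteq> b + b'"
begin

definition nfold :: "nat \<Rightarrow> 'a \<Rightarrow> 'a" where "nfold n a = (\<Sum>i<n. a)"

lemma nfold_0 [simp]: "nfold 0 a = 0" and nfold_Suc: "nfold (Suc n) a = nfold n a + a"
  by (simp_all add: nfold_def)

lemma nfold_1 [simp]: "nfold 1 a = a" "nfold (Suc 0) a = a"
  by (simp_all add: nfold_def)

lemma nfold_add: "nfold (m + n) a = nfold m a + nfold n a"
  by (induction n) (simp_all add: nfold_Suc ac_simps)

lemma nfold_plus: "nfold n (a + b) = nfold n a + nfold n b"
  by (simp add: nfold_def sum.distrib)

lemma nfold_nfold: "nfold m (nfold n a) = nfold (m * n) a"
  by (induction m) (simp_all add: nfold_Suc nfold_add ac_simps)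

lemma R_add2: "a \<sqsubseteq> b \<Longrightarrow> d \<sqsubseteq> e \<Longrightarrow> a + d \<sqsubseteq> b + e"
  by (metis R_add R_trans add.commute)

lemma R_nfold: "a \<sqsubseteq> b \<Longrightarrow> nfold n a \<sqsubseteq> nfold n b"
  by (induction n) (simp_all add: nfold_Suc R_refl R_add2)

text \<open>
  Doubling takes the place of positive homogeneity: it is what the rotation of two Gaussian variables
  by 45 degrees provides, and together with subadditivity it implies homogeneity for all natural
  multiples.
\<close>

definition sublinear :: "('a \<Rightarrow> real) \<Rightarrow> bool" where
  "sublinear S \<longleftrightarrow> (\<forall>a b. S (a + b) \<le> S a + S b) \<and> (\<forall>a. S (a + a) = 2 * S a)
     \<and> (\<forall>a b. a \<sqsubseteq> b \<longrightarrow> S a \<le> S b)"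

lemma sublinearD:
  assumes "sublinear S"
  shows "S (a + b) \<le> S a + S b" "S (a + a) = 2 * S a" "a \<sqsubseteq> b \<Longrightarrow> S a \<le> S b"
  using assms unfolding sublinear_def by blast+

lemma sublinear_0: "sublinear S \<Longrightarrow> S 0 = 0"
  using sublinearD(2)[of S 0] by simp

text \<open>
  Subadditivity gives one inequality. Repeated doubling gives the equality for powers of two, and
  splitting \<open>2 ^ n = n + (2 ^ n - n)\<close> transfers the other inequality to \<open>n\<close>.
\<close>

lemma sublinear_nfold:
  assumes S: "sublinear S"
  shows "S (nfold n a) = real n * S a"
proof (rule antisym)
  have upper: "S (nfold n a) \<le> real n * S a" for n
  proof (induction n)
    case 0
    then show ?case by (simp add: sublinear_0[OF S])
  next
    case (Suc n)
    have "S (nfold (Suc n) a) \<le> S (nfold n a) + S a"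
      using sublinearD(1)[OF S] by (simp add: nfold_Suc)
    with Suc show ?case by (simp add: algebra_simps)
  qed
  then show "S (nfold n a) \<le> real n * S a" .
  have pow: "S (nfold (2 ^ j) a) = 2 ^ j * S a" for j
  proof (induction j)
    case (Suc j)
    have "nfold (2 ^ Suc j) a = nfold (2 ^ j) a + nfold (2 ^ j) a"
      by (simp flip: nfold_add add: mult_2)
    then show ?case using Suc sublinearD(2)[OF S] by simp
  qed simp
  define m where "m = 2 ^ n - n"
  have nm: "2 ^ n = n + m" by (simp add: m_def)
  then have "real n + real m = 2 ^ n" by (metis of_nat_add of_nat_numeral of_nat_power)
  moreover have "2 ^ n * S a \<le> S (nfold n a) + S (nfold m a)"
    using sublinearD(1)[OF S, of "nfold n a" "nfold m a"] pow[of n] by (simp add: nm nfold_add)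
  moreover have "S (nfold m a) \<le> real m * S a" by (rule upper)
  ultimately have "(real n + real m) * S a \<le> S (nfold n a) + real m * S a" by simp
  then show "real n * S a \<le> S (nfold n a)" by (simp add: algebra_simps)
qed

text \<open>
  In a vector space \<open>flatten a S b\<close> would be \<open>inf\<^sub>t S (b + t a) - t S a\<close> over real \<open>t \<ge> 0\<close>. The quotient by
  \<open>n\<close> produces the rational multiples of \<open>a\<close>.
\<close>

definition slope :: "'a \<Rightarrow> ('a \<Rightarrow> real) \<Rightarrow> 'a \<Rightarrow> nat \<Rightarrow> nat \<Rightarrow> real" where
  "slope a S b n k = (S (nfold n b + nfold k a) - real k * S a) / real n"

definition flatten :: "'a \<Rightarrow> ('a \<Rightarrow> real) \<Rightarrow> 'a \<Rightarrow> real" where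
  "flatten a S b = Inf {slope a S b n k | n k. 0 < n}"

lemma slope_bound:
  assumes S: "sublinear S" and n: "0 < n" and b': "0 \<sqsubseteq> b + b'"
  shows "- S b' \<le> slope a S b n k"
proof -
  have "nfold k a \<sqsubseteq> nfold k a + nfold n (b + b')"
    using R_add2[OF R_refl R_nfold[OF b', of n]] by (simp add: nfold_def)
  then have "real k * S a \<le> S (nfold k a + nfold n (b + b'))"
    using sublinearD(3)[OF S] sublinear_nfold[OF S] by metis
  also have "\<dots> \<le> S (nfold n b + nfold k a) + S (nfold n b')"
    using sublinearD(1)[OF S, of "nfold n b + nfold k a" "nfold n b'"] by (simp add: nfold_plus ac_simps)
  finally have "- (S b' * n) \<le> S (nfold n b + nfold k a) - real k * S a"
    by (simp add: sublinear_nfold[OF S] ac_simps)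
  then show ?thesis using n by (simp add: slope_def field_simps)
qed

lemma bdd_slope:
  assumes S: "sublinear S"
  shows "bdd_below {slope a S b n k | n k. 0 < n}"
proof -
  obtain b' where "0 \<sqsubseteq> b + b'" using R_compl by blast
  then show ?thesis using slope_bound[OF S] by (intro bdd_belowI[where m="- S b'"]) blast
qed

lemma flatten_le:
  "sublinear S \<Longrightarrow> 0 < n \<Longrightarrow> flatten a S b \<le> slope a S b n k"
  unfolding flatten_def by (intro cInf_lower bdd_slope) auto

lemma flatten_ge:
  assumes "\<And>n k. 0 < n \<Longrightarrow> x \<le> slope a S b n k"
  shows "x \<le> flatten a S b"
  unfolding flatten_def by (rule cInf_greatest) (use assms in auto)

lemma flatten_le_self: "sublinear S \<Longrightarrow> flatten a S b \<le> S b"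
  using flatten_le[of S 1 a b 0] by (simp add: slope_def)

lemma flatten_subadd:
  assumes S: "sublinear S"
  shows "flatten a S (b + d) \<le> flatten a S b + flatten a S d"
proof -
  have *: "flatten a S (b + d) \<le> slope a S b n k + slope a S d m l" if "0 < n" "0 < m" for n k m l
  proof -
    have "flatten a S (b + d) \<le> slope a S (b + d) (n * m) (k * m + l * n)"
      using that by (intro flatten_le[OF S]) auto
    also have "\<dots> \<le> slope a S b n k + slope a S d m l"
    proof -
      have frac: "(m * X + n * Y - (k * m + l * n) * s) / (n * m) = (X - k * s) / n + (Y - l * s) / m"
        if "n \<noteq> 0" "m \<noteq> 0" for m n X Y k l s :: real
        using that by (simp add: field_simps)
      have "nfold (n * m) (b + d) + nfold (k * m + l * n) a
          = nfold m (nfold n b + nfold k a) + nfold n (nfold m d + nfold l a)"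
        by (simp add: nfold_plus nfold_nfold nfold_add ac_simps)
      then have "S (nfold (n * m) (b + d) + nfold (k * m + l * n) a)
          \<le> S (nfold m (nfold n b + nfold k a)) + S (nfold n (nfold m d + nfold l a))"
        using sublinearD(1)[OF S] by simp
      also have "\<dots> = m * S (nfold n b + nfold k a) + n * S (nfold m d + nfold l a)"
        by (simp only: sublinear_nfold[OF S])
      finally have "(S (nfold (n * m) (b + d) + nfold (k * m + l * n) a) - real (k * m + l * n) * S a) / (n * m)
          \<le> (m * S (nfold n b + nfold k a) + n * S (nfold m d + nfold l a) - real (k * m + l * n) * S a) / (n * m)"
        by (intro divide_right_mono) simp_all
      also have "\<dots> = slope a S b n k + slope a S d m l"
        using that frac[of "real n" "real m"] by (simp add: slope_def)
      finally show ?thesis by (simp add: slope_def)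
    qed
    finally show ?thesis .
  qed
  have "flatten a S (b + d) - slope a S d m l \<le> flatten a S b" if "0 < m" for m l
    by (rule flatten_ge) (use *[OF _ that] in \<open>simp add: algebra_simps\<close>)
  then have "flatten a S (b + d) - flatten a S b \<le> flatten a S d"
    by (intro flatten_ge) (simp add: algebra_simps)
  then show ?thesis by simp
qed

lemma sublinear_flatten:
  assumes S: "sublinear S"
  shows "sublinear (flatten a S)"
  unfolding sublinear_def
proof (intro conjI allI impI)
  show "flatten a S (b + d) \<le> flatten a S b + flatten a S d" for b d
    by (rule flatten_subadd[OF S])
  show "flatten a S (b + b) = 2 * flatten a S b" for b
  proof (rule antisym)
    show "flatten a S (b + b) \<le> 2 * flatten a S b"
      using flatten_subadd[OF S, of a b b] by simp
    show "2 * flatten a S b \<le> flatten a S (b + b)"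
    proof (rule flatten_ge)
      fix n k :: nat assume n: "0 < n"
      have "nfold n (b + b) = nfold (2 * n) b" by (simp add: nfold_plus mult_2 nfold_add)
      then have "slope a S (b + b) n k = 2 * slope a S b (2 * n) k"
        using n by (simp add: slope_def divide_simps)
      then show "2 * flatten a S b \<le> slope a S (b + b) n k"
        using flatten_le[OF S, of "2 * n" a b k] n by simp
    qed
  qed
  show "flatten a S b \<le> flatten a S d" if "b \<sqsubseteq> d" for b d
  proof (rule flatten_ge)
    fix n k :: nat assume n: "0 < n"
    have "S (nfold n b + nfold k a) \<le> S (nfold n d + nfold k a)"
      using that by (intro sublinearD(3)[OF S] R_add R_nfold)
    then have "slope a S b n k \<le> slope a S d n k"
      using n by (simp add: slope_def divide_right_mono)
    with flatten_le[OF S n, of a b k] show "flatten a S b \<le> slope a S d n k" by simp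
  qed
qed

lemma flatten_shift:
  assumes S: "sublinear S"
  shows "flatten a S (b + a) = flatten a S b + S a"
proof (rule antisym)
  have "flatten a S a \<le> S a" by (rule flatten_le_self[OF S])
  then show "flatten a S (b + a) \<le> flatten a S b + S a"
    using flatten_subadd[OF S, of a b a] by simp
  show "flatten a S b + S a \<le> flatten a S (b + a)"
  proof (rule flatten_ge)
    fix n k :: nat assume n: "0 < n"
    have "slope a S (b + a) n k = slope a S b n (n + k) + S a"
      using n by (simp add: slope_def nfold_plus nfold_add ac_simps diff_divide_distrib add_divide_distrib distrib_left)
    then show "flatten a S b + S a \<le> slope a S (b + a) n k"
      using flatten_le[OF S n, of a b "n + k"] by simp
  qed
qed

lemma flatten_keeps_shift:
  assumes S: "sublinear S" and y: "\<And>b. S (b + y) = S b + v"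
  shows "flatten a S (b + y) = flatten a S b + v"
proof -
  have nfold: "S (b + nfold n y) = S b + n * v" for n b
  proof (induction n)
    case (Suc n)
    have "S (b + nfold (Suc n) y) = S (b + nfold n y) + v"
      using y[of "b + nfold n y"] by (simp add: nfold_Suc add.assoc)
    with Suc show ?case by (simp add: distrib_right)
  qed simp
  have eq: "slope a S (b + y) n k = slope a S b n k + v" if "0 < n" for n k
  proof -
    have "S (nfold n (b + y) + nfold k a) = S ((nfold n b + nfold k a) + nfold n y)"
      by (simp add: nfold_plus ac_simps)
    then show ?thesis using that by (simp add: nfold slope_def diff_divide_distrib add_divide_distrib)
  qed
  show ?thesis
  proof (rule antisym)
    have "flatten a S (b + y) - v \<le> flatten a S b"
      by (rule flatten_ge) (use flatten_le[OF S, of _ a "b + y"] in \<open>simp add: eq diff_le_eq\<close>)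
    then show "flatten a S (b + y) \<le> flatten a S b + v" by simp
    show "flatten a S b + v \<le> flatten a S (b + y)"
      by (rule flatten_ge) (simp add: eq flatten_le[OF S])
  qed
qed

text \<open>
  Flattening makes a sublinear functional additive in one direction (\<open>flatten_shift\<close>). Flattening in
  the direction \<open>y\<close> first fixes the value at \<open>y\<close>. By Zorn's lemma there is a minimal sublinear
  functional with this value; it cannot be changed by flattening in any direction, so it is additive.
\<close>

theorem additive_minorant:
  assumes S0: "sublinear S0"
  obtains S where "\<And>a b. S (a + b) = S a + S b" "\<And>a. S a \<le> S0 a"
    "\<And>a b. a \<sqsubseteq> b \<Longrightarrow> S a \<le> S b" "S y = S0 y"
proof -
  define v where "v = S0 y"
  define S1 where "S1 = flatten y S0"
  \<comment> \<open>As \<open>S 0 = 0\<close>, the last condition at \<open>b = 0\<close> reads \<open>S y = S0 y\<close>.\<close>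
  define A where "A = {S. sublinear S \<and> (\<forall>b. S b \<le> S1 b) \<and> (\<forall>b. S (b + y) = S b + v)}"
  have S1: "S1 \<in> A"
    using sublinear_flatten[OF S0, of y] flatten_shift[OF S0, of y] by (simp add: A_def S1_def v_def)
  have S1_le: "S1 b \<le> S0 b" for b unfolding S1_def by (rule flatten_le_self[OF S0])
  have "\<exists>m\<in>A. \<forall>a\<in>A. m \<ge> a \<longrightarrow> a = m"
  proof (rule predicate_Zorn)
    show "partial_order_on A (relation_of (\<lambda>x y. y \<le> x) A)"
      by (rule partial_order_on_relation_ofI) auto
  next
    fix C assume C: "C \<in> Chains (relation_of (\<lambda>x y. y \<le> x) A)"
    have CA: "C \<subseteq> A" using C by (auto simp: Chains_def relation_of_def)
    have chain: "S \<le> T \<or> T \<le> S" if "S \<in> C" "T \<in> C" for S T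
      using C that by (auto simp: Chains_def relation_of_def)
    show "\<exists>u\<in>A. \<forall>a\<in>C. u \<le> a"
    proof (cases "C = {}")
      case True
      then show ?thesis using S1 by auto
    next
      case False
      define u where "u = (\<lambda>b. INF S\<in>C. S b)"
      have sub: "sublinear S" if "S \<in> C" for S using that CA by (auto simp: A_def)
      have bdd: "bdd_below ((\<lambda>S. S b) ` C)" for b
      proof -
        obtain b' where b': "0 \<sqsubseteq> b + b'" using R_compl by blast
        show ?thesis
        proof (rule bdd_belowI2[where m="- S0 b'"])
          fix S assume S: "S \<in> C"
          have "0 \<le> S b + S b'"
            using sublinearD(3)[OF sub[OF S] b'] sublinearD(1)[OF sub[OF S], of b b']
              sublinear_0[OF sub[OF S]] by simp
          moreover have "S b' \<le> S0 b'"
            using subsetD[OF CA S] S1_le[of b'] order_trans[of "S b'" "S1 b'" "S0 b'"] by (simp add: A_def)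
          ultimately show "- S0 b' \<le> S b" by simp
        qed
      qed
      have le: "u b \<le> S b" if "S \<in> C" for S b
        unfolding u_def using that by (intro cINF_lower bdd)
      have ge: "x \<le> u b" if "\<And>S. S \<in> C \<Longrightarrow> x \<le> S b" for x b
        unfolding u_def using that False by (intro cINF_greatest) auto
      have "sublinear u"
        unfolding sublinear_def
      proof (intro conjI allI impI)
        show "u (a + b) \<le> u a + u b" for a b
        proof -
          have *: "u (a + b) \<le> S a + T b" if "S \<in> C" "T \<in> C" for S T
          proof (cases "S \<le> T")
            case True
            then have "S b \<le> T b" by (simp add: le_fun_def)
            then show ?thesis
              using le[OF that(1), of "a + b"] sublinearD(1)[OF sub[OF that(1)], of a b] by simp
          next
            case False
            then have "T \<le> S" using chain[OF that] by blast
            then have "T a \<le> S a" by (simp add: le_fun_def)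
            then show ?thesis
              using le[OF that(2), of "a + b"] sublinearD(1)[OF sub[OF that(2)], of a b] by simp
          qed
          have "u (a + b) - T b \<le> u a" if "T \<in> C" for T
            by (rule ge) (use * that in \<open>simp add: algebra_simps\<close>)
          then have "u (a + b) - u a \<le> u b" by (intro ge) (simp add: algebra_simps)
          then show ?thesis by simp
        qed
        show "u (a + a) = 2 * u a" for a
        proof (rule antisym)
          have "u (a + a) / 2 \<le> u a"
          proof (rule ge)
            fix S assume "S \<in> C"
            then show "u (a + a) / 2 \<le> S a"
              using le[of S "a + a"] sublinearD(2)[OF sub, of S a] by simp
          qed
          then show "u (a + a) \<le> 2 * u a" by simp
          show "2 * u a \<le> u (a + a)"
          proof (rule ge)
            fix S assume "S \<in> C"
            then show "2 * u a \<le> S (a + a)"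
              using le[of S a] sublinearD(2)[OF sub, of S a] by simp
          qed
        qed
        show "u a \<le> u b" if "a \<sqsubseteq> b" for a b
        proof (rule ge)
          fix S assume "S \<in> C"
          then show "u a \<le> S b"
            using le[of S a] sublinearD(3)[OF sub that, of S] by simp
        qed
      qed
      moreover have "u b \<le> S1 b" for b
      proof -
        obtain S where "S \<in> C" using False by blast
        moreover from this have "S b \<le> S1 b" using CA by (auto simp: A_def)
        ultimately show ?thesis using le[of S b] by simp
      qed
      moreover have "u (b + y) = u b + v" for b
      proof (rule antisym)
        have "u (b + y) - v \<le> u b"
        proof (rule ge)
          fix S assume S: "S \<in> C"
          then have "S (b + y) = S b + v" using CA by (auto simp: A_def)
          then show "u (b + y) - v \<le> S b" using le[OF S, of "b + y"] by simp
        qed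
        then show "u (b + y) \<le> u b + v" by simp
        show "u b + v \<le> u (b + y)"
        proof (rule ge)
          fix S assume S: "S \<in> C"
          then have "S (b + y) = S b + v" using CA by (auto simp: A_def)
          then show "u b + v \<le> S (b + y)" using le[OF S, of b] by simp
        qed
      qed
      ultimately have "u \<in> A" by (simp add: A_def)
      then show ?thesis using le by (auto simp: le_fun_def)
    qed
  qed
  then obtain S where SA: "S \<in> A" and min: "\<And>T. T \<in> A \<Longrightarrow> T \<le> S \<Longrightarrow> T = S" by blast
  have S: "sublinear S" and le: "\<And>b. S b \<le> S1 b" and y: "\<And>b. S (b + y) = S b + v"
    using SA by (auto simp: A_def)
  have "flatten a S = S" for a
  proof (rule min)
    show "flatten a S \<in> A"
      using sublinear_flatten[OF S] flatten_keeps_shift[OF S y] order_trans[OF flatten_le_self[OF S] le]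
      by (simp add: A_def)
    show "flatten a S \<le> S" using flatten_le_self[OF S] by (simp add: le_fun_def)
  qed
  then have "S (b + a) = S b + S a" for a b
    using flatten_shift[OF S, of a b] by simp
  moreover have "S b \<le> S0 b" for b using order_trans[OF le S1_le] .
  moreover have "S y = S0 y" using y[of 0] sublinear_0[OF S] by (simp add: v_def)
  ultimately show thesis by (intro that[of S] sublinearD(3)[OF S])
qed

end

section \<open>Linear functionals and quadratic forms on normed spaces\<close>

text \<open>
  Comparing \<open>n * c\<close> with its integer part shows that \<open>n * (f (c *\<^sub>R x) - c * f x)\<close> stays bounded as
  \<open>n\<close> grows.
\<close>

lemma additive_imp_linear:
  fixes f :: "'a::real_normed_vector \<Rightarrow> real"
  assumes add: "\<And>x y. f (x + y) = f x + f y"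
    and bdd: "\<And>r. \<exists>K. \<forall>x. norm x \<le> r \<longrightarrow> \<bar>f x\<bar> \<le> K"
  shows "linear f"
proof
  show "f (x + y) = f x + f y" for x y by (rule add)
  have nat: "f (real n *\<^sub>R x) = real n * f x" for n x
  proof (induction n)
    case 0
    then show ?case using add[of 0 0] by simp
  next
    case (Suc n)
    then show ?case by (simp add: add scaleR_add_left algebra_simps)
  qed
  have neg: "f (- x) = - f x" for x
    using add[of x "- x"] add[of 0 0] by simp
  have int: "f (of_int k *\<^sub>R x) = of_int k * f x" for k x
  proof (cases k)
    case (nonneg n)
    then show ?thesis using nat by simp
  next
    case (neg n)
    then show ?thesis using nat[of "Suc n" x] \<open>f (- (real (Suc n) *\<^sub>R x)) = - f (real (Suc n) *\<^sub>R x)\<close>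
      by (simp del: of_nat_Suc)
  qed
  show "f (c *\<^sub>R x) = c *\<^sub>R f x" for c x
  proof -
    obtain K where K: "\<And>y. norm y \<le> norm x \<Longrightarrow> \<bar>f y\<bar> \<le> K" using bdd by blast
    have *: "real n * \<bar>f (c *\<^sub>R x) - c * f x\<bar> \<le> K + \<bar>f x\<bar>" for n
    proof -
      define t where "t = frac (n * c)"
      have t: "0 \<le> t" "t < 1" unfolding t_def by (simp_all add: frac_lt_1)
      have nc: "n * c = of_int \<lfloor>n * c\<rfloor> + t" by (simp add: t_def frac_def)
      have "n * f (c *\<^sub>R x) = f ((n * c) *\<^sub>R x)" using nat[of n "c *\<^sub>R x"] by simp
      also have "\<dots> = of_int \<lfloor>n * c\<rfloor> * f x + f (t *\<^sub>R x)"
        by (subst nc) (simp only: scaleR_add_left add int)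
      also have "of_int \<lfloor>n * c\<rfloor> = n * c - t" using nc by linarith
      finally have "n * (f (c *\<^sub>R x) - c * f x) = f (t *\<^sub>R x) - t * f x" by (simp add: algebra_simps)
      then have "real n * \<bar>f (c *\<^sub>R x) - c * f x\<bar> = \<bar>f (t *\<^sub>R x) - t * f x\<bar>"
        by (metis abs_mult abs_of_nat)
      also have "\<dots> \<le> \<bar>f (t *\<^sub>R x)\<bar> + \<bar>t * f x\<bar>" by simp
      also have "\<dots> \<le> K + \<bar>f x\<bar>"
        using t by (intro add_mono K) (auto simp: abs_mult mult_left_le_one_le)
      finally show ?thesis .
    qed
    have "\<bar>f (c *\<^sub>R x) - c * f x\<bar> = 0"
    proof (rule ccontr)
      assume "\<bar>f (c *\<^sub>R x) - c * f x\<bar> \<noteq> 0"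
      then have "0 < \<bar>f (c *\<^sub>R x) - c * f x\<bar>" by simp
      from reals_Archimedean3[OF this] obtain n :: nat
        where "K + \<bar>f x\<bar> < real n * \<bar>f (c *\<^sub>R x) - c * f x\<bar>" by blast
      with *[of n] show False by simp
    qed
    then show ?thesis by simp
  qed
qed

text \<open>
  The Hahn-Banach theorem for the norm: an additive functional below the norm is automatically linear.
\<close>

lemma norming_functional:
  fixes z :: "'a::real_normed_vector"
  obtains f :: "'a \<Rightarrow>\<^sub>L real" where "norm f \<le> 1" "blinfun_apply f z = norm z"
proof -
  interpret preordered_monoid "(=) :: 'a \<Rightarrow> 'a \<Rightarrow> bool"
  proof
    show "\<exists>b'. 0 = b + b'" for b :: 'a by (rule exI[of _ "- b"]) simp
  qed auto
  have "sublinear norm"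
  proof -
    have "norm (a + a) = 2 * norm a" for a :: 'a
      by (simp flip: scaleR_2)
    then show ?thesis by (simp add: sublinear_def norm_triangle_ineq)
  qed
  then obtain S where S: "\<And>a b. S (a + b) = S a + S b" "\<And>a. S a \<le> norm a" "S z = norm z"
    by (rule additive_minorant[of _ z]) blast
  have abs: "\<bar>S x\<bar> \<le> norm x" for x
    using S(1)[of x "- x"] S(1)[of 0 0] S(2)[of x] S(2)[of "- x"] by simp
  have "linear S"
    by (rule additive_imp_linear[OF S(1)]) (meson abs order_trans)
  then have bl: "bounded_linear S"
    by (intro bounded_linear_intro[of _ 1]) (simp_all add: linear_add linear_scale abs)
  show thesis
  proof (rule that[of "Blinfun S"])
    show "blinfun_apply (Blinfun S) z = norm z" by (simp add: bounded_linear_Blinfun_apply[OF bl] S)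
    show "norm (Blinfun S) \<le> 1"
      by (rule norm_blinfun_bound) (simp_all add: bounded_linear_Blinfun_apply[OF bl] abs)
  qed
qed

definition psd_form :: "('a::real_vector \<Rightarrow> 'a \<Rightarrow> real) \<Rightarrow> bool" where
  "psd_form B \<longleftrightarrow> (\<forall>x. linear (B x)) \<and> (\<forall>x y. B x y = B y x) \<and> (\<forall>x. 0 \<le> B x x)"

lemma psd_formD:
  assumes "psd_form B"
  shows "linear (B x)" "B x y = B y x" "0 \<le> B x x"
  using assms unfolding psd_form_def by blast+

lemma psd_form_expand:
  assumes B: "psd_form B"
  shows "B (x + y) (x + y) = B x x + 2 * B x y + B y y"
    and "B (x - y) (x - y) = B x x - 2 * B x y + B y y"
    and "B (t *\<^sub>R x) (t *\<^sub>R x) = t\<^sup>2 * B x x"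
proof -
  have l: "B z (x + y) = B z x + B z y" "B z (x - y) = B z x - B z y" "B z (t *\<^sub>R x) = t * B z x" for z x y t
    using psd_formD(1)[OF B, of z] by (simp_all add: linear_add linear_diff linear_scale)
  have r: "B (x + y) z = B x z + B y z" "B (x - y) z = B x z - B y z" "B (t *\<^sub>R x) z = t * B x z" for z x y t
    using l psd_formD(2)[OF B] by metis+
  show "B (x + y) (x + y) = B x x + 2 * B x y + B y y" "B (x - y) (x - y) = B x x - 2 * B x y + B y y"
    by (simp_all add: l r psd_formD(2)[OF B, of y x])
  show "B (t *\<^sub>R x) (t *\<^sub>R x) = t\<^sup>2 * B x x"
    by (simp add: l r power2_eq_square)
qed

text \<open>
  The Jordan-von Neumann theorem. Homogeneity of \<open>q\<close> is not assumed: polarization gives a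
  biadditive form, and the bound on \<open>q\<close> makes it linear in each variable.
\<close>

lemma psd_form_of_parallelogram:
  fixes q :: "'a::real_normed_vector \<Rightarrow> real"
  assumes par: "\<And>x y. q (x + y) + q (x - y) = 2 * q x + 2 * q y"
    and pos: "\<And>x. 0 \<le> q x" and bdd: "\<And>x. q x \<le> c * (norm x)\<^sup>2"
  obtains B where "psd_form B" "\<And>x. B x x = q x"
proof -
  define B where "B x y = (q (x + y) - q (x - y)) / 4" for x y
  have q0: "q 0 = 0" using bdd[of 0] pos[of 0] by simp
  have even: "q (- x) = q x" for x using par[of 0 x] by (simp add: q0)
  have even': "q (x - y) = q (y - x)" for x y using even[of "x - y"] by simp
  have sym: "B x y = B y x" for x y
    by (simp add: B_def add.commute even'[of x y])
  have diag: "B x x = q x" for x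
    using par[of x x] by (simp add: B_def q0)
  have add: "B (x + x') y = B x y + B x' y" for x x' y
  proof -
    have 1: "q (x + x' + y) + q (x + y - x') = 2 * q (x + y) + 2 * q x'"
      using par[of "x + y" x'] by (simp add: algebra_simps)
    have 2: "q (x + x' - y) + q (x - y - x') = 2 * q (x - y) + 2 * q x'"
      using par[of "x - y" x'] by (simp add: algebra_simps)
    have 3: "q (x + x' + y) + q (x' + y - x) = 2 * q (x' + y) + 2 * q x"
      using par[of "x' + y" x] by (simp add: algebra_simps)
    have 4: "q (x + x' - y) + q (x' - y - x) = 2 * q (x' - y) + 2 * q x"
      using par[of "x' - y" x] by (simp add: algebra_simps)
    have 5: "q (x' + y - x) = q (x - y - x')" "q (x' - y - x) = q (x + y - x')"
      using even'[of "x' + y" x] even'[of "x' - y" x] by (simp_all add: algebra_simps)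
    show ?thesis using 1 2 3 4 5 unfolding B_def by argo
  qed
  have q_le: "q x \<le> \<bar>c\<bar> * (norm x)\<^sup>2" for x
    using bdd[of x] mult_right_mono[OF abs_ge_self[of c], of "(norm x)\<^sup>2"] by simp
  have "linear (B x)" for x
  proof (rule additive_imp_linear)
    show "B x (y + z) = B x y + B x z" for y z
      using add[of y z x] by (simp add: sym)
    show "\<exists>K. \<forall>y. norm y \<le> r \<longrightarrow> \<bar>B x y\<bar> \<le> K" for r
    proof (intro exI allI impI)
      fix y :: 'a assume y: "norm y \<le> r"
      have le: "q z \<le> \<bar>c\<bar> * (norm x + r)\<^sup>2" if "norm z \<le> norm x + norm y" for z
      proof (rule order_trans[OF q_le])
        show "\<bar>c\<bar> * (norm z)\<^sup>2 \<le> \<bar>c\<bar> * (norm x + r)\<^sup>2"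
          using that y by (intro mult_left_mono power_mono) auto
      qed
      have "\<bar>q (x + y) - q (x - y)\<bar> \<le> \<bar>c\<bar> * (norm x + r)\<^sup>2"
        using le[of "x + y"] le[of "x - y"] pos[of "x + y"] pos[of "x - y"]
        by (simp add: norm_triangle_ineq norm_triangle_ineq4)
      then show "\<bar>B x y\<bar> \<le> \<bar>c\<bar> * (norm x + r)\<^sup>2" by (simp add: B_def)
    qed
  qed
  then have "psd_form B" using sym diag pos by (simp add: psd_form_def)
  then show thesis using diag by (rule that)
qed

text \<open>
  Completing the square at \<open>y\<close>: subtracting the square of \<open>B y x / sqrt (B y y)\<close> leaves a
  nonnegative form that vanishes at \<open>y\<close>.
\<close>

lemma psd_form_peel:
  assumes B: "psd_form B"
  obtains h where "linear h" "psd_form (\<lambda>x x'. B x x' - h x * h x')" "(h y)\<^sup>2 = B y y"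
proof (cases "B y y = 0")
  case True
  show thesis
    by (rule that[of "\<lambda>_. 0"]) (use B True in \<open>simp_all add: linear_0 linear_zero module_hom_zero\<close>)
next
  case False
  define h where "h x = B y x / sqrt (B y y)" for x
  have pos: "0 < B y y" using False psd_formD(3)[OF B, of y] by simp
  have h: "linear h" unfolding h_def
    using psd_formD(1)[OF B, of y] by (simp add: linear_iff add_divide_distrib)
  have 1: "linear (\<lambda>x'. B x x' - h x * h x')" for x
    using psd_formD(1)[OF B, of x] h by (simp add: linear_iff algebra_simps)
  have 2: "B x x' - h x * h x' = B x' x - h x' * h x" for x x'
    using psd_formD(2)[OF B] by (simp add: mult.commute)
  have 3: "0 \<le> B x x - h x * h x" for x
  proof -
    define t where "t = B y x / B y y"
    have "0 \<le> B (x - t *\<^sub>R y) (x - t *\<^sub>R y)" by (rule psd_formD(3)[OF B])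
    also have "\<dots> = B x x - 2 * (t * B y x) + t\<^sup>2 * B y y"
    proof -
      have "B x (t *\<^sub>R y) = t * B y x"
        using psd_formD(1)[OF B, of x] psd_formD(2)[OF B, of x y] by (simp add: linear_scale)
      then show ?thesis by (simp add: psd_form_expand[OF B])
    qed
    also have "\<dots> = B x x - h x * h x"
      using pos by (simp add: t_def h_def power2_eq_square field_simps)
    finally show ?thesis .
  qed
  show thesis
  proof (rule that[of h])
    show "psd_form (\<lambda>x x'. B x x' - h x * h x')" using 1 2 3 by (simp add: psd_form_def)
    show "(h y)\<^sup>2 = B y y" using pos by (simp add: h_def power2_eq_square)
  qed (rule h)
qed

text \<open>
  Squares are completed at one vector of the list after the other. Once the remaining form
  vanishes at \<open>y\<close>, the squares of the later functionals also vanish there, since they stay below that form.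
\<close>

lemma psd_form_sum_squares:
  assumes "psd_form B"
  shows "\<exists>hs. (\<forall>h\<in>set hs. linear h) \<and> (\<forall>x. (\<Sum>h\<leftarrow>hs. (h x)\<^sup>2) \<le> B x x)
    \<and> (\<forall>y\<in>set ys. (\<Sum>h\<leftarrow>hs. (h y)\<^sup>2) = B y y)"
  using assms
proof (induction ys arbitrary: B)
  case Nil
  then show ?case by (intro exI[of _ "[]"]) (simp add: psd_form_def)
next
  case (Cons y ys)
  obtain h where h: "linear h" "psd_form (\<lambda>x x'. B x x' - h x * h x')" "(h y)\<^sup>2 = B y y"
    using psd_form_peel[OF Cons.prems] .
  from Cons.IH[OF h(2)] obtain hs where hs: "\<forall>h\<in>set hs. linear h"
    "\<And>x. (\<Sum>h\<leftarrow>hs. (h x)\<^sup>2) \<le> B x x - h x * h x"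
    "\<And>z. z \<in> set ys \<Longrightarrow> (\<Sum>h\<leftarrow>hs. (h z)\<^sup>2) = B z z - h z * h z" by blast
  have "0 \<le> (\<Sum>h\<leftarrow>hs. (h y)\<^sup>2)" by (intro sum_list_nonneg) auto
  with hs(2)[of y] h(3) have "(\<Sum>h\<leftarrow>hs. (h y)\<^sup>2) = 0" by (simp add: power2_eq_square)
  then show ?case
    using h hs by (intro exI[of _ "h # hs"]) (auto simp: power2_eq_square add.commute le_diff_eq)
qed

section \<open>The Hilbert space of square-summable sequences\<close>

text \<open>
  This space serves as domain and as codomain of the operators to which the pre-Hilbert-Schmidt
  property is applied.
\<close>

typedef ell2 = "{a :: nat \<Rightarrow> real. summable (\<lambda>n. (a n)\<^sup>2)}"
  morphisms coord Ell2
  by (rule exI[of _ "\<lambda>_. 0"]) simp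

setup_lifting type_definition_ell2

lemma summable_coord: "summable (\<lambda>n. (coord a n)\<^sup>2)"
  using coord[of a] by simp

lemma summable_prod:
  fixes a b :: "nat \<Rightarrow> real"
  assumes "summable (\<lambda>n. (a n)\<^sup>2)" "summable (\<lambda>n. (b n)\<^sup>2)"
  shows "summable (\<lambda>n. a n * b n)"
proof (rule summable_comparison_test'[where N=0])
  show "summable (\<lambda>n. (a n)\<^sup>2 + (b n)\<^sup>2)" using assms by (rule summable_add)
  show "norm (a n * b n) \<le> (a n)\<^sup>2 + (b n)\<^sup>2" for n
  proof -
    have "0 \<le> \<bar>a n\<bar> * \<bar>b n\<bar>" by simp
    then show ?thesis
      using sum_squares_bound[of "\<bar>a n\<bar>" "\<bar>b n\<bar>"] unfolding real_norm_def abs_mult power2_abs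
      by linarith
  qed
qed

instantiation ell2 :: real_vector
begin

lift_definition zero_ell2 :: ell2 is "\<lambda>_. 0" by simp

lift_definition plus_ell2 :: "ell2 \<Rightarrow> ell2 \<Rightarrow> ell2" is "\<lambda>a b n. a n + b n"
proof -
  fix a b :: "nat \<Rightarrow> real"
  assume "summable (\<lambda>n. (a n)\<^sup>2)" "summable (\<lambda>n. (b n)\<^sup>2)"
  then have "summable (\<lambda>n. (a n)\<^sup>2 + (b n)\<^sup>2 + 2 * (a n * b n))"
    by (intro summable_add summable_mult summable_prod)
  then show "summable (\<lambda>n. (a n + b n)\<^sup>2)" by (simp add: power2_sum mult.assoc)
qed

lift_definition scaleR_ell2 :: "real \<Rightarrow> ell2 \<Rightarrow> ell2" is "\<lambda>c a n. c * a n"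
  by (simp add: power_mult_distrib summable_mult)

lift_definition uminus_ell2 :: "ell2 \<Rightarrow> ell2" is "\<lambda>a n. - a n" by simp

definition minus_ell2 :: "ell2 \<Rightarrow> ell2 \<Rightarrow> ell2" where "minus_ell2 a b = a + - b"

instance
proof
  fix a b c :: ell2 and r s :: real
  show "a + b + c = a + (b + c)" by transfer (simp add: add.assoc)
  show "a + b = b + a" by transfer (simp add: add.commute)
  show "0 + a = a" by transfer simp
  show "- a + a = 0" by transfer simp
  show "a - b = a + - b" by (rule minus_ell2_def)
  show "r *\<^sub>R (a + b) = r *\<^sub>R a + r *\<^sub>R b" by transfer (simp add: distrib_left)
  show "(r + s) *\<^sub>R a = r *\<^sub>R a + s *\<^sub>R a" by transfer (simp add: distrib_right)
  show "r *\<^sub>R s *\<^sub>R a = (r * s) *\<^sub>R a" by transfer (simp add: mult.assoc)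
  show "1 *\<^sub>R a = a" by transfer simp
qed

end

instantiation ell2 :: real_inner
begin

definition inner_ell2 :: "ell2 \<Rightarrow> ell2 \<Rightarrow> real" where
  "inner_ell2 a b = (\<Sum>n. coord a n * coord b n)"

definition norm_ell2 :: "ell2 \<Rightarrow> real" where "norm_ell2 a = sqrt (a \<bullet> a)"

definition sgn_ell2 :: "ell2 \<Rightarrow> ell2" where "sgn_ell2 a = a /\<^sub>R norm a"

definition dist_ell2 :: "ell2 \<Rightarrow> ell2 \<Rightarrow> real" where "dist_ell2 a b = norm (a - b)"

definition uniformity_ell2 :: "(ell2 \<times> ell2) filter" where
  "uniformity_ell2 = (INF e\<in>{0<..}. principal {(x, y). dist x y < e})"

definition open_ell2 :: "ell2 set \<Rightarrow> bool" where
  "open_ell2 U \<longleftrightarrow> (\<forall>x\<in>U. \<forall>\<^sub>F (x', y) in uniformity. x' = x \<longrightarrow> y \<in> U)"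

instance
proof
  fix a b c :: ell2 and r :: real
  show "dist a b = norm (a - b)" by (rule dist_ell2_def)
  show "sgn a = inverse (norm a) *\<^sub>R a" by (rule sgn_ell2_def)
  show "uniformity = (INF e\<in>{0<..}. principal {(x::ell2, y). dist x y < e})"
    by (rule uniformity_ell2_def)
  show "open U \<longleftrightarrow> (\<forall>x\<in>U. \<forall>\<^sub>F (x', y) in uniformity. x' = x \<longrightarrow> y \<in> U)" for U :: "ell2 set"
    by (rule open_ell2_def)
  show "a \<bullet> b = b \<bullet> a" by (simp add: inner_ell2_def mult.commute)
  have sp: "summable (\<lambda>n. coord x n * coord y n)" for x y
    by (intro summable_prod summable_coord)
  show "(a + b) \<bullet> c = a \<bullet> c + b \<bullet> c"
    unfolding inner_ell2_def plus_ell2.rep_eq distrib_right by (rule suminf_add[OF sp sp, symmetric])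
  show "(r *\<^sub>R a) \<bullet> b = r * (a \<bullet> b)"
    unfolding inner_ell2_def scaleR_ell2.rep_eq mult.assoc by (rule suminf_mult[OF sp])
  show "0 \<le> a \<bullet> a"
    unfolding inner_ell2_def by (rule suminf_nonneg[OF sp]) simp
  show "a \<bullet> a = 0 \<longleftrightarrow> a = 0"
  proof
    assume "a \<bullet> a = 0"
    then have "\<forall>n. coord a n * coord a n = 0"
      unfolding inner_ell2_def by (subst (asm) suminf_eq_zero_iff[OF sp]) simp_all
    then show "a = 0" unfolding coord_inject[symmetric] zero_ell2.rep_eq by (simp add: fun_eq_iff)
  qed (simp add: inner_ell2_def zero_ell2.rep_eq)
  show "norm a = sqrt (a \<bullet> a)" by (rule norm_ell2_def)
qed

end

lemma coord_simps [simp]: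
  "coord (a + b) n = coord a n + coord b n" "coord (a - b) n = coord a n - coord b n"
  "coord (c *\<^sub>R a) n = c * coord a n" "coord 0 n = 0"
  unfolding minus_ell2_def plus_ell2.rep_eq scaleR_ell2.rep_eq zero_ell2.rep_eq uminus_ell2.rep_eq
  by simp_all

lemma coord_eqI: "(\<And>n. coord a n = coord b n) \<Longrightarrow> a = b"
  by (simp add: coord_inject[symmetric] fun_eq_iff)

lemma norm_ell2_power2: "(norm (a::ell2))\<^sup>2 = (\<Sum>n. (coord a n)\<^sup>2)"
  unfolding power2_norm_eq_inner inner_ell2_def by (simp add: power2_eq_square)

lemma coord_sum [simp]: "coord (\<Sum>i\<in>I. a i) n = (\<Sum>i\<in>I. coord (a i) n)"
  by (induction I rule: infinite_finite_induct) simp_all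

lemma sum_coord_le: "finite I \<Longrightarrow> (\<Sum>n\<in>I. (coord a n)\<^sup>2) \<le> (norm a)\<^sup>2"
  unfolding norm_ell2_power2 by (rule sum_le_suminf) (simp_all add: summable_coord)

lemma abs_coord_le: "\<bar>coord a n\<bar> \<le> norm a"
  using sum_coord_le[of "{n}" a] by (simp add: abs_le_square_iff[symmetric])

lemma norm_ell2_le:
  assumes "\<And>N. (\<Sum>n<N. (a n)\<^sup>2) \<le> K\<^sup>2" "0 \<le> K"
  shows "coord (Ell2 a) = a" "norm (Ell2 a) \<le> K"
proof -
  have s: "summable (\<lambda>n. (a n)\<^sup>2)" by (rule summableI_nonneg_bounded) (use assms in auto)
  then show eq: "coord (Ell2 a) = a" by (simp add: Ell2_inverse)
  have "(norm (Ell2 a))\<^sup>2 \<le> K\<^sup>2"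
    unfolding norm_ell2_power2 eq by (rule suminf_le_const[OF s assms(1)])
  then show "norm (Ell2 a) \<le> K" using assms(2) by (rule power2_le_imp_le)
qed

instance ell2 :: complete_space
proof
  fix X :: "nat \<Rightarrow> ell2" assume X: "Cauchy X"
  have "Cauchy (\<lambda>k. coord (X k) n)" for n
  proof (rule metric_CauchyI)
    fix e :: real assume "0 < e"
    then obtain M where M: "\<And>k l. k \<ge> M \<Longrightarrow> l \<ge> M \<Longrightarrow> dist (X k) (X l) < e"
      using metric_CauchyD[OF X] by blast
    have "dist (coord (X k) n) (coord (X l) n) \<le> dist (X k) (X l)" for k l
      using abs_coord_le[of "X k - X l" n] by (simp add: dist_norm)
    then show "\<exists>M. \<forall>k\<ge>M. \<forall>l\<ge>M. dist (coord (X k) n) (coord (X l) n) < e"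
      using M by (meson le_less_trans)
  qed
  then have "\<exists>l. (\<lambda>k. coord (X k) n) \<longlonglongrightarrow> l" for n
    using Cauchy_convergent convergent_def by blast
  then obtain a where a: "\<And>n. (\<lambda>k. coord (X k) n) \<longlonglongrightarrow> a n" by metis
  have close: "\<exists>M. \<forall>k\<ge>M. \<forall>N. (\<Sum>n<N. (coord (X k) n - a n)\<^sup>2) \<le> e\<^sup>2" if e: "0 < e" for e
  proof -
    obtain M where M: "\<And>k l. k \<ge> M \<Longrightarrow> l \<ge> M \<Longrightarrow> dist (X k) (X l) < e"
      using metric_CauchyD[OF X e] by blast
    have "(\<Sum>n<N. (coord (X k) n - a n)\<^sup>2) \<le> e\<^sup>2" if "k \<ge> M" for k N
    proof (rule LIMSEQ_le_const2)
      show "(\<lambda>l. \<Sum>n<N. (coord (X k) n - coord (X l) n)\<^sup>2) \<longlonglongrightarrow> (\<Sum>n<N. (coord (X k) n - a n)\<^sup>2)"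
        by (intro tendsto_intros a)
      have "(\<Sum>n<N. (coord (X k) n - coord (X l) n)\<^sup>2) \<le> e\<^sup>2" if "l \<ge> M" for l
      proof -
        have "(\<Sum>n<N. (coord (X k - X l) n)\<^sup>2) \<le> (norm (X k - X l))\<^sup>2" by (intro sum_coord_le) simp
        also have "\<dots> \<le> e\<^sup>2"
          using M[OF \<open>k \<ge> M\<close> that] by (intro power_mono) (simp_all add: dist_norm)
        finally show ?thesis by simp
      qed
      then show "\<exists>L. \<forall>l\<ge>L. (\<Sum>n<N. (coord (X k) n - coord (X l) n)\<^sup>2) \<le> e\<^sup>2" by blast
    qed
    then show ?thesis by blast
  qed
  obtain M where "\<And>N. (\<Sum>n<N. (coord (X M) n - a n)\<^sup>2) \<le> 1\<^sup>2" using close[of 1] by auto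
  then have d: "coord (Ell2 (\<lambda>n. coord (X M) n - a n)) = (\<lambda>n. coord (X M) n - a n)"
    by (intro norm_ell2_le(1)[of _ 1]) auto
  define L where "L = X M - Ell2 (\<lambda>n. coord (X M) n - a n)"
  have L: "coord L = a" by (simp add: L_def d fun_eq_iff)
  have "X \<longlonglongrightarrow> L"
  proof (rule metric_LIMSEQ_I)
    fix e :: real assume e: "0 < e"
    then obtain M where M: "\<And>k N. k \<ge> M \<Longrightarrow> (\<Sum>n<N. (coord (X k) n - a n)\<^sup>2) \<le> (e/2)\<^sup>2"
      using close[of "e/2"] by auto
    have "dist (X k) L < e" if "k \<ge> M" for k
    proof -
      have "X k - L = Ell2 (\<lambda>n. coord (X k) n - a n)"
        using norm_ell2_le(1)[OF M[OF that]] e by (intro coord_eqI) (simp add: L)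
      then have "norm (X k - L) \<le> e/2" using norm_ell2_le(2)[OF M[OF that]] e by simp
      then show ?thesis using e by (simp add: dist_norm)
    qed
    then show "\<exists>M. \<forall>k\<ge>M. dist (X k) L < e" by blast
  qed
  then show "convergent X" by (auto simp: convergent_def)
qed

definition unit_vec :: "nat \<Rightarrow> ell2" where
  "unit_vec n = Ell2 (\<lambda>k. if k = n then 1 else 0)"

lemma coord_unit_vec [simp]: "coord (unit_vec n) k = (if k = n then 1 else 0)"
proof -
  have "(\<Sum>k<N. (if k = n then 1 else 0::real)\<^sup>2) \<le> 1\<^sup>2" for N
    by (simp add: if_distrib[of "\<lambda>x. x\<^sup>2"] cong: if_cong)
  from norm_ell2_le(1)[OF this] show ?thesis by (simp add: unit_vec_def)
qed

lemma norm_sum_unit_vec: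
  "(norm (\<Sum>n<N. c n *\<^sub>R unit_vec n))\<^sup>2 = (\<Sum>n<N. (c n)\<^sup>2)"
proof -
  have "coord (\<Sum>n<N. c n *\<^sub>R unit_vec n) k = (if k < N then c k else 0)" for k
    by (simp add: if_distrib cong: if_cong)
  then have "(norm (\<Sum>n<N. c n *\<^sub>R unit_vec n))\<^sup>2 = (\<Sum>k. (if k < N then c k else 0)\<^sup>2)"
    by (simp only: norm_ell2_power2)
  also have "\<dots> = (\<Sum>k<N. (if k < N then c k else 0)\<^sup>2)"
    by (rule suminf_finite) auto
  finally show ?thesis by simp
qed

section \<open>Bounded functionals on an orthonormal basis\<close>

text \<open>
  The vector \<open>a\<close> is the sum of its Fourier series along \<open>B\<close>, and the bound is the Cauchy-Schwarz
  inequality for the series of \<open>\<phi> a\<close>. An uncountable \<open>B\<close> is handled by finite subsets along which the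
  Bessel sums of \<open>a\<close> tend to their supremum. The lemma compares the values of \<open>\<phi>\<close> on a basis about
  which nothing else is known with its values elsewhere.
\<close>

lemma functional_le_orthonormal:
  fixes \<phi> :: "'a::{real_inner,complete_space} \<Rightarrow> real" and B :: "'a set"
  assumes \<phi>: "bounded_linear \<phi>"
    and orth: "\<And>b c. b \<in> B \<Longrightarrow> c \<in> B \<Longrightarrow> b \<bullet> c = (if b = c then 1 else 0)"
    and maximal: "\<And>x. (\<And>b. b \<in> B \<Longrightarrow> x \<bullet> b = 0) \<Longrightarrow> x = 0"
    and C: "\<And>S. finite S \<Longrightarrow> S \<subseteq> B \<Longrightarrow> (\<Sum>b\<in>S. (\<phi> b)\<^sup>2) \<le> C"
  shows "(\<phi> a)\<^sup>2 \<le> C * (norm a)\<^sup>2"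
proof -
  define P where "P S = (\<Sum>b\<in>S. (a \<bullet> b) *\<^sub>R b)" for S
  have PP: "P S \<bullet> P T = (\<Sum>b\<in>S\<inter>T. (a \<bullet> b)\<^sup>2)" if "finite S" "finite T" "S \<subseteq> B" "T \<subseteq> B" for S T
  proof -
    have "P S \<bullet> P T = (\<Sum>b\<in>S. \<Sum>c\<in>T. (a \<bullet> b) * (a \<bullet> c) * (b \<bullet> c))"
      unfolding P_def inner_sum_left by (intro sum.cong refl) (simp add: inner_sum_right sum_distrib_left ac_simps)
    also have "\<dots> = (\<Sum>b\<in>S. \<Sum>c\<in>T. if b = c then (a \<bullet> b)\<^sup>2 else 0)"
      using that by (intro sum.cong refl) (auto simp: orth subset_iff power2_eq_square)
    also have "\<dots> = (\<Sum>b\<in>S\<inter>T. (a \<bullet> b)\<^sup>2)"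
      using that by (simp flip: sum.inter_restrict)
    finally show ?thesis .
  qed
  have aP: "a \<bullet> P S = (\<Sum>b\<in>S. (a \<bullet> b)\<^sup>2)" for S
    by (simp add: P_def inner_sum_right power2_eq_square)
  have bessel: "(\<Sum>b\<in>S. (a \<bullet> b)\<^sup>2) \<le> (norm a)\<^sup>2" if S: "finite S" "S \<subseteq> B" for S
  proof -
    have "0 \<le> (a - P S) \<bullet> (a - P S)" by simp
    also have "\<dots> = (norm a)\<^sup>2 - (\<Sum>b\<in>S. (a \<bullet> b)\<^sup>2)"
      using PP[OF S(1) S(1) S(2) S(2)] aP[of S]
      by (simp add: inner_diff_left inner_diff_right inner_commute[of "P S" a] power2_norm_eq_inner)
    finally show ?thesis by simp
  qed
  have C0: "0 \<le> C" using C[of "{}"] by simp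
  define F where "F = {S. finite S \<and> S \<subseteq> B}"
  define sup where "sup = (SUP S\<in>F. \<Sum>b\<in>S. (a \<bullet> b)\<^sup>2)"
  have bdd: "bdd_above ((\<lambda>S. \<Sum>b\<in>S. (a \<bullet> b)\<^sup>2) ` F)"
    using bessel by (intro bdd_aboveI2[of _ _ "(norm a)\<^sup>2"]) (auto simp: F_def)
  have le_sup: "(\<Sum>b\<in>S. (a \<bullet> b)\<^sup>2) \<le> sup" if "S \<in> F" for S
    unfolding sup_def using that by (intro cSUP_upper bdd)
  have "\<exists>S\<in>F. sup - 1 / real (Suc n) < (\<Sum>b\<in>S. (a \<bullet> b)\<^sup>2)" for n
  proof -
    have ne: "F \<noteq> {}" by (auto simp: F_def)
    have "sup - 1 / real (Suc n) < sup" by simp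
    then show ?thesis unfolding sup_def by (subst (asm) less_cSUP_iff[OF ne bdd[unfolded sup_def]]) simp
  qed
  then obtain G where G: "\<And>n. G n \<in> F" "\<And>n. sup - 1 / real (Suc n) < (\<Sum>b\<in>G n. (a \<bullet> b)\<^sup>2)" by metis
  define H where "H n = (\<Union>i\<le>n. G i)" for n
  have HF: "H n \<in> F" for n using G(1) by (auto simp: H_def F_def)
  have Hmono: "H m \<subseteq> H n" if "m \<le> n" for m n using that unfolding H_def by (intro UN_mono) auto
  have Hsup: "sup - 1 / real (Suc n) < (\<Sum>b\<in>H n. (a \<bullet> b)\<^sup>2)" for n
  proof -
    have "(\<Sum>b\<in>G n. (a \<bullet> b)\<^sup>2) \<le> (\<Sum>b\<in>H n. (a \<bullet> b)\<^sup>2)"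
      using HF[of n] by (intro sum_mono2) (auto simp: H_def F_def)
    with G(2)[of n] show ?thesis by linarith
  qed
  have fin: "finite (H n)" "H n \<subseteq> B" for n using HF[of n] by (auto simp: F_def)
  have dist: "(norm (P (H n) - P (H m)))\<^sup>2 < 1 / real (Suc m)" if "m \<le> n" for m n
  proof -
    have "(norm (P (H n) - P (H m)))\<^sup>2 = (\<Sum>b\<in>H n. (a \<bullet> b)\<^sup>2) - (\<Sum>b\<in>H m. (a \<bullet> b)\<^sup>2)"
      using Hmono[OF that]
      by (simp add: power2_norm_eq_inner inner_diff_left inner_diff_right PP fin Int_absorb1 Int_absorb2)
    then show ?thesis using le_sup[OF HF[of n]] Hsup[of m] by linarith
  qed
  have "Cauchy (\<lambda>n. P (H n))"
  proof (rule CauchyI')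
    fix e :: real assume e: "0 < e"
    then obtain M where M: "1 / real (Suc M) < e\<^sup>2" using nat_approx_posE[of "e\<^sup>2"] by auto
    have "dist (P (H m)) (P (H n)) < e" if "m \<ge> M" "n > m" for m n
    proof -
      have "1 / real (Suc m) \<le> 1 / real (Suc M)" using that by (intro divide_left_mono) auto
      with dist[of m n] that M have "(norm (P (H n) - P (H m)))\<^sup>2 < e\<^sup>2" by simp
      then show ?thesis using e by (simp add: dist_norm norm_minus_commute power2_less_imp_less)
    qed
    then show "\<exists>M. \<forall>m\<ge>M. \<forall>n>m. dist (P (H m)) (P (H n)) < e" by blast
  qed
  then obtain s where s: "(\<lambda>n. P (H n)) \<longlonglongrightarrow> s" using Cauchy_convergent convergent_def by blast
  have "a - s = 0"
  proof (rule maximal)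
    fix b assume b: "b \<in> B"
    have Pb: "P S \<bullet> b = (if b \<in> S then a \<bullet> b else 0)" if "finite S" "S \<subseteq> B" for S
    proof -
      have "P S \<bullet> b = (\<Sum>c\<in>S. if c = b then a \<bullet> b else 0)"
        unfolding P_def inner_sum_left using that b
        by (intro sum.cong refl) (auto simp: orth subset_iff)
      then show ?thesis using that by simp
    qed
    have lim: "(\<lambda>n. P (H n) \<bullet> b) \<longlonglongrightarrow> s \<bullet> b" by (intro tendsto_intros s)
    have "s \<bullet> b = a \<bullet> b"
    proof (cases "\<exists>m. b \<in> H m")
      case True
      then obtain m where m: "b \<in> H m" ..
      have "\<forall>\<^sub>F n in sequentially. P (H n) \<bullet> b = a \<bullet> b"
        using eventually_ge_at_top[of m] by eventually_elim (use m Hmono in \<open>auto simp: Pb fin\<close>)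
      then have "(\<lambda>n. P (H n) \<bullet> b) \<longlonglongrightarrow> a \<bullet> b" by (rule tendsto_eventually)
      with lim show ?thesis by (rule LIMSEQ_unique)
    next
      case False
      then have "s \<bullet> b = 0" using lim by (simp add: Pb fin LIMSEQ_const_iff)
      moreover have "(a \<bullet> b)\<^sup>2 \<le> 0"
      proof (rule LIMSEQ_le_const)
        show "(\<lambda>n. 1 / real (Suc n)) \<longlonglongrightarrow> 0"
          using LIMSEQ_inverse_real_of_nat by (simp add: inverse_eq_divide)
        have "(a \<bullet> b)\<^sup>2 \<le> 1 / real (Suc n)" for n
        proof -
          have "insert b (H n) \<in> F" using b fin by (auto simp: F_def)
          from le_sup[OF this] have "(a \<bullet> b)\<^sup>2 + (\<Sum>b\<in>H n. (a \<bullet> b)\<^sup>2) \<le> sup"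
            using False fin by simp
          with Hsup[of n] show ?thesis by linarith
        qed
        then show "\<exists>N. \<forall>n\<ge>N. (a \<bullet> b)\<^sup>2 \<le> 1 / real (Suc n)" by blast
      qed
      ultimately show ?thesis by simp
    qed
    then show "(a - s) \<bullet> b = 0" by (simp add: inner_diff_left)
  qed
  then have sa: "s = a" by simp
  have "(\<phi> (P (H n)))\<^sup>2 \<le> C * (norm a)\<^sup>2" for n
  proof -
    interpret bounded_linear \<phi> by fact
    have "(\<phi> (P (H n)))\<^sup>2 = (\<Sum>b\<in>H n. (a \<bullet> b) * \<phi> b)\<^sup>2"
      by (simp add: P_def sum scale)
    also have "\<dots> \<le> (\<Sum>b\<in>H n. (a \<bullet> b)\<^sup>2) * (\<Sum>b\<in>H n. (\<phi> b)\<^sup>2)"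
      by (rule Cauchy_Schwarz_ineq_sum)
    also have "\<dots> \<le> (norm a)\<^sup>2 * C"
      using bessel C fin by (intro mult_mono sum_nonneg) auto
    finally show ?thesis by (simp add: mult.commute)
  qed
  moreover have "(\<lambda>n. (\<phi> (P (H n)))\<^sup>2) \<longlonglongrightarrow> (\<phi> a)\<^sup>2"
    using bounded_linear.tendsto[OF \<phi> s] by (intro tendsto_power) (simp add: sa)
  ultimately show ?thesis by (intro LIMSEQ_le_const2) auto
qed

section \<open>Pre-Hilbert-Schmidt operators on weakly 2-summable sequences\<close>

text \<open>
  Transport of structure along an injection. It realizes the sequence space inside the universe of the
  Hilbert spaces over which pre-Hilbert-Schmidt operators quantify.
\<close>

definition carry_hilbert :: "('a::real_inner \<Rightarrow> 'h) \<Rightarrow> 'h hilbert" where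
  "carry_hilbert J = \<lparr>carr = range J, hzero = J 0, hadd = (\<lambda>x y. J (inv J x + inv J y)),
     hscale = (\<lambda>c x. J (c *\<^sub>R inv J x)), hinner = (\<lambda>x y. inv J x \<bullet> inv J y)\<rparr>"

lemma carry_hilbert_simps [simp]:
  assumes "inj J"
  shows "carr (carry_hilbert J) = range J" "hzero (carry_hilbert J) = J 0"
    "hadd (carry_hilbert J) (J x) (J y) = J (x + y)" "hscale (carry_hilbert J) c (J x) = J (c *\<^sub>R x)"
    "hinner (carry_hilbert J) (J x) (J y) = x \<bullet> y"
    "hnorm (carry_hilbert J) (J x) = norm x" "hdist (carry_hilbert J) (J x) (J y) = dist x y"
  using assms by (simp_all add: carry_hilbert_def hnorm_def hdist_def norm_eq_sqrt_inner dist_norm)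

lemma hilbert_space_carry:
  fixes J :: "'a::{real_inner,complete_space} \<Rightarrow> 'h"
  assumes J: "inj J"
  shows "hilbert_space (carry_hilbert J)"
proof
  let ?H = "carry_hilbert J"
  note [simp] = carry_hilbert_simps[OF J]
  have d: "hdist ?H = (\<lambda>x y. dist (inv J x) (inv J y))"
    by (intro ext) (simp add: hdist_def hnorm_def carry_hilbert_def J dist_norm norm_eq_sqrt_inner)
  interpret Metric_space "range J" "hdist ?H"
    unfolding d by unfold_locales (auto simp: J dist_commute dist_triangle)
  have "mcomplete"
    unfolding mcomplete_def
  proof (intro allI impI)
    fix \<sigma> assume \<sigma>: "MCauchy \<sigma>"
    have eq: "\<sigma> n = J (inv J (\<sigma> n))" for n
      using \<sigma> by (metis MCauchy_def f_inv_into_f range_subsetD)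
    define s where "s n = inv J (\<sigma> n)" for n
    have \<sigma>s: "\<sigma> = (\<lambda>n. J (s n))" using eq by (auto simp: s_def)
    have "Cauchy s"
      using \<sigma> by (auto simp: MCauchy_def \<sigma>s Cauchy_def)
    then obtain l where l: "s \<longlonglongrightarrow> l" using Cauchy_convergent convergent_def by blast
    have "limitin mtopology \<sigma> (J l) sequentially"
      using l by (auto simp: limit_metric_sequentially \<sigma>s lim_sequentially)
    then show "\<exists>x. limitin mtopology \<sigma> x sequentially" ..
  qed
  then show "Metric_space.mcomplete (carr ?H) (hdist ?H)" by simp
qed (auto simp: carry_hilbert_simps[OF J] algebra_simps inner_commute inner_add_left)

text \<open>
  A sequence of reals is a sequence of sets of natural numbers, which is coded by one such set.
\<close>

lemma ell2_lepoll:
  assumes "(UNIV :: real set) \<lesssim> (UNIV :: 'h set)"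
  obtains J :: "ell2 \<Rightarrow> 'h" where "inj J"
proof -
  obtain i :: "real \<Rightarrow> nat set" where i: "inj i"
    using nat_sets_eqpoll_reals eqpoll_imp_lepoll eqpoll_sym unfolding lepoll_def by (metis subset_UNIV)
  obtain j :: "nat set \<Rightarrow> real" where j: "inj j"
    using nat_sets_eqpoll_reals eqpoll_imp_lepoll unfolding lepoll_def by (metis subset_UNIV)
  obtain k :: "real \<Rightarrow> 'h" where k: "inj k"
    using assms unfolding lepoll_def by blast
  define c where "c a = {m. snd (prod_decode m) \<in> i (coord a (fst (prod_decode m)))}" for a
  have "inj c"
  proof (rule injI)
    fix a b assume "c a = c b"
    then have "prod_encode (n, l) \<in> c a \<longleftrightarrow> prod_encode (n, l) \<in> c b" for n l by simp
    then have "i (coord a n) = i (coord b n)" for n by (auto simp: c_def)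
    then show "a = b" using i by (intro coord_eqI) (simp add: inj_eq)
  qed
  then have "inj (k \<circ> j \<circ> c)" using j k by (intro inj_compose)
  then show thesis by (rule that)
qed

lemma weakly_2_summable_bound:
  fixes x :: "nat \<Rightarrow> 'e::real_normed_vector"
  assumes "weakly_2_summable x"
  obtains K where "0 \<le> K" "\<And>N (f::'e \<Rightarrow>\<^sub>L real). norm f \<le> 1 \<Longrightarrow> (\<Sum>n<N. (blinfun_apply f (x n))\<^sup>2) \<le> K\<^sup>2"
proof -
  define S where "S = (SUP f \<in> {f :: 'e \<Rightarrow>\<^sub>L real. norm f \<le> 1}. \<Sum>n. ennreal (\<bar>blinfun_apply f (x n)\<bar>\<^sup>2))"
  have S: "S < \<infinity>" using assms by (simp add: weakly_2_summable_def S_def)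
  show thesis
  proof (rule that[of "sqrt (enn2real S)"])
    fix N and f :: "'e \<Rightarrow>\<^sub>L real" assume f: "norm f \<le> 1"
    have "ennreal (\<Sum>n<N. (blinfun_apply f (x n))\<^sup>2) = (\<Sum>n<N. ennreal (\<bar>blinfun_apply f (x n)\<bar>\<^sup>2))"
      by (simp add: sum_ennreal)
    also have "\<dots> \<le> (\<Sum>n. ennreal (\<bar>blinfun_apply f (x n)\<bar>\<^sup>2))"
      by (rule sum_le_suminf) auto
    also have "\<dots> \<le> S" unfolding S_def using f by (intro SUP_upper) simp
    finally have "ennreal (\<Sum>n<N. (blinfun_apply f (x n))\<^sup>2) \<le> ennreal (enn2real S)"
      using S by simp
    then show "(\<Sum>n<N. (blinfun_apply f (x n))\<^sup>2) \<le> (sqrt (enn2real S))\<^sup>2"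
      by (simp add: ennreal_le_iff)
  qed simp
qed

text \<open>
  The operator with \<open>e\<^sub>n \<mapsto> x\<^sub>n\<close>. Norming functionals turn weak summability into an estimate for the
  norms of the blocks of the series.
\<close>

lemma weakly_2_summable_synthesis:
  fixes x :: "nat \<Rightarrow> 'e::banach"
  assumes "weakly_2_summable x"
  obtains v :: "ell2 \<Rightarrow> 'e" where "bounded_linear v" "\<And>n. v (unit_vec n) = x n"
proof -
  obtain K where K: "0 \<le> K" "\<And>N (f::'e \<Rightarrow>\<^sub>L real). norm f \<le> 1 \<Longrightarrow> (\<Sum>n<N. (blinfun_apply f (x n))\<^sup>2) \<le> K\<^sup>2"
    using weakly_2_summable_bound[OF assms] by blast
  have partial: "(norm (\<Sum>n\<in>I. c n *\<^sub>R x n))\<^sup>2 \<le> K\<^sup>2 * (\<Sum>n\<in>I. (c n)\<^sup>2)" if I: "I \<subseteq> {..<N}" for I c N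
  proof -
    obtain f :: "'e \<Rightarrow>\<^sub>L real" where f: "norm f \<le> 1" "blinfun_apply f (\<Sum>n\<in>I. c n *\<^sub>R x n) = norm (\<Sum>n\<in>I. c n *\<^sub>R x n)"
      by (rule norming_functional)
    have "(norm (\<Sum>n\<in>I. c n *\<^sub>R x n))\<^sup>2 = (\<Sum>n\<in>I. c n * blinfun_apply f (x n))\<^sup>2"
      unfolding f(2)[symmetric] by (simp add: blinfun.sum_right blinfun.scaleR_right)
    also have "\<dots> \<le> (\<Sum>n\<in>I. (c n)\<^sup>2) * (\<Sum>n\<in>I. (blinfun_apply f (x n))\<^sup>2)"
      by (rule Cauchy_Schwarz_ineq_sum)
    also have "\<dots> \<le> (\<Sum>n\<in>I. (c n)\<^sup>2) * K\<^sup>2"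
    proof (rule mult_left_mono)
      have "(\<Sum>n\<in>I. (blinfun_apply f (x n))\<^sup>2) \<le> (\<Sum>n<N. (blinfun_apply f (x n))\<^sup>2)" using I by (intro sum_mono2) auto
      also have "\<dots> \<le> K\<^sup>2" by (rule K(2)[OF f(1)])
      finally show "(\<Sum>n\<in>I. (blinfun_apply f (x n))\<^sup>2) \<le> K\<^sup>2" .
    qed (simp add: sum_nonneg)
    finally show ?thesis by (simp add: mult.commute)
  qed
  have summ: "summable (\<lambda>n. coord a n *\<^sub>R x n)" for a
    unfolding summable_Cauchy
  proof (intro allI impI)
    fix e :: real assume e: "0 < e"
    define d where "d = e\<^sup>2 / (K\<^sup>2 + 1)"
    have d: "0 < d" using e by (simp add: d_def add_nonneg_pos)
    have "\<exists>N. \<forall>m\<ge>N. \<forall>n. norm (\<Sum>k=m..<n. (coord a k)\<^sup>2) < d"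
      using summable_coord[of a] d unfolding summable_Cauchy by blast
    then obtain N where N: "\<And>m n. m \<ge> N \<Longrightarrow> norm (\<Sum>k=m..<n. (coord a k)\<^sup>2) < d" by blast
    have "norm (\<Sum>k=m..<n. coord a k *\<^sub>R x k) < e" if "m \<ge> N" for m n
    proof -
      have "(norm (\<Sum>k=m..<n. coord a k *\<^sub>R x k))\<^sup>2 \<le> K\<^sup>2 * (\<Sum>k=m..<n. (coord a k)\<^sup>2)"
        by (rule partial[of _ n]) auto
      also have "\<dots> \<le> K\<^sup>2 * d" using N[OF that, of n] by (intro mult_left_mono) auto
      also have "\<dots> < e\<^sup>2" using e by (simp add: d_def pos_divide_less_eq add_nonneg_pos distrib_left mult.commute)
      finally show ?thesis using e by (simp add: power2_less_imp_less)
    qed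
    then show "\<exists>N. \<forall>m\<ge>N. \<forall>n. norm (\<Sum>k=m..<n. coord a k *\<^sub>R x k) < e" by blast
  qed
  define v where "v a = (\<Sum>n. coord a n *\<^sub>R x n)" for a
  have "bounded_linear v"
  proof (rule bounded_linear_intro)
    show "v (a + b) = v a + v b" for a b
      by (simp add: v_def suminf_add[OF summ summ] scaleR_add_left)
    show "v (c *\<^sub>R a) = c *\<^sub>R v a" for c a
      by (simp add: v_def suminf_scaleR_right[OF summ])
    show "norm (v a) \<le> norm a * K" for a
    proof (rule LIMSEQ_le_const2)
      show "(\<lambda>N. norm (\<Sum>n<N. coord a n *\<^sub>R x n)) \<longlonglongrightarrow> norm (v a)"
        unfolding v_def by (intro tendsto_norm summable_LIMSEQ summ)
      have "norm (\<Sum>n<N. coord a n *\<^sub>R x n) \<le> norm a * K" for N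
      proof (rule power2_le_imp_le)
        have "(norm (\<Sum>n<N. coord a n *\<^sub>R x n))\<^sup>2 \<le> K\<^sup>2 * (\<Sum>n<N. (coord a n)\<^sup>2)" by (rule partial) auto
        also have "\<dots> \<le> K\<^sup>2 * (norm a)\<^sup>2" by (intro mult_left_mono sum_coord_le) auto
        finally show "(norm (\<Sum>n<N. coord a n *\<^sub>R x n))\<^sup>2 \<le> (norm a * K)\<^sup>2"
          by (simp add: power_mult_distrib mult.commute)
      qed (use K in simp)
      then show "\<exists>M. \<forall>N\<ge>M. norm (\<Sum>n<N. coord a n *\<^sub>R x n) \<le> norm a * K" by blast
    qed
  qed
  moreover have "v (unit_vec n) = x n" for n
  proof -
    have "v (unit_vec n) = (\<Sum>k\<in>{n}. coord (unit_vec n) k *\<^sub>R x k)"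
      unfolding v_def by (rule suminf_finite) auto
    then show ?thesis by simp
  qed
  ultimately show thesis by (rule that)
qed

text \<open>
  The definition is applied to \<open>v : e\<^sub>n \<mapsto> x\<^sub>n\<close> and \<open>w : y \<mapsto> (h\<^sub>k y)\<^sub>k\<close>. It yields some orthonormal
  basis on which the squares of \<open>w u v\<close> are summable. Each coordinate of \<open>w u v\<close> is a bounded
  functional, so \<open>functional_le_orthonormal\<close> carries the estimate over to the unit vectors.
\<close>

lemma pre_hilbert_schmidt_bound:
  fixes u :: "'e::banach \<Rightarrow>\<^sub>L 'f::real_normed_vector" and h :: "nat \<Rightarrow> 'f \<Rightarrow> real"
  assumes u: "u \<in> pre_hilbert_schmidt TYPE('h)"
    and card: "(UNIV :: real set) \<lesssim> (UNIV :: 'h set)"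
    and x: "weakly_2_summable x"
    and lin: "\<And>k. linear (h k)"
    and bdd: "\<And>y N. (\<Sum>k<N. (h k y)\<^sup>2) \<le> (K * norm y)\<^sup>2" and K: "0 \<le> K"
  obtains C where "\<And>N m. (\<Sum>n<N. \<Sum>k<m. (h k (blinfun_apply u (x n)))\<^sup>2) \<le> C"
proof -
  obtain J :: "ell2 \<Rightarrow> 'h" where J: "inj J" using ell2_lepoll[OF card] .
  obtain v :: "ell2 \<Rightarrow> 'e" where v: "bounded_linear v" "\<And>n. v (unit_vec n) = x n"
    using weakly_2_summable_synthesis[OF x] by blast
  interpret v: bounded_linear v by fact
  note [simp] = carry_hilbert_simps[OF J]
  define H where "H = carry_hilbert J"
  define w where "w y = Ell2 (\<lambda>k. h k y)" for y
  have coord_w [simp]: "coord (w y) = (\<lambda>k. h k y)" and norm_w: "norm (w y) \<le> K * norm y" for y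
    using norm_ell2_le[OF bdd, of y] K unfolding w_def by simp_all
  have w_add: "w (y + z) = w y + w z" and w_scale: "w (c *\<^sub>R y) = c *\<^sub>R w y" for y z c
    by (rule coord_eqI; simp add: linear_add[OF lin] linear_scale[OF lin])+
  have "hilbert_schmidt H H ((J \<circ> w) \<circ> blinfun_apply u \<circ> (v \<circ> inv J))"
  proof -
    have "bounded_op_from H (v \<circ> inv J)"
      using v.nonneg_bounded J
      by (auto simp: bounded_op_from_def H_def v.add v.scaleR mult.commute)
    moreover have "bounded_op_into H (J \<circ> w)"
      using norm_w by (auto simp: bounded_op_into_def H_def w_add w_scale)
    ultimately show ?thesis
      using u hilbert_space_carry[OF J] unfolding pre_hilbert_schmidt_def H_def by blast
  qed
  then obtain B where B: "orthonormal_basis H B"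
    and HS: "(\<lambda>b. (hnorm H (J (w (blinfun_apply u (v (inv J b))))))\<^sup>2) summable_on B"
    unfolding hilbert_schmidt_def comp_def by blast
  define B' where "B' = inv J ` B"
  have "B \<subseteq> range J" using B by (simp add: orthonormal_basis_def H_def)
  then have BB': "B = J ` B'" unfolding B'_def by (force simp: image_image f_inv_into_f)
  have HS': "(\<lambda>b. (norm (w (blinfun_apply u (v b))))\<^sup>2) summable_on B'"
    using HS unfolding BB' by (subst (asm) summable_on_reindex) (simp_all add: J inj_on_subset[OF J] comp_def H_def)
  define C where "C = infsum (\<lambda>b. (norm (w (blinfun_apply u (v b))))\<^sup>2) B'"
  define T where "T k a = h k (blinfun_apply u (v a))" for k a
  have T: "bounded_linear (T k)" for k
  proof -
    have "bounded_linear (h k)"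
    proof (rule bounded_linear_intro)
      show "norm (h k y) \<le> norm y * K" for y
        using abs_coord_le[of "w y" k] norm_w[of y] by (simp add: mult.commute)
    qed (simp_all add: linear_add[OF lin] linear_scale[OF lin])
    from bounded_linear_compose[OF this bounded_linear_compose[OF blinfun.bounded_linear_right v(1)]]
    show ?thesis unfolding T_def .
  qed
  have main: "(\<Sum>n<N. (T k (unit_vec n))\<^sup>2) \<le> D"
    if D: "\<And>S. finite S \<Longrightarrow> S \<subseteq> B' \<Longrightarrow> (\<Sum>b\<in>S. (T k b)\<^sup>2) \<le> D" for N k D
  proof -
    define s where "s = (\<Sum>n<N. (T k (unit_vec n))\<^sup>2)"
    \<comment> \<open>At this vector \<open>T k\<close> takes the value \<open>s\<close>, which is also its squared norm.\<close>
    define a where "a = (\<Sum>n<N. T k (unit_vec n) *\<^sub>R unit_vec n)"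
    interpret Tk: bounded_linear "T k" by (rule T)
    have "T k a = s" by (simp add: a_def s_def Tk.sum Tk.scaleR power2_eq_square)
    moreover have "(norm a)\<^sup>2 = s" by (simp add: a_def s_def norm_sum_unit_vec)
    moreover have "(T k a)\<^sup>2 \<le> D * (norm a)\<^sup>2"
    proof (rule functional_le_orthonormal[OF T _ _ D])
      show "b \<bullet> c = (if b = c then 1 else 0)" if "b \<in> B'" "c \<in> B'" for b c
        using B that J unfolding orthonormal_basis_def BB' by (auto simp: H_def inj_eq)
      show "y = 0" if "\<And>b. b \<in> B' \<Longrightarrow> y \<bullet> b = 0" for y
        using B that J unfolding orthonormal_basis_def BB' by (auto simp: H_def inj_eq)
    qed
    ultimately have "s * s \<le> D * s" by (simp add: power2_eq_square)
    moreover have "0 \<le> s" by (simp add: s_def sum_nonneg)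
    moreover have "0 \<le> D" using D[of "{}"] by simp
    ultimately have "s \<le> D" by (cases "s = 0") (auto simp: mult_le_cancel_right)
    then show ?thesis by (simp add: s_def)
  qed
  have "(\<Sum>n<N. \<Sum>k<m. (h k (blinfun_apply u (x n)))\<^sup>2) \<le> C" for N m
  proof -
    define c where "c k = infsum (\<lambda>b. (T k b)\<^sup>2) B'" for k
    have le: "(\<Sum>k<m. (T k b)\<^sup>2) \<le> (norm (w (blinfun_apply u (v b))))\<^sup>2" for m b
      using sum_coord_le[of "{..<m}" "w (blinfun_apply u (v b))"] by (simp add: T_def)
    have Ts: "(\<lambda>b. (T k b)\<^sup>2) summable_on B'" for k
    proof (rule summable_on_comparison_test[OF HS'])
      show "(T k b)\<^sup>2 \<le> (norm (w (blinfun_apply u (v b))))\<^sup>2" for b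
        using abs_coord_le[of "w (blinfun_apply u (v b))" k] by (simp add: T_def abs_le_square_iff[symmetric])
    qed simp
    have Tsum: "(\<lambda>b. \<Sum>k<m. (T k b)\<^sup>2) summable_on B'" for m
      by (rule summable_on_comparison_test[OF HS' le]) (simp add: sum_nonneg)
    have "(\<Sum>n<N. (T k (unit_vec n))\<^sup>2) \<le> c k" for k
      by (rule main) (auto simp: c_def intro: finite_sum_le_infsum[OF Ts])
    then have "(\<Sum>k<m. \<Sum>n<N. (T k (unit_vec n))\<^sup>2) \<le> (\<Sum>k<m. c k)" by (intro sum_mono)
    also have "\<dots> = infsum (\<lambda>b. \<Sum>k<m. (T k b)\<^sup>2) B'"
    proof (induction m)
      case (Suc m)
      then show ?case
        by (simp add: c_def infsum_add Tsum Ts)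
    qed simp
    also have "\<dots> \<le> C"
      unfolding C_def by (intro infsum_mono Tsum HS' le)
    finally show ?thesis by (subst sum.swap) (simp add: T_def v(2))
  qed
  then show thesis by (rule that)
qed

section \<open>The standard Gaussian measure\<close>

definition gauss :: "real measure" where
  "gauss = density lborel (\<lambda>t. ennreal (std_normal_density t))"

lemma sets_gauss [measurable_cong, simp]: "sets gauss = sets borel"
  and space_gauss [simp]: "space gauss = UNIV"
  by (simp_all add: gauss_def)

interpretation gauss: prob_space gauss
  unfolding gauss_def by (rule prob_space_normal_density) simp

lemma nn_integral_gauss:
  "f \<in> borel_measurable borel \<Longrightarrow> (\<integral>\<^sup>+t. f t \<partial>gauss) = (\<integral>\<^sup>+t. ennreal (std_normal_density t) * f t \<partial>lborel)"
  unfolding gauss_def by (rule nn_integral_density) auto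

lemma nn_integral_gauss_uminus:
  assumes [measurable]: "f \<in> borel_measurable borel"
  shows "(\<integral>\<^sup>+t. f (- t) \<partial>gauss) = (\<integral>\<^sup>+t. f t \<partial>gauss)"
proof -
  have "(\<integral>\<^sup>+t. f t \<partial>gauss) = (\<integral>\<^sup>+t. ennreal (std_normal_density t) * f t \<partial>lborel)"
    by (simp add: nn_integral_gauss)
  also have "\<dots> = \<bar>- 1 :: real\<bar> * (\<integral>\<^sup>+t. ennreal (std_normal_density (0 + - 1 * t)) * f (0 + - 1 * t) \<partial>lborel)"
    by (rule nn_integral_real_affine) auto
  also have "\<dots> = (\<integral>\<^sup>+t. ennreal (std_normal_density t) * f (- t) \<partial>lborel)"
    by (simp add: normal_density_def)
  also have "\<dots> = (\<integral>\<^sup>+t. f (- t) \<partial>gauss)"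
    by (simp add: nn_integral_gauss)
  finally show ?thesis ..
qed

text \<open>
  The joint density depends on \<open>s\<^sup>2 + t\<^sup>2\<close> only. The rotation is carried out one variable at a time:
  \<open>t = - s + sqrt 2 * p\<close> for fixed \<open>s\<close>, and after exchanging the integrals \<open>q = - p + sqrt 2 * s\<close> for
  fixed \<open>p\<close>; the two Jacobian factors cancel.
\<close>

lemma nn_integral_gauss_rotate:
  fixes F :: "real \<Rightarrow> real \<Rightarrow> ennreal"
  assumes F[measurable]: "case_prod F \<in> borel_measurable (borel \<Otimes>\<^sub>M borel)"
  shows "(\<integral>\<^sup>+s. \<integral>\<^sup>+t. F ((s + t) / sqrt 2) ((s - t) / sqrt 2) \<partial>gauss \<partial>gauss) = (\<integral>\<^sup>+p. \<integral>\<^sup>+q. F p q \<partial>gauss \<partial>gauss)"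
proof -
  define d where "d = (\<lambda>t::real. ennreal (std_normal_density t))"
  have [measurable]: "d \<in> borel_measurable borel" by (simp add: d_def)
  define H where "H p q = d p * (d q * F p q)" for p q
  have H[measurable]: "case_prod H \<in> borel_measurable (borel \<Otimes>\<^sub>M borel)"
    unfolding H_def by measurable
  have [measurable]: "case_prod F \<in> borel_measurable (borel \<Otimes>\<^sub>M gauss)"
    using F by (simp cong: measurable_cong_sets)
  have gg: "(\<integral>\<^sup>+s. \<integral>\<^sup>+t. f s t \<partial>gauss \<partial>gauss) = (\<integral>\<^sup>+s. \<integral>\<^sup>+t. d s * (d t * f s t) \<partial>lborel \<partial>lborel)"
    if f[measurable]: "case_prod f \<in> borel_measurable (borel \<Otimes>\<^sub>M borel)" for f :: "real \<Rightarrow> real \<Rightarrow> ennreal"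
  proof -
    have 1: "(\<integral>\<^sup>+t. f s t \<partial>gauss) = (\<integral>\<^sup>+t. d t * f s t \<partial>lborel)" for s
      unfolding d_def by (rule nn_integral_gauss) measurable
    have "(\<integral>\<^sup>+s. \<integral>\<^sup>+t. f s t \<partial>gauss \<partial>gauss) = (\<integral>\<^sup>+s. d s * (\<integral>\<^sup>+t. d t * f s t \<partial>lborel) \<partial>lborel)"
      unfolding 1 unfolding d_def by (rule nn_integral_gauss) measurable
    also have "\<dots> = (\<integral>\<^sup>+s. \<integral>\<^sup>+t. d s * (d t * f s t) \<partial>lborel \<partial>lborel)"
      by (intro nn_integral_cong nn_integral_cmult[symmetric]) measurable
    finally show ?thesis .
  qed
  have dd: "d s * (d t * x) = d ((s + t) / sqrt 2) * (d ((s - t) / sqrt 2) * x)" for s t x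
  proof -
    have "std_normal_density s * std_normal_density t
        = std_normal_density ((s + t) / sqrt 2) * std_normal_density ((s - t) / sqrt 2)"
    proof -
      have "((s + t) / sqrt 2)\<^sup>2 = (s + t)\<^sup>2 / 2" "((s - t) / sqrt 2)\<^sup>2 = (s - t)\<^sup>2 / 2"
        by (simp_all add: power_divide)
      then have eq: "- s\<^sup>2 / 2 + - t\<^sup>2 / 2 = - ((s + t) / sqrt 2)\<^sup>2 / 2 + - ((s - t) / sqrt 2)\<^sup>2 / 2"
        by (simp only: power2_sum power2_diff) argo
      have "exp (- s\<^sup>2 / 2) * exp (- t\<^sup>2 / 2) = exp (- ((s + t) / sqrt 2)\<^sup>2 / 2) * exp (- ((s - t) / sqrt 2)\<^sup>2 / 2)"
        unfolding exp_add[symmetric] eq ..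
      then show ?thesis by (simp add: std_normal_density_def)
    qed
    then have "d s * d t = d ((s + t) / sqrt 2) * d ((s - t) / sqrt 2)"
      unfolding d_def by (simp flip: ennreal_mult)
    then show ?thesis by (metis mult.assoc)
  qed
  have "(\<integral>\<^sup>+s. \<integral>\<^sup>+t. F ((s + t) / sqrt 2) ((s - t) / sqrt 2) \<partial>gauss \<partial>gauss)
      = (\<integral>\<^sup>+s. \<integral>\<^sup>+t. H ((s + t) / sqrt 2) ((s - t) / sqrt 2) \<partial>lborel \<partial>lborel)"
    unfolding H_def dd[symmetric] by (rule gg) measurable
  also have "\<dots> = (\<integral>\<^sup>+s. sqrt 2 * (\<integral>\<^sup>+p. H p (sqrt 2 * s - p) \<partial>lborel) \<partial>lborel)"
  proof (intro nn_integral_cong)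
    fix s :: real
    have "(\<integral>\<^sup>+t. H ((s + t) / sqrt 2) ((s - t) / sqrt 2) \<partial>lborel)
        = ennreal \<bar>sqrt 2\<bar> * (\<integral>\<^sup>+p. H ((s + (- s + sqrt 2 * p)) / sqrt 2) ((s - (- s + sqrt 2 * p)) / sqrt 2) \<partial>lborel)"
      by (rule nn_integral_real_affine) auto
    also have "(\<lambda>p. H ((s + (- s + sqrt 2 * p)) / sqrt 2) ((s - (- s + sqrt 2 * p)) / sqrt 2))
        = (\<lambda>p. H p (sqrt 2 * s - p))"
    proof
      fix p
      have "(s - (- s + sqrt 2 * p)) / sqrt 2 = sqrt 2 * s - p" by (simp add: field_simps)
      then show "H ((s + (- s + sqrt 2 * p)) / sqrt 2) ((s - (- s + sqrt 2 * p)) / sqrt 2) = H p (sqrt 2 * s - p)"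
        by simp
    qed
    finally show "(\<integral>\<^sup>+t. H ((s + t) / sqrt 2) ((s - t) / sqrt 2) \<partial>lborel)
        = sqrt 2 * (\<integral>\<^sup>+p. H p (sqrt 2 * s - p) \<partial>lborel)" by simp
  qed
  also have "\<dots> = sqrt 2 * (\<integral>\<^sup>+s. \<integral>\<^sup>+p. H p (sqrt 2 * s - p) \<partial>lborel \<partial>lborel)"
    by (rule nn_integral_cmult) measurable
  also have "(\<integral>\<^sup>+s. \<integral>\<^sup>+p. H p (sqrt 2 * s - p) \<partial>lborel \<partial>lborel) = (\<integral>\<^sup>+p. \<integral>\<^sup>+s. H p (sqrt 2 * s - p) \<partial>lborel \<partial>lborel)"
    by (rule lborel_pair.Fubini') measurable
  also have "sqrt 2 * (\<integral>\<^sup>+p. \<integral>\<^sup>+s. H p (sqrt 2 * s - p) \<partial>lborel \<partial>lborel)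
      = (\<integral>\<^sup>+p. sqrt 2 * (\<integral>\<^sup>+s. H p (sqrt 2 * s - p) \<partial>lborel) \<partial>lborel)"
    by (rule nn_integral_cmult[symmetric]) measurable
  also have "\<dots> = (\<integral>\<^sup>+p. \<integral>\<^sup>+q. H p q \<partial>lborel \<partial>lborel)"
  proof (intro nn_integral_cong)
    fix p :: real
    have "(\<integral>\<^sup>+q. H p q \<partial>lborel) = ennreal \<bar>sqrt 2\<bar> * (\<integral>\<^sup>+s. H p (- p + sqrt 2 * s) \<partial>lborel)"
      by (rule nn_integral_real_affine) auto
    then show "sqrt 2 * (\<integral>\<^sup>+s. H p (sqrt 2 * s - p) \<partial>lborel) = (\<integral>\<^sup>+q. H p q \<partial>lborel)"
      by (simp add: algebra_simps)
  qed
  also have "\<dots> = (\<integral>\<^sup>+p. \<integral>\<^sup>+q. F p q \<partial>gauss \<partial>gauss)"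
    unfolding H_def by (rule gg[symmetric]) (rule F)
  finally show ?thesis .
qed

section \<open>Second moments of Gaussian sums\<close>

text \<open>
  The second moment of \<open>\<parallel>w + \<Sum>\<^sub>i \<gamma>\<^sub>i x\<^sub>i\<parallel>\<close> as an iterated integral. In this form permutations of the
  vectors are instances of Fubini's theorem and rotations concern two adjacent integrals; the offset
  \<open>w\<close> carries the inductions.
\<close>

primrec gsq :: "'a::real_normed_vector list \<Rightarrow> 'a \<Rightarrow> ennreal" where
  "gsq [] w = ennreal ((norm w)\<^sup>2)"
| "gsq (x # xs) w = (\<integral>\<^sup>+t. gsq xs (w + t *\<^sub>R x) \<partial>gauss)"

text \<open>
  In a non-separable space sums of Borel functions need not be Borel. The norm of a linear
  combination of fixed vectors is nevertheless a continuous function of the real coefficients, and all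
  measurability below is reduced to this.
\<close>

lemma borel_measurable_combination:
  fixes y :: "'i \<Rightarrow> 'a::real_normed_vector"
  shows "(\<lambda>t::nat \<Rightarrow> real. norm (w + (\<Sum>i\<in>I. t (k i) *\<^sub>R y i))) \<in> borel_measurable (Pi\<^sub>M UNIV (\<lambda>_. borel))"
proof -
  have "continuous_on UNIV (\<lambda>t::nat \<Rightarrow> real. norm (w + (\<Sum>i\<in>I. t (k i) *\<^sub>R y i)))"
    by (intro continuous_intros continuous_on_product_coordinates)
  then have "(\<lambda>t::nat \<Rightarrow> real. norm (w + (\<Sum>i\<in>I. t (k i) *\<^sub>R y i))) \<in> borel_measurable borel"
    by (rule borel_measurable_continuous_onI)
  then show ?thesis by (simp cong: measurable_cong_sets add: sets_PiM_equal_borel)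
qed

lemma measurable_gsq_combination:
  "(\<lambda>t. gsq xs (w + (\<Sum>i<N. t i *\<^sub>R y i))) \<in> borel_measurable (Pi\<^sub>M UNIV (\<lambda>_::nat. borel))"
proof (induction xs arbitrary: N y)
  case Nil
  have [measurable]: "(\<lambda>t. norm (w + (\<Sum>i<N. t i *\<^sub>R y i))) \<in> borel_measurable (Pi\<^sub>M UNIV (\<lambda>_::nat. borel))"
    by (rule borel_measurable_combination)
  show ?case unfolding gsq.simps by measurable
next
  case (Cons a xs)
  have eq: "w + (\<Sum>i<Suc N. (t(N := s)) i *\<^sub>R (y(N := a)) i) = w + (\<Sum>i<N. t i *\<^sub>R y i) + s *\<^sub>R a"
    for t :: "nat \<Rightarrow> real" and s
    by (simp add: add.assoc)
  have "(\<lambda>z. (fst z)(N := snd z)) \<in> Pi\<^sub>M UNIV (\<lambda>_::nat. borel :: real measure) \<Otimes>\<^sub>M gauss \<rightarrow>\<^sub>M Pi\<^sub>M UNIV (\<lambda>_. borel)"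
    by (rule measurable_fun_upd[where J=UNIV]) auto
  from measurable_compose[OF this Cons.IH[where N="Suc N" and y="y(N := a)"]]
  have "(\<lambda>z. gsq xs (w + (\<Sum>i<N. fst z i *\<^sub>R y i) + snd z *\<^sub>R a))
      \<in> borel_measurable (Pi\<^sub>M UNIV (\<lambda>_::nat. borel) \<Otimes>\<^sub>M gauss)"
    unfolding eq .
  then have "case_prod (\<lambda>t s. gsq xs (w + (\<Sum>i<N. t i *\<^sub>R y i) + s *\<^sub>R a))
      \<in> borel_measurable (Pi\<^sub>M UNIV (\<lambda>_::nat. borel) \<Otimes>\<^sub>M gauss)"
    by (simp add: case_prod_beta')
  then show ?case
    unfolding gsq.simps by (rule gauss.borel_measurable_nn_integral)
qed

lemma measurable_gsq2:
  "case_prod (\<lambda>s t. gsq xs (w + s *\<^sub>R x + t *\<^sub>R y)) \<in> borel_measurable (borel \<Otimes>\<^sub>M borel)"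
proof -
  have "(\<lambda>z::real \<times> real. \<lambda>i::nat. if i = 0 then fst z else snd z) \<in> borel \<Otimes>\<^sub>M borel \<rightarrow>\<^sub>M Pi\<^sub>M UNIV (\<lambda>_. borel)"
    by (rule measurable_PiM_single') auto
  from measurable_compose[OF this measurable_gsq_combination[where N=2 and y="\<lambda>i. if i = 0 then x else y" and xs=xs and w=w]]
  show ?thesis by (simp add: numeral_2_eq_2 case_prod_beta' add.assoc)
qed

lemma measurable_gsq1 [measurable]: "(\<lambda>t. gsq xs (w + t *\<^sub>R x)) \<in> borel_measurable borel"
  using measurable_compose[OF _ measurable_gsq2[of xs w x 0], of "\<lambda>t. (t, 0)" borel] by simp

lemma gsq_swap: "gsq (x # y # xs) w = gsq (y # x # xs) w"
proof -
  interpret pair_sigma_finite gauss gauss ..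
  have "case_prod (\<lambda>t s. gsq xs (w + s *\<^sub>R x + t *\<^sub>R y)) \<in> borel_measurable (gauss \<Otimes>\<^sub>M gauss)"
    using measurable_gsq2[of xs w y x] by (simp add: add_ac cong: measurable_cong_sets)
  from Fubini'[OF this] show ?thesis by (simp add: add_ac)
qed

lemma gsq_move: "gsq (xs @ y # ys) w = gsq (y # xs @ ys) w"
proof (induction xs arbitrary: w)
  case (Cons x xs)
  then have "gsq ((x # xs) @ y # ys) w = gsq (x # y # xs @ ys) w" by simp
  also have "\<dots> = gsq (y # (x # xs) @ ys) w" using gsq_swap[of x y "xs @ ys" w] by simp
  finally show ?case .
qed simp

lemma gsq_mset:
  "mset xs = mset ys \<Longrightarrow> gsq xs w = gsq ys w"
proof (induction xs arbitrary: ys w)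
  case (Cons x xs)
  from Cons.prems have "x \<in> set ys" by (metis list.set_intros(1) set_mset_mset)
  then obtain a b where ys: "ys = a @ x # b" by (meson split_list)
  have "mset xs = mset (a @ b)" using Cons.prems by (simp add: ys)
  then have "gsq xs v = gsq (a @ b) v" for v by (rule Cons.IH)
  then have "gsq (x # xs) w = gsq (x # a @ b) w" by simp
  also have "\<dots> = gsq ys w" unfolding ys by (rule gsq_move[symmetric])
  finally show ?case .
qed simp

lemma gsq_zero: "gsq (0 # xs) w = gsq xs w"
  by (simp add: gauss.emeasure_space_1[unfolded space_gauss])

lemma gsq_scale: "gsq (map (\<lambda>x. c *\<^sub>R x) xs) (c *\<^sub>R w) = ennreal (c\<^sup>2) * gsq xs w"
proof (induction xs arbitrary: w)
  case Nil
  then show ?case by (simp add: power_mult_distrib ennreal_mult)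
next
  case (Cons x xs)
  have "gsq (map (\<lambda>x. c *\<^sub>R x) (x # xs)) (c *\<^sub>R w)
      = (\<integral>\<^sup>+t. gsq (map (\<lambda>x. c *\<^sub>R x) xs) (c *\<^sub>R (w + t *\<^sub>R x)) \<partial>gauss)"
    by (simp add: scaleR_add_right mult.commute)
  also have "\<dots> = ennreal (c\<^sup>2) * gsq (x # xs) w"
    unfolding Cons.IH by (simp add: nn_integral_cmult)
  finally show ?case .
qed

lemma gsq_sign: "gsq ((- x) # xs) w = gsq (x # xs) w"
  using nn_integral_gauss_uminus[OF measurable_gsq1[of xs w x]] by simp

lemma gsq_signs:
  "(\<And>n. n \<in> set ns \<Longrightarrow> s n = 1 \<or> s n = -1) \<Longrightarrow> gsq (map (\<lambda>n. s n *\<^sub>R y n) ns) w = gsq (map y ns) w"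
proof (induction ns arbitrary: w)
  case (Cons n ns)
  then have IH: "gsq (map (\<lambda>n. s n *\<^sub>R y n) ns) v = gsq (map y ns) v" for v by simp
  have "s n *\<^sub>R y n = y n \<or> s n *\<^sub>R y n = - y n" using Cons.prems[of n] by auto
  then have "gsq (s n *\<^sub>R y n # map y ns) w = gsq (y n # map y ns) w"
    using gsq_sign by metis
  moreover have "gsq (map (\<lambda>n. s n *\<^sub>R y n) (n # ns)) w = gsq (s n *\<^sub>R y n # map y ns) w"
    by (simp add: IH)
  ultimately show ?case by simp
qed simp

lemma gsq_rotate:
  "gsq (((x + y) /\<^sub>R sqrt 2) # ((x - y) /\<^sub>R sqrt 2) # xs) w = gsq (x # y # xs) w"
proof -
  define F where "F p q = gsq xs (w + p *\<^sub>R x + q *\<^sub>R y)" for p q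
  have eq: "w + s *\<^sub>R ((x + y) /\<^sub>R sqrt 2) + t *\<^sub>R ((x - y) /\<^sub>R sqrt 2)
      = w + ((s + t) / sqrt 2) *\<^sub>R x + ((s - t) / sqrt 2) *\<^sub>R y" for s t
    by (simp add: algebra_simps divide_inverse)
  have "gsq (((x + y) /\<^sub>R sqrt 2) # ((x - y) /\<^sub>R sqrt 2) # xs) w
     = (\<integral>\<^sup>+s. \<integral>\<^sup>+t. F ((s + t) / sqrt 2) ((s - t) / sqrt 2) \<partial>gauss \<partial>gauss)"
    unfolding gsq.simps eq F_def ..
  also have "\<dots> = (\<integral>\<^sup>+p. \<integral>\<^sup>+q. F p q \<partial>gauss \<partial>gauss)"
    by (rule nn_integral_gauss_rotate) (simp add: F_def measurable_gsq2)
  finally show ?thesis by (simp add: F_def)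
qed

text \<open>
  Convexity of the squared norm, inherited by the iterated integrals.
\<close>

lemma gsq_midpoint: "2 * gsq xs w \<le> gsq xs (w + v) + gsq xs (w - v)"
proof (induction xs arbitrary: w)
  case Nil
  have "2 * norm w \<le> norm (w + v) + norm (w - v)"
  proof -
    have "norm (2 *\<^sub>R w) \<le> norm (w + v) + norm (w - v)"
      using norm_triangle_ineq[of "w + v" "w - v"] by (simp add: scaleR_2)
    then show ?thesis by simp
  qed
  then have "(2 * norm w)\<^sup>2 \<le> (norm (w + v) + norm (w - v))\<^sup>2" by (intro power_mono) auto
  also have "\<dots> \<le> 2 * ((norm (w + v))\<^sup>2 + (norm (w - v))\<^sup>2)"
    using sum_squares_bound[of "norm (w + v)" "norm (w - v)"] by (simp add: power2_sum)
  finally have "2 * (norm w)\<^sup>2 \<le> (norm (w + v))\<^sup>2 + (norm (w - v))\<^sup>2" by (simp add: power_mult_distrib)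
  then have "ennreal (2 * (norm w)\<^sup>2) \<le> ennreal ((norm (w + v))\<^sup>2 + (norm (w - v))\<^sup>2)"
    by (rule ennreal_leI)
  then show ?case by (simp add: ennreal_mult)
next
  case (Cons x xs)
  have "2 * gsq (x # xs) w = (\<integral>\<^sup>+t. 2 * gsq xs (w + t *\<^sub>R x) \<partial>gauss)"
    by (simp add: nn_integral_cmult)
  also have "\<dots> \<le> (\<integral>\<^sup>+t. gsq xs (w + v + t *\<^sub>R x) + gsq xs (w - v + t *\<^sub>R x) \<partial>gauss)"
  proof (rule nn_integral_mono)
    show "2 * gsq xs (w + t *\<^sub>R x) \<le> gsq xs (w + v + t *\<^sub>R x) + gsq xs (w - v + t *\<^sub>R x)" for t
      using Cons.IH[of "w + t *\<^sub>R x"] by (simp add: algebra_simps)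
  qed
  also have "\<dots> = gsq (x # xs) (w + v) + gsq (x # xs) (w - v)"
    by (simp add: nn_integral_add)
  finally show ?case .
qed

text \<open>
  Averaging over the sign of the additional Gaussian variable and using convexity.
\<close>

lemma gsq_le_Cons: "gsq xs w \<le> gsq (x # xs) w"
proof -
  have "2 * gsq xs w = (\<integral>\<^sup>+t. 2 * gsq xs w \<partial>gauss)"
    by (simp add: gauss.emeasure_space_1[unfolded space_gauss])
  also have "\<dots> \<le> (\<integral>\<^sup>+t. gsq xs (w + t *\<^sub>R x) + gsq xs (w - t *\<^sub>R x) \<partial>gauss)"
    by (intro nn_integral_mono gsq_midpoint)
  also have "\<dots> = (\<integral>\<^sup>+t. gsq xs (w + t *\<^sub>R x) \<partial>gauss) + (\<integral>\<^sup>+t. gsq xs (w + t *\<^sub>R (- x)) \<partial>gauss)"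
    using measurable_gsq1[of xs w "- x"] by (simp add: nn_integral_add)
  also have "\<dots> = 2 * gsq (x # xs) w"
    using gsq_sign[of x xs w] by (simp add: mult_2)
  finally show ?thesis by (simp add: ennreal_mult_le_mult_iff)
qed

lemma gsq_le_append: "gsq xs w \<le> gsq (ys @ xs) w"
proof (induction ys arbitrary: w)
  case (Cons y ys)
  have "gsq xs w \<le> gsq (ys @ xs) w" by (rule Cons.IH)
  also have "\<dots> \<le> gsq (y # ys @ xs) w" by (rule gsq_le_Cons)
  finally show ?case by simp
qed simp

lemma borel_measurable_PiM_combination:
  fixes y :: "nat \<Rightarrow> 'a::real_normed_vector"
  shows "(\<lambda>t. norm (w + (\<Sum>k\<in>I. t k *\<^sub>R y k))) \<in> borel_measurable (Pi\<^sub>M I (\<lambda>_. borel))"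
proof -
  have "(\<lambda>t k. if k \<in> I then t k else 0) \<in> Pi\<^sub>M I (\<lambda>_. borel :: real measure) \<rightarrow>\<^sub>M Pi\<^sub>M UNIV (\<lambda>_. borel :: real measure)"
  proof (rule measurable_PiM_single')
    show "(\<lambda>t. if k \<in> I then t k else 0) \<in> borel_measurable (Pi\<^sub>M I (\<lambda>_. borel :: real measure))" for k
      by (cases "k \<in> I") simp_all
  qed auto
  from measurable_compose[OF this borel_measurable_combination[of w "\<lambda>k. k" y I]]
  show ?thesis by (simp cong: sum.cong)
qed

lemma PiM_gauss_gsq:
  fixes y :: "nat \<Rightarrow> 'a::real_normed_vector"
  assumes "distinct ns"
  shows "(\<integral>\<^sup>+t. ennreal ((norm (w + (\<Sum>n\<in>set ns. t n *\<^sub>R y n)))\<^sup>2) \<partial>(Pi\<^sub>M (set ns) (\<lambda>_. gauss)))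
    = gsq (map y ns) w"
  using assms
proof (induction ns arbitrary: w)
  case Nil
  then show ?case by (simp add: PiM_empty nn_integral_count_space_finite)
next
  case (Cons n ns)
  interpret product_sigma_finite "\<lambda>_::nat. gauss" ..
  let ?P = "Pi\<^sub>M (set (n # ns)) (\<lambda>_. gauss)"
  have [measurable]: "(\<lambda>t. norm (w + (\<Sum>k\<in>set (n # ns). t k *\<^sub>R y k))) \<in> borel_measurable ?P"
    using borel_measurable_PiM_combination[of w y "set (n # ns)"]
    by (simp cong: measurable_cong_sets sets_PiM_cong)
  have "(\<integral>\<^sup>+t. ennreal ((norm (w + (\<Sum>k\<in>set (n # ns). t k *\<^sub>R y k)))\<^sup>2) \<partial>?P)
    = (\<integral>\<^sup>+s. \<integral>\<^sup>+t. ennreal ((norm (w + (\<Sum>k\<in>set (n # ns). (t(n := s)) k *\<^sub>R y k)))\<^sup>2)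
        \<partial>(Pi\<^sub>M (set ns) (\<lambda>_. gauss)) \<partial>gauss)"
  proof (unfold list.set, rule product_nn_integral_insert_rev)
    show "(\<lambda>t. ennreal ((norm (w + (\<Sum>k\<in>insert n (set ns). t k *\<^sub>R y k)))\<^sup>2))
        \<in> borel_measurable (Pi\<^sub>M (insert n (set ns)) (\<lambda>_. gauss))"
      unfolding list.set(2)[symmetric] by measurable
  qed (use Cons.prems in auto)
  also have "\<dots> = (\<integral>\<^sup>+s. gsq (map y ns) (w + s *\<^sub>R y n) \<partial>gauss)"
  proof (intro nn_integral_cong)
    fix s
    have upd: "w + (\<Sum>k\<in>set (n # ns). (t(n := s)) k *\<^sub>R y k) = w + s *\<^sub>R y n + (\<Sum>k\<in>set ns. t k *\<^sub>R y k)" for t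
    proof -
      have "(\<Sum>k\<in>set ns. (t(n := s)) k *\<^sub>R y k) = (\<Sum>k\<in>set ns. t k *\<^sub>R y k)"
        using Cons.prems by (intro sum.cong) auto
      then show ?thesis using Cons.prems by (simp add: add.assoc)
    qed
    show "(\<integral>\<^sup>+t. ennreal ((norm (w + (\<Sum>k\<in>set (n # ns). (t(n := s)) k *\<^sub>R y k)))\<^sup>2)
        \<partial>(Pi\<^sub>M (set ns) (\<lambda>_. gauss))) = gsq (map y ns) (w + s *\<^sub>R y n)"
      unfolding upd using Cons by simp
  qed
  finally show ?case by simp
qed

lemma gaussian_sequence_measurable:
  assumes "prob_space M" "gaussian_sequence M g"
  shows "g n \<in> borel_measurable M" "distr M borel (g n) = gauss"
proof -
  have d: "distributed M lborel (g n) std_normal_density"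
    using assms(2) by (simp add: gaussian_sequence_def)
  show "g n \<in> borel_measurable M"
    using distributed_measurable[OF d] by simp
  have "distr M borel (g n) = distr M lborel (g n)" by (rule distr_cong) auto
  also have "\<dots> = gauss" using d by (simp add: distributed_def gauss_def)
  finally show "distr M borel (g n) = gauss" .
qed

lemma borel_measurable_sequence_combination:
  fixes g :: "nat \<Rightarrow> 'w \<Rightarrow> real" and y :: "nat \<Rightarrow> 'a::real_normed_vector"
  assumes "\<And>n. g n \<in> borel_measurable M"
  shows "(\<lambda>\<omega>. norm (w + (\<Sum>n\<in>I. g n \<omega> *\<^sub>R y n))) \<in> borel_measurable M"
proof -
  have "(\<lambda>\<omega> n. g n \<omega>) \<in> M \<rightarrow>\<^sub>M Pi\<^sub>M UNIV (\<lambda>_. borel)"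
    by (rule measurable_PiM_single') (use assms in auto)
  from measurable_compose[OF this borel_measurable_combination[of w "\<lambda>n. n" y I]] show ?thesis .
qed

lemma gaussian_sum_eq_gsq:
  fixes y :: "nat \<Rightarrow> 'a::real_normed_vector"
  assumes M: "prob_space M" and g: "gaussian_sequence M g" and ns: "distinct ns"
  shows "(\<integral>\<^sup>+\<omega>. ennreal ((norm (\<Sum>n\<in>set ns. g n \<omega> *\<^sub>R y n))\<^sup>2) \<partial>M) = gsq (map y ns) 0"
proof (cases "ns = []")
  case True
  then show ?thesis by simp
next
  case False
  interpret prob_space M by fact
  note [measurable] = gaussian_sequence_measurable(1)[OF M g]
  let ?I = "set ns"
  have "indep_vars (\<lambda>_. borel) g UNIV" using g by (simp add: gaussian_sequence_def)
  then have "indep_vars (\<lambda>_. borel) g ?I" by (rule indep_vars_subset) auto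
  then have distr: "distr M (Pi\<^sub>M ?I (\<lambda>_. borel)) (\<lambda>\<omega>. \<lambda>i\<in>?I. g i \<omega>) = Pi\<^sub>M ?I (\<lambda>_. gauss)"
    using False by (subst (asm) indep_vars_iff_distr_eq_PiM') (simp_all add: gaussian_sequence_measurable[OF M g])
  have [measurable]: "(\<lambda>t. norm (\<Sum>k\<in>?I. t k *\<^sub>R y k)) \<in> borel_measurable (Pi\<^sub>M ?I (\<lambda>_. borel))"
    using borel_measurable_PiM_combination[of 0 y ?I] by simp
  have "gsq (map y ns) 0 = (\<integral>\<^sup>+t. ennreal ((norm (\<Sum>n\<in>?I. t n *\<^sub>R y n))\<^sup>2) \<partial>(Pi\<^sub>M ?I (\<lambda>_. gauss)))"
    using PiM_gauss_gsq[OF ns, of 0 y] by simp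
  also have "\<dots> = (\<integral>\<^sup>+\<omega>. ennreal ((norm (\<Sum>n\<in>?I. (\<lambda>i\<in>?I. g i \<omega>) n *\<^sub>R y n))\<^sup>2) \<partial>M)"
    unfolding distr[symmetric] by (rule nn_integral_distr) measurable
  also have "\<dots> = (\<integral>\<^sup>+\<omega>. ennreal ((norm (\<Sum>n\<in>?I. g n \<omega> *\<^sub>R y n))\<^sup>2) \<partial>M)"
    by simp
  finally show ?thesis ..
qed

section \<open>Hilbertian domination of Gaussian sums\<close>

lemma rademacher_sequence_props:
  assumes "prob_space M" "rademacher_sequence M r"
  shows "r n \<in> borel_measurable M" "AE \<omega> in M. r n \<omega> = 1 \<or> r n \<omega> = -1"
proof -
  interpret prob_space M by fact
  show [measurable]: "r n \<in> borel_measurable M"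
    using assms(2) by (auto simp: rademacher_sequence_def indep_vars_def2)
  have "prob ({\<omega> \<in> space M. r n \<omega> = 1} \<union> {\<omega> \<in> space M. r n \<omega> = -1})
      = prob {\<omega> \<in> space M. r n \<omega> = 1} + prob {\<omega> \<in> space M. r n \<omega> = -1}"
    by (rule finite_measure_Union) auto
  also have "\<dots> = 1 / 2 + 1 / 2"
    using assms(2) unfolding rademacher_sequence_def by metis
  finally have "prob ({\<omega> \<in> space M. r n \<omega> = 1} \<union> {\<omega> \<in> space M. r n \<omega> = -1}) = 1" by simp
  from AE_prob_1[OF this] show "AE \<omega> in M. r n \<omega> = 1 \<or> r n \<omega> = -1"
    by eventually_elim auto
qed

text \<open>
  Type 2 is stated with Bochner integrals, which are zero for non-integrable functions. The
  integrand is almost surely bounded here, so nothing is lost.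
\<close>

lemma type_2_nn_integral:
  assumes M: "prob_space M" and r: "rademacher_sequence M r" and t: "type_2 M r TYPE('f::real_normed_vector)"
  obtains c where "0 < c" "\<And>N (x :: nat \<Rightarrow> 'f). (\<integral>\<^sup>+\<omega>. ennreal ((norm (\<Sum>n<N. r n \<omega> *\<^sub>R x n))\<^sup>2) \<partial>M)
      \<le> ennreal (c\<^sup>2 * (\<Sum>n<N. (norm (x n))\<^sup>2))"
proof -
  interpret prob_space M by fact
  note r = rademacher_sequence_props[OF M r]
  obtain c where c: "0 < c" and t2: "\<And>N (x :: nat \<Rightarrow> 'f).
      sqrt (\<integral>\<omega>. (norm (\<Sum>n<N. r n \<omega> *\<^sub>R x n))\<^sup>2 \<partial>M) \<le> c * sqrt (\<Sum>n<N. (norm (x n))\<^sup>2)"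
    using t unfolding type_2_def by blast
  show thesis
  proof (rule that[OF c])
    fix N and x :: "nat \<Rightarrow> 'f"
    let ?X = "\<lambda>\<omega>. (norm (\<Sum>n<N. r n \<omega> *\<^sub>R x n))\<^sup>2"
    have meas: "?X \<in> borel_measurable M"
      using borel_measurable_sequence_combination[of r M 0 x "{..<N}"] r(1) by simp
    have "AE \<omega> in M. \<forall>n. r n \<omega> = 1 \<or> r n \<omega> = -1"
      using r(2) by (simp add: AE_all_countable)
    then have "AE \<omega> in M. norm (?X \<omega>) \<le> (\<Sum>n<N. norm (x n))\<^sup>2"
    proof eventually_elim
      case (elim \<omega>)
      have "norm (\<Sum>n<N. r n \<omega> *\<^sub>R x n) \<le> (\<Sum>n<N. norm (r n \<omega> *\<^sub>R x n))" by (rule norm_sum)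
      also have "\<dots> = (\<Sum>n<N. norm (x n))"
      proof (rule sum.cong[OF refl])
        show "norm (r n \<omega> *\<^sub>R x n) = norm (x n)" for n using elim[rule_format, of n] by auto
      qed
      finally show ?case by (simp add: power_mono)
    qed
    then have int: "integrable M ?X" by (rule integrable_const_bound) (rule meas)
    have "(\<integral>\<omega>. ?X \<omega> \<partial>M) = (sqrt (\<integral>\<omega>. ?X \<omega> \<partial>M))\<^sup>2" by simp
    also have "\<dots> \<le> (c * sqrt (\<Sum>n<N. (norm (x n))\<^sup>2))\<^sup>2"
      by (intro power_mono t2) simp
    also have "\<dots> = c\<^sup>2 * (\<Sum>n<N. (norm (x n))\<^sup>2)"
      by (simp add: power_mult_distrib sum_nonneg)
    finally have "(\<integral>\<omega>. ?X \<omega> \<partial>M) \<le> c\<^sup>2 * (\<Sum>n<N. (norm (x n))\<^sup>2)" .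
    then show "(\<integral>\<^sup>+\<omega>. ennreal (?X \<omega>) \<partial>M) \<le> ennreal (c\<^sup>2 * (\<Sum>n<N. (norm (x n))\<^sup>2))"
      using nn_integral_eq_integral[OF int] by (simp add: ennreal_leI)
  qed
qed

lemma gauss_second_moment: "(\<integral>\<^sup>+t. ennreal (t\<^sup>2) \<partial>gauss) = 1"
proof -
  have b: "has_bochner_integral lborel (\<lambda>x. std_normal_density x * x\<^sup>2) 1"
    using std_normal_moment_even[of 1] by simp
  have "(\<integral>\<^sup>+t. ennreal (t\<^sup>2) \<partial>gauss) = (\<integral>\<^sup>+t. ennreal (std_normal_density t * t\<^sup>2) \<partial>lborel)"
    by (simp add: nn_integral_gauss ennreal_mult)
  also have "\<dots> = 1"
    using b by (subst nn_integral_eq_integral) (auto simp: has_bochner_integral_iff)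
  finally show ?thesis .
qed

lemma gaussian_second_moment:
  assumes M: "prob_space M" and g: "gaussian_sequence M g"
  shows "(\<integral>\<^sup>+\<omega>. ennreal ((g n \<omega>)\<^sup>2) \<partial>M) = 1"
proof -
  note [measurable] = gaussian_sequence_measurable(1)[OF M g]
  have "(\<integral>\<^sup>+\<omega>. ennreal ((g n \<omega>)\<^sup>2) \<partial>M) = (\<integral>\<^sup>+t. ennreal (t\<^sup>2) \<partial>(distr M borel (g n)))"
    by (rule nn_integral_distr[symmetric]) measurable
  also have "\<dots> = 1"
    by (simp add: gaussian_sequence_measurable(2)[OF M g] gauss_second_moment)
  finally show ?thesis .
qed

lemma gsq_map_upt: 
  assumes "prob_space M" "gaussian_sequence M g"
  shows "(\<integral>\<^sup>+\<omega>. ennreal ((norm (\<Sum>n<N. g n \<omega> *\<^sub>R y n))\<^sup>2) \<partial>M) = gsq (map y [0..<N]) 0"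
  using gaussian_sum_eq_gsq[OF assms, of "[0..<N]" y] by (simp add: atLeast0LessThan)

text \<open>
  Random signs do not change the second moment of a Gaussian sum, and type 2 applies to the signs for
  fixed Gaussian variables. As \<open>r\<close> and \<open>g\<close> are not assumed to be jointly independent, they are placed on
  the two factors of \<open>M \<Otimes>\<^sub>M M\<close>.
\<close>

lemma gsq_type_2:
  fixes x :: "nat \<Rightarrow> 'f::real_normed_vector"
  assumes M: "prob_space M" and r: "rademacher_sequence M r" and g: "gaussian_sequence M g"
    and t2: "\<And>N (x :: nat \<Rightarrow> 'f). (\<integral>\<^sup>+\<omega>. ennreal ((norm (\<Sum>n<N. r n \<omega> *\<^sub>R x n))\<^sup>2) \<partial>M)
      \<le> ennreal (c\<^sup>2 * (\<Sum>n<N. (norm (x n))\<^sup>2))"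
  shows "gsq xs 0 \<le> ennreal (c\<^sup>2 * (\<Sum>x\<leftarrow>xs. (norm (x::'f))\<^sup>2))"
proof -
  interpret prob_space M by fact
  interpret MM: pair_sigma_finite M M ..
  note rp = rademacher_sequence_props[OF M r]
  note [measurable] = rp(1) gaussian_sequence_measurable(1)[OF M g]
  define N where "N = length xs"
  define x where "x n = xs ! n" for n
  have xs: "map x [0..<N] = xs" by (simp add: N_def x_def[abs_def] map_nth)
  let ?F = "\<lambda>\<omega>' \<omega>. ennreal ((norm (\<Sum>n<N. g n \<omega> *\<^sub>R (r n \<omega>' *\<^sub>R x n)))\<^sup>2)"
  have "(\<lambda>z. norm (0 + (\<Sum>n<N. (g n (snd z) * r n (fst z)) *\<^sub>R x n))) \<in> borel_measurable (M \<Otimes>\<^sub>M M)"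
    by (rule borel_measurable_sequence_combination) measurable
  then have F: "case_prod ?F \<in> borel_measurable (M \<Otimes>\<^sub>M M)"
    by (simp add: case_prod_beta')
  have "AE \<omega>' in M. \<forall>n. r n \<omega>' = 1 \<or> r n \<omega>' = -1"
    using rp(2) by (simp add: AE_all_countable)
  then have "AE \<omega>' in M. (\<integral>\<^sup>+\<omega>. ?F \<omega>' \<omega> \<partial>M) = gsq xs 0"
  proof eventually_elim
    case (elim \<omega>')
    have "(\<integral>\<^sup>+\<omega>. ?F \<omega>' \<omega> \<partial>M) = gsq (map (\<lambda>n. r n \<omega>' *\<^sub>R x n) [0..<N]) 0"
      by (rule gsq_map_upt[OF M g])
    also have "\<dots> = gsq (map x [0..<N]) 0" by (rule gsq_signs) (use elim in blast)
    finally show ?case by (simp only: xs)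
  qed
  then have "(\<integral>\<^sup>+\<omega>'. \<integral>\<^sup>+\<omega>. ?F \<omega>' \<omega> \<partial>M \<partial>M) = (\<integral>\<^sup>+\<omega>'. gsq xs 0 \<partial>M)"
    by (rule nn_integral_cong_AE)
  then have "gsq xs 0 = (\<integral>\<^sup>+\<omega>'. \<integral>\<^sup>+\<omega>. ?F \<omega>' \<omega> \<partial>M \<partial>M)"
    by (simp add: emeasure_space_1)
  also have "\<dots> = (\<integral>\<^sup>+\<omega>. \<integral>\<^sup>+\<omega>'. ?F \<omega>' \<omega> \<partial>M \<partial>M)"
    by (rule MM.Fubini'[OF F, symmetric])
  also have "\<dots> \<le> (\<integral>\<^sup>+\<omega>. (\<Sum>n<N. ennreal (c\<^sup>2 * (norm (x n))\<^sup>2) * ennreal ((g n \<omega>)\<^sup>2)) \<partial>M)"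
  proof (rule nn_integral_mono)
    fix \<omega>
    have "(\<integral>\<^sup>+\<omega>'. ?F \<omega>' \<omega> \<partial>M) = (\<integral>\<^sup>+\<omega>'. ennreal ((norm (\<Sum>n<N. r n \<omega>' *\<^sub>R (g n \<omega> *\<^sub>R x n)))\<^sup>2) \<partial>M)"
      by (simp add: mult.commute)
    also have "\<dots> \<le> ennreal (c\<^sup>2 * (\<Sum>n<N. (norm (g n \<omega> *\<^sub>R x n))\<^sup>2))" by (rule t2)
    also have "\<dots> = (\<Sum>n<N. ennreal (c\<^sup>2 * (norm (x n))\<^sup>2) * ennreal ((g n \<omega>)\<^sup>2))"
      by (simp add: sum_distrib_left power_mult_distrib ac_simps flip: ennreal_mult sum_ennreal)
    finally show "(\<integral>\<^sup>+\<omega>'. ?F \<omega>' \<omega> \<partial>M) \<le> (\<Sum>n<N. ennreal (c\<^sup>2 * (norm (x n))\<^sup>2) * ennreal ((g n \<omega>)\<^sup>2))" .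
  qed
  also have "\<dots> = (\<Sum>n<N. ennreal (c\<^sup>2 * (norm (x n))\<^sup>2))"
    by (simp add: nn_integral_sum nn_integral_cmult gaussian_second_moment[OF M g])
  also have "\<dots> = ennreal (c\<^sup>2 * (\<Sum>x\<leftarrow>xs. (norm x)\<^sup>2))"
    unfolding xs[symmetric] by (simp add: sum_ennreal sum_distrib_left interv_sum_list_conv_sum_set_nat comp_def atLeast0LessThan)
  finally show ?thesis .
qed

definition gauss_size :: "'a::real_normed_vector multiset \<Rightarrow> real" where
  "gauss_size A = enn2real (gsq (SOME xs. mset xs = A) 0)"

lemma gauss_size_mset: "gauss_size (mset xs) = enn2real (gsq xs 0)"
proof -
  have "mset (SOME ys. mset ys = mset xs) = mset xs" by (rule someI) (rule refl)
  then show ?thesis unfolding gauss_size_def using gsq_mset by metis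
qed

lemma gauss_size_rotate:
  "gauss_size ({#(x + y) /\<^sub>R sqrt 2, (x - y) /\<^sub>R sqrt 2#} + D) = gauss_size ({#x, y#} + D)"
proof -
  obtain xs where D: "D = mset xs" by (metis ex_mset)
  show ?thesis
    using gauss_size_mset[of "(x + y) /\<^sub>R sqrt 2 # (x - y) /\<^sub>R sqrt 2 # xs"]
      gauss_size_mset[of "x # y # xs"] gsq_rotate[of x y xs 0] by (simp add: D)
qed

lemma gauss_size_zero: "gauss_size (add_mset 0 D) = gauss_size D"
proof -
  obtain xs where D: "D = mset xs" by (metis ex_mset)
  show ?thesis
    using gauss_size_mset[of "0 # xs"] gauss_size_mset[of xs] gsq_zero[of xs 0]
    by (simp add: D del: gsq.simps)
qed

lemma gauss_size_scale: "gauss_size (image_mset (\<lambda>x. c *\<^sub>R x) D) = c\<^sup>2 * gauss_size D"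
proof -
  obtain xs where D: "D = mset xs" by (metis ex_mset)
  show ?thesis
    using gauss_size_mset[of "map (\<lambda>x. c *\<^sub>R x) xs"] gauss_size_mset[of xs] gsq_scale[of c xs 0]
    by (simp add: D enn2real_mult)
qed

text \<open>
  The rotation turns the pair \<open>x, x\<close> into \<open>sqrt 2 *\<^sub>R x, 0\<close>.
\<close>

lemma gauss_size_double:
  "gauss_size (A + A + D) = gauss_size (image_mset (\<lambda>x. sqrt 2 *\<^sub>R x) A + D)"
proof (induction A arbitrary: D)
  case (add x A)
  have two: "(x + x) /\<^sub>R sqrt 2 = sqrt 2 *\<^sub>R x"
    by (simp add: scaleR_2[symmetric] inverse_eq_divide real_div_sqrt)
  have "gauss_size (add_mset x A + add_mset x A + D) = gauss_size (A + A + ({#x, x#} + D))"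
    by (simp add: ac_simps)
  also have "\<dots> = gauss_size (image_mset (\<lambda>x. sqrt 2 *\<^sub>R x) A + ({#x, x#} + D))" by (rule add.IH)
  also have "\<dots> = gauss_size ({#x, x#} + (image_mset (\<lambda>x. sqrt 2 *\<^sub>R x) A + D))" by (simp add: ac_simps)
  also have "\<dots> = gauss_size ({#(x + x) /\<^sub>R sqrt 2, (x - x) /\<^sub>R sqrt 2#} + (image_mset (\<lambda>x. sqrt 2 *\<^sub>R x) A + D))"
    by (rule gauss_size_rotate[symmetric])
  also have "\<dots> = gauss_size (image_mset (\<lambda>x. sqrt 2 *\<^sub>R x) (add_mset x A) + D)"
    unfolding two using gauss_size_zero[of "add_mset (sqrt 2 *\<^sub>R x) (image_mset (\<lambda>x. sqrt 2 *\<^sub>R x) A + D)"]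
    by (simp add: add_mset_commute)
  finally show ?case .
qed simp

definition sq_sum :: "'a::real_normed_vector multiset \<Rightarrow> real" where
  "sq_sum A = (\<Sum>x\<in>#A. (norm x)\<^sup>2)"

lemma sq_sum_simps [simp]: "sq_sum {#} = 0" "sq_sum (add_mset x A) = (norm x)\<^sup>2 + sq_sum A"
  "sq_sum (A + B) = sq_sum A + sq_sum B"
  by (simp_all add: sq_sum_def)

lemma sq_sum_nonneg: "0 \<le> sq_sum A"
  by (induction A) simp_all

lemma sq_sum_scale: "sq_sum (image_mset (\<lambda>x. c *\<^sub>R x) A) = c\<^sup>2 * sq_sum A"
  by (induction A) (simp_all add: power_mult_distrib distrib_left)

lemma sq_sum_mset: "sq_sum (mset xs) = (\<Sum>x\<leftarrow>xs. (norm x)\<^sup>2)"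
  by (induction xs) simp_all

text \<open>
  The arbitrary context \<open>D\<close> makes domination compatible with addition.
\<close>

definition dominated :: "'a::real_normed_vector multiset \<Rightarrow> 'a multiset \<Rightarrow> bool" where
  "dominated A B \<longleftrightarrow> (\<forall>D. gauss_size (A + D) \<le> gauss_size (B + D))"

text \<open>
  The largest sublinear, domination-monotone functional that is at most \<open>c\<^sup>2 * (norm x)\<^sup>2\<close> on singletons.
\<close>

definition type_2_envelope :: "real \<Rightarrow> 'a::real_normed_vector multiset \<Rightarrow> real" where
  "type_2_envelope c A = Inf {c\<^sup>2 * sq_sum Z | Z. dominated A Z}"

text \<open>
  An additive functional below the envelope is a sum of values \<open>q x\<close>. Domination in both directions
  between a pair and its rotation forces the parallelogram law for \<open>q\<close>, and the envelope lies above the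
  Gaussian second moment by type 2.
\<close>

lemma hilbertian_domination:
  fixes ys :: "'f::real_normed_vector list"
  assumes t2: "\<And>xs :: 'f list. gsq xs 0 \<le> ennreal (c\<^sup>2 * (\<Sum>x\<leftarrow>xs. (norm x)\<^sup>2))"
  obtains hs where "\<And>h. h \<in> set hs \<Longrightarrow> linear h"
    "\<And>x::'f. (\<Sum>h\<leftarrow>hs. (h x)\<^sup>2) \<le> c\<^sup>2 * (norm x)\<^sup>2"
    "gsq ys 0 \<le> ennreal (\<Sum>y\<leftarrow>ys. \<Sum>h\<leftarrow>hs. (h y)\<^sup>2)"
proof -
  have fin: "gsq xs 0 < top" for xs :: "'f list"
    using le_less_trans[OF t2 ennreal_less_top] .
  have size_eq: "ennreal (gauss_size (mset xs)) = gsq xs 0" for xs :: "'f list"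
    using fin[of xs] by (simp add: gauss_size_mset)
  have size_le: "gauss_size A \<le> c\<^sup>2 * sq_sum A" for A :: "'f multiset"
  proof -
    obtain xs where A: "A = mset xs" by (metis ex_mset)
    have "ennreal (gauss_size A) \<le> ennreal (c\<^sup>2 * sq_sum A)"
      unfolding A size_eq sq_sum_mset by (rule t2)
    then show ?thesis by (simp add: ennreal_le_iff sq_sum_nonneg)
  qed
  have size_mono: "gauss_size A \<le> gauss_size (B + A)" for A B :: "'f multiset"
  proof -
    obtain xs zs where A: "A = mset xs" and B: "B = mset zs" by (metis ex_mset)
    have "gsq xs 0 \<le> gsq (zs @ xs) 0" by (rule gsq_le_append)
    then have "enn2real (gsq xs 0) \<le> enn2real (gsq (zs @ xs) 0)" using fin by (intro enn2real_mono)
    then show ?thesis unfolding A B gauss_size_mset[symmetric] by simp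
  qed
  interpret preordered_monoid "dominated :: 'f multiset \<Rightarrow> 'f multiset \<Rightarrow> bool"
  proof
    show "dominated A A" for A :: "'f multiset" by (simp add: dominated_def)
    show "dominated A D" if "dominated A B" "dominated B D" for A B D :: "'f multiset"
      using that by (auto simp: dominated_def intro: order_trans)
    show "dominated (A + D) (B + D)" if "dominated A B" for A B D :: "'f multiset"
      using that by (auto simp: dominated_def add.assoc)
    show "\<exists>B'. dominated 0 (B + B')" for B :: "'f multiset"
      by (rule exI[of _ 0]) (simp add: dominated_def size_mono)
  qed
  define S0 where "S0 = (type_2_envelope c :: 'f multiset \<Rightarrow> real)"
  have S0_le: "S0 A \<le> c\<^sup>2 * sq_sum Z" if "dominated A Z" for A Z
    unfolding S0_def type_2_envelope_def
    using that by (intro cInf_lower bdd_belowI[of _ 0]) (auto simp: sq_sum_nonneg)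
  have S0_ge: "m \<le> S0 A" if "\<And>Z. dominated A Z \<Longrightarrow> m \<le> c\<^sup>2 * sq_sum Z" for m A
    unfolding S0_def type_2_envelope_def
    using that R_refl[of A] by (intro cInf_greatest) blast+
  have subadd: "S0 (A + B) \<le> S0 A + S0 B" for A B
  proof -
    have *: "S0 (A + B) \<le> c\<^sup>2 * sq_sum Z + c\<^sup>2 * sq_sum Y" if "dominated A Z" "dominated B Y" for Z Y
      using S0_le[OF R_add2[OF that]] by (simp add: distrib_left)
    have "S0 (A + B) - c\<^sup>2 * sq_sum Y \<le> S0 A" if "dominated B Y" for Y
      by (rule S0_ge) (use * that in \<open>simp add: algebra_simps\<close>)
    then have "S0 (A + B) - S0 A \<le> S0 B" by (intro S0_ge) (simp add: algebra_simps)
    then show ?thesis by simp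
  qed
  have "sublinear S0"
    unfolding sublinear_def
  proof (intro conjI allI impI)
    show "S0 (A + B) \<le> S0 A + S0 B" for A B by (rule subadd)
    show "S0 (A + A) = 2 * S0 A" for A
    proof (rule antisym)
      show "S0 (A + A) \<le> 2 * S0 A" using subadd[of A A] by simp
      show "2 * S0 A \<le> S0 (A + A)"
      proof (rule S0_ge)
        \<comment> \<open>\<open>A + A\<close> may be exchanged for \<open>A\<close> scaled by \<open>sqrt 2\<close>, so \<open>Z\<close> scaled by \<open>1 / sqrt 2\<close> dominates \<open>A\<close>.\<close>
        fix Z assume Z: "dominated (A + A) Z"
        let ?up = "image_mset (\<lambda>x::'f. sqrt 2 *\<^sub>R x)" and ?down = "image_mset (\<lambda>x::'f. (1 / sqrt 2) *\<^sub>R x)"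
        have ud: "?up (?down B) = B" for B by (simp add: image_mset.compositionality comp_def)
        have "dominated A (?down Z)"
          unfolding dominated_def
        proof
          fix D
          have "2 * gauss_size (A + D) = gauss_size (?up A + ?up D)"
            using gauss_size_scale[of "sqrt 2" "A + D"] by simp
          also have "\<dots> = gauss_size (A + A + ?up D)" by (rule gauss_size_double[symmetric])
          also have "\<dots> \<le> gauss_size (Z + ?up D)" using Z by (simp add: dominated_def)
          also have "Z + ?up D = ?up (?down Z + D)" by (simp add: ud)
          also have "gauss_size \<dots> = 2 * gauss_size (?down Z + D)"
            by (subst gauss_size_scale) simp
          finally show "gauss_size (A + D) \<le> gauss_size (?down Z + D)" by simp
        qed
        from S0_le[OF this] show "2 * S0 A \<le> c\<^sup>2 * sq_sum Z"
          by (simp add: sq_sum_scale power_divide)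
      qed
    qed
    show "S0 A \<le> S0 B" if "dominated A B" for A B
      by (rule S0_ge) (use S0_le R_trans[OF that] in blast)
  qed
  then obtain S where add: "\<And>A B. S (A + B) = S A + S B" and le: "\<And>A. S A \<le> S0 A"
    and mono: "\<And>A B. dominated A B \<Longrightarrow> S A \<le> S B" and at: "S (mset ys) = S0 (mset ys)"
    by (rule additive_minorant[of S0 "mset ys"]) blast
  have S_0: "S {#} = 0" using add[of "{#}" "{#}"] by simp
  define q where "q x = S {#x#}" for x
  have S_sum: "S (mset xs) = (\<Sum>x\<leftarrow>xs. q x)" for xs
  proof (induction xs)
    case (Cons x xs)
    then show ?case using add[of "{#x#}" "mset xs"] by (simp add: q_def)
  qed (simp add: S_0)
  have rotate: "q ((x + y) /\<^sub>R sqrt 2) + q ((x - y) /\<^sub>R sqrt 2) = q x + q y" for x y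
  proof -
    have "dominated {#(x + y) /\<^sub>R sqrt 2, (x - y) /\<^sub>R sqrt 2#} {#x, y#}"
      "dominated {#x, y#} {#(x + y) /\<^sub>R sqrt 2, (x - y) /\<^sub>R sqrt 2#}"
      by (simp_all only: dominated_def gauss_size_rotate order_refl simp_thms)
    from this[THEN mono] show ?thesis
      using S_sum[of "[(x + y) /\<^sub>R sqrt 2, (x - y) /\<^sub>R sqrt 2]"] S_sum[of "[x, y]"] by simp
  qed
  have q_pos: "0 \<le> q x" for x
    using mono[of "{#}" "{#x#}"] size_mono[of _ "{#x#}"] by (simp add: q_def S_0 dominated_def)
  have q_le: "q x \<le> c\<^sup>2 * (norm x)\<^sup>2" for x
    using le[of "{#x#}"] S0_le[OF R_refl, of "{#x#}"] by (simp add: q_def)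
  have q0: "q 0 = 0" using q_pos[of 0] q_le[of 0] by simp
  have q_sqrt2: "q (sqrt 2 *\<^sub>R x) = 2 * q x" for x
    using rotate[of "sqrt 2 *\<^sub>R x" 0] by (simp add: q0)
  have "q (x + y) + q (x - y) = 2 * q x + 2 * q y" for x y
    using rotate[of x y] q_sqrt2[of "(x + y) /\<^sub>R sqrt 2"] q_sqrt2[of "(x - y) /\<^sub>R sqrt 2"] by simp
  then obtain B where B: "psd_form B" "\<And>x. B x x = q x"
    using psd_form_of_parallelogram[of q "c\<^sup>2"] q_pos q_le by blast
  obtain hs where hs: "\<forall>h\<in>set hs. linear h" "\<forall>x. (\<Sum>h\<leftarrow>hs. (h x)\<^sup>2) \<le> B x x"
    "\<forall>y\<in>set ys. (\<Sum>h\<leftarrow>hs. (h y)\<^sup>2) = B y y"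
    using psd_form_sum_squares[OF B(1), of ys] by blast
  show thesis
  proof (rule that[of hs])
    show "linear h" if "h \<in> set hs" for h using hs(1) that by blast
    show "(\<Sum>h\<leftarrow>hs. (h x)\<^sup>2) \<le> c\<^sup>2 * (norm x)\<^sup>2" for x
      using hs(2) B(2) q_le order_trans by metis
    have "gauss_size (mset ys) \<le> S0 (mset ys)"
    proof (rule S0_ge)
      fix Z assume "dominated (mset ys) Z"
      then have "gauss_size (mset ys + {#}) \<le> gauss_size (Z + {#})" unfolding dominated_def by blast
      with size_le[of Z] show "gauss_size (mset ys) \<le> c\<^sup>2 * sq_sum Z" by simp
    qed
    also have "\<dots> = (\<Sum>y\<leftarrow>ys. q y)" using at S_sum by simp
    also have "\<dots> = (\<Sum>y\<leftarrow>ys. \<Sum>h\<leftarrow>hs. (h y)\<^sup>2)"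
      using hs(3) B(2) by (intro arg_cong[where f=sum_list] map_cong) auto
    finally show "gsq ys 0 \<le> ennreal (\<Sum>y\<leftarrow>ys. \<Sum>h\<leftarrow>hs. (h y)\<^sup>2)"
      unfolding size_eq[symmetric] by (rule ennreal_leI)
  qed
qed

section \<open>Boundedness and the Cauchy property\<close>

lemma gsq_mono_mset:
  assumes "mset xs \<subseteq># mset ys"
  shows "gsq xs w \<le> gsq ys w"
proof -
  obtain zs where "mset ys = mset xs + mset zs"
    using assms by (metis ex_mset mset_subset_eq_exists_conv)
  then have "gsq ys w = gsq (zs @ xs) w" by (intro gsq_mset) (simp add: add.commute)
  then show ?thesis using gsq_le_append by metis
qed

text \<open>
  Otherwise for every \<open>j\<close> some partial sum has second moment above \<open>4 ^ j\<close>, and so has a finite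
  family of functionals dominating it. Weighting the squares of the \<open>j\<close>-th family by \<open>2\<^sup>-\<^sup>j\<close>
  yields one family of functionals that is bounded, but whose squares at the vectors \<open>u x\<^sub>n\<close> sum up to at least
  \<open>2 ^ j\<close> for every \<open>j\<close>.
\<close>

lemma pre_hilbert_schmidt_gsq_bounded:
  fixes u :: "'e::banach \<Rightarrow>\<^sub>L 'f::real_normed_vector"
  assumes u: "u \<in> pre_hilbert_schmidt TYPE('h)"
    and card: "(UNIV :: real set) \<lesssim> (UNIV :: 'h set)"
    and x: "weakly_2_summable x" and c: "0 \<le> c"
    and t2: "\<And>xs :: 'f list. gsq xs 0 \<le> ennreal (c\<^sup>2 * (\<Sum>x\<leftarrow>xs. (norm x)\<^sup>2))"
  shows "\<exists>C\<ge>0. \<forall>N. gsq (map (\<lambda>n. blinfun_apply u (x n)) [0..<N]) 0 \<le> ennreal C"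
proof (rule ccontr)
  assume neg: "\<not> ?thesis"
  define y where "y n = blinfun_apply u (x n)" for n
  have "\<exists>N. ennreal (4 ^ j) < gsq (map y [0..<N]) 0" for j :: nat
    using neg unfolding y_def by (metis not_le zero_le_numeral zero_le_power)
  then obtain N where N: "\<And>j::nat. ennreal (4 ^ j) < gsq (map y [0..<N j]) 0" by metis
  have "\<exists>hs. (\<forall>h\<in>set hs. linear h) \<and> (\<forall>z::'f. (\<Sum>h\<leftarrow>hs. (h z)\<^sup>2) \<le> c\<^sup>2 * (norm z)\<^sup>2)
      \<and> 4 ^ j < (\<Sum>n<N j. \<Sum>h\<leftarrow>hs. (h (y n))\<^sup>2)" for j :: nat
  proof -
    obtain hs where hs: "\<And>h. h \<in> set hs \<Longrightarrow> linear h" "\<And>z::'f. (\<Sum>h\<leftarrow>hs. (h z)\<^sup>2) \<le> c\<^sup>2 * (norm z)\<^sup>2"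
      "gsq (map y [0..<N j]) 0 \<le> ennreal (\<Sum>z\<leftarrow>map y [0..<N j]. \<Sum>h\<leftarrow>hs. (h z)\<^sup>2)"
      using hilbertian_domination[OF t2, of "map y [0..<N j]"] by blast
    have "ennreal (4 ^ j) < ennreal (\<Sum>z\<leftarrow>map y [0..<N j]. \<Sum>h\<leftarrow>hs. (h z)\<^sup>2)"
      using N hs(3) by (rule less_le_trans)
    then have "4 ^ j < (\<Sum>z\<leftarrow>map y [0..<N j]. \<Sum>h\<leftarrow>hs. (h z)\<^sup>2)"
      by (simp add: ennreal_less_iff)
    also have "\<dots> = (\<Sum>n<N j. \<Sum>h\<leftarrow>hs. (h (y n))\<^sup>2)"
      by (simp add: interv_sum_list_conv_sum_set_nat comp_def atLeast0LessThan)
    finally show ?thesis using hs(1,2) by blast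
  qed
  then obtain hs where lin: "\<And>j h. h \<in> set (hs j) \<Longrightarrow> linear h"
    and hs_le: "\<And>j z. (\<Sum>h\<leftarrow>hs j. (h z)\<^sup>2) \<le> c\<^sup>2 * (norm (z::'f))\<^sup>2"
    and hs_gt: "\<And>j::nat. 4 ^ j < (\<Sum>n<N j. \<Sum>h\<leftarrow>hs j. (h (y n))\<^sup>2)" by metis
  define hh where "hh m z = (case prod_decode m of (j, k) \<Rightarrow>
      if k < length (hs j) then sqrt ((1/2) ^ j) * (hs j ! k) z else 0)" for m z
  define G where "G z = (\<lambda>(j, k). if k < length (hs j) then (1/2) ^ j * ((hs j ! k) z)\<^sup>2 else 0)" for z
  have hh_sq: "(hh m z)\<^sup>2 = G z (prod_decode m)" for m z
    by (simp add: hh_def G_def power_mult_distrib split: prod.split)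
  have G_row: "(\<Sum>k<length (hs j). G z (j, k)) = (1/2) ^ j * (\<Sum>h\<leftarrow>hs j. (h z)\<^sup>2)" for j z
    by (simp add: G_def sum_list_sum_nth sum_distrib_left atLeast0LessThan)
  have G_nonneg: "0 \<le> G z p" for z p by (simp add: G_def split: prod.split)
  have hh_lin: "linear (hh m)" for m
  proof (cases "prod_decode m")
    case (Pair j k)
    show ?thesis
    proof (cases "k < length (hs j)")
      case True
      then have "linear (hs j ! k)" using lin nth_mem by blast
      then show ?thesis using True
        by (simp add: hh_def[abs_def] Pair linear_iff algebra_simps)
    qed (simp add: hh_def[abs_def] Pair linear_iff)
  qed
  have hh_bdd: "(\<Sum>m<M. (hh m z)\<^sup>2) \<le> (sqrt 2 * c * norm z)\<^sup>2" for M z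
  proof -
    have "(\<Sum>m<M. (hh m z)\<^sup>2) = (\<Sum>p\<in>prod_decode ` {..<M}. G z p)"
      by (simp add: hh_sq sum.reindex inj_prod_decode)
    also have "\<dots> \<le> (\<Sum>p\<in>{..<M} \<times> {..<M}. G z p)"
    proof (rule sum_mono2)
      show "prod_decode ` {..<M} \<subseteq> {..<M} \<times> {..<M}"
      proof
        fix p assume "p \<in> prod_decode ` {..<M}"
        then have "prod_encode p < M" by auto
        then show "p \<in> {..<M} \<times> {..<M}"
          using le_prod_encode_1[of "fst p" "snd p"] le_prod_encode_2[of "snd p" "fst p"]
          by (cases p) auto
      qed
    qed (simp_all add: G_nonneg)
    also have "\<dots> = (\<Sum>j<M. \<Sum>k<M. G z (j, k))" by (simp add: sum.cartesian_product)
    also have "\<dots> \<le> (\<Sum>j<M. (1/2) ^ j * (c\<^sup>2 * (norm z)\<^sup>2))"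
    proof (rule sum_mono)
      fix j
      have "(\<Sum>k<M. G z (j, k)) \<le> (\<Sum>k<max M (length (hs j)). G z (j, k))"
        by (intro sum_mono2) (auto simp: G_nonneg)
      also have "\<dots> = (\<Sum>k<length (hs j). G z (j, k))"
        by (intro sum.mono_neutral_right) (auto simp: G_def)
      also have "\<dots> \<le> (1/2) ^ j * (c\<^sup>2 * (norm z)\<^sup>2)"
        unfolding G_row by (intro mult_left_mono hs_le) simp
      finally show "(\<Sum>k<M. G z (j, k)) \<le> (1/2) ^ j * (c\<^sup>2 * (norm z)\<^sup>2)" .
    qed
    also have "\<dots> = (\<Sum>j<M. (1/2) ^ j) * (c\<^sup>2 * (norm z)\<^sup>2)" by (rule sum_distrib_right[symmetric])
    also have "\<dots> \<le> 2 * (c\<^sup>2 * (norm z)\<^sup>2)"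
      by (intro mult_right_mono) (simp_all add: sum_gp_strict)
    finally show ?thesis by (simp add: power_mult_distrib mult.assoc)
  qed
  obtain C where C: "\<And>N m. (\<Sum>n<N. \<Sum>k<m. (hh k (blinfun_apply u (x n)))\<^sup>2) \<le> C"
    using pre_hilbert_schmidt_bound[OF u card x hh_lin hh_bdd] c by auto
  obtain j :: nat where j: "C < 2 ^ j" using real_arch_pow[of 2 C] by auto
  obtain M where M: "(\<lambda>k. prod_encode (j, k)) ` {..<length (hs j)} \<subseteq> {..<M}"
    using finite_nat_iff_bounded[of "(\<lambda>k. prod_encode (j, k)) ` {..<length (hs j)}"] by auto
  have "(1/2) ^ j * (\<Sum>h\<leftarrow>hs j. (h z)\<^sup>2) \<le> (\<Sum>m<M. (hh m z)\<^sup>2)" for z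
  proof -
    have "(1/2) ^ j * (\<Sum>h\<leftarrow>hs j. (h z)\<^sup>2) = (\<Sum>m\<in>(\<lambda>k. prod_encode (j, k)) ` {..<length (hs j)}. (hh m z)\<^sup>2)"
      unfolding G_row[symmetric] by (subst sum.reindex) (auto simp: hh_sq inj_on_def)
    also have "\<dots> \<le> (\<Sum>m<M. (hh m z)\<^sup>2)" by (rule sum_mono2[OF _ M]) simp_all
    finally show ?thesis .
  qed
  then have "(\<Sum>n<N j. (1/2) ^ j * (\<Sum>h\<leftarrow>hs j. (h (y n))\<^sup>2)) \<le> (\<Sum>n<N j. \<Sum>m<M. (hh m (y n))\<^sup>2)"
    by (intro sum_mono) simp
  also have "\<dots> \<le> C" unfolding y_def by (rule C)
  finally have "(1/2) ^ j * (\<Sum>n<N j. \<Sum>h\<leftarrow>hs j. (h (y n))\<^sup>2) \<le> C" by (simp add: sum_distrib_left)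
  moreover have "(1/2) ^ j * 4 ^ j < (1/2) ^ j * (\<Sum>n<N j. \<Sum>h\<leftarrow>hs j. (h (y n))\<^sup>2)"
    by (intro mult_strict_left_mono hs_gt) simp
  moreover have "(1/2::real) ^ j * 4 ^ j = 2 ^ j" by (simp flip: power_mult_distrib)
  ultimately show False using j by linarith
qed

text \<open>
  Otherwise there are disjoint blocks of indices whose Gaussian sums have second moments at least \<open>e\<close>.
  The blocks are labelled by all sign patterns of length \<open>k\<close>, and \<open>V\<^sub>i\<close> is the Gaussian sum in which
  every block is multiplied by the \<open>i\<close>-th sign of its pattern. Whatever the values of \<open>r\<^sub>1, \<dots>, r\<^sub>k\<close>
  are, the block whose pattern agrees with them enters \<open>\<Sum>\<^sub>i r\<^sub>i V\<^sub>i\<close> with coefficient \<open>k\<close>, so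
  the second moment of this sum is at least \<open>k\<^sup>2 e\<close>. By type 2 it is at most
  \<open>c\<^sup>2 \<Sum>\<^sub>i E\<parallel>V\<^sub>i\<parallel>\<^sup>2 \<le> c\<^sup>2 k C\<close>, which is impossible for large \<open>k\<close>.
\<close>

lemma gsq_bounded_imp_Cauchy:
  fixes y :: "nat \<Rightarrow> 'f::real_normed_vector"
  assumes M: "prob_space M" and r: "rademacher_sequence M r" and g: "gaussian_sequence M g"
    and t2: "\<And>N (x :: nat \<Rightarrow> 'f). (\<integral>\<^sup>+\<omega>. ennreal ((norm (\<Sum>n<N. r n \<omega> *\<^sub>R x n))\<^sup>2) \<partial>M)
      \<le> ennreal (c\<^sup>2 * (\<Sum>n<N. (norm (x n))\<^sup>2))"
    and C: "\<And>N. gsq (map y [0..<N]) 0 \<le> ennreal C" "0 \<le> C" and e: "0 < e"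
  shows "\<exists>m. \<forall>p\<ge>m. \<forall>q. gsq (map y [p..<q]) 0 < ennreal e"
proof (rule ccontr)
  assume "\<not> ?thesis"
  then have "\<forall>m. \<exists>p q. p \<ge> m \<and> ennreal e \<le> gsq (map y [p..<q]) 0" by (metis not_le)
  then obtain P Q where PQ: "\<And>m. m \<le> P m" "\<And>m. ennreal e \<le> gsq (map y [P m..<Q m]) 0" by metis
  have P_less_Q: "P m < Q m" for m
  proof (rule ccontr)
    assume "\<not> P m < Q m"
    then show False using PQ(2)[of m] e by (simp add: ennreal_eq_0_iff)
  qed
  \<comment> \<open>Block \<open>s\<close> lies between \<open>a s\<close> and \<open>a (Suc s)\<close>; its sign pattern is positive on \<open>set_decode s\<close>.\<close>
  define a where "a = rec_nat 0 (\<lambda>_. Q)"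
  have a_Suc: "a (Suc s) = Q (a s)" for s by (simp add: a_def)
  have a_mono: "a s \<le> a t" if "s \<le> t" for s t
    using that
  proof (rule lift_Suc_mono_le[rotated])
    show "a n \<le> a (Suc n)" for n using PQ(1)[of "a n"] P_less_Q[of "a n"] by (simp add: a_Suc)
  qed
  define I where "I s = {P (a s)..<Q (a s)}" for s
  have I_range: "a s \<le> n" "n < a (Suc s)" if "n \<in> I s" for n s
    using that PQ(1)[of "a s"] by (auto simp: I_def a_Suc)
  have I_disj: "s = t" if n: "n \<in> I s" "n \<in> I t" for n s t
  proof -
    have "\<not> s < t" if "n \<in> I s" "n \<in> I t" for s t
      using I_range[OF that(1)] I_range[OF that(2)] a_mono[of "Suc s" t] by linarith
    then show ?thesis using n by (metis linorder_neqE_nat)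
  qed
  define \<sigma> :: "nat \<Rightarrow> nat \<Rightarrow> real" where
    "\<sigma> i n = (if \<exists>s. n \<in> I s \<and> i \<in> set_decode s then 1 else -1)" for i n
  obtain k :: nat where k: "c\<^sup>2 * C < real k * e" using reals_Archimedean3[OF e] by blast
  then have k0: "0 < k" using C(2) by (cases "k = 0") (auto simp: mult_less_0_iff not_less)
  define T where "T = Max (set_encode ` Pow {..<k})"
  have T: "set_encode A \<le> T" if "A \<subseteq> {..<k}" for A
    unfolding T_def using that by (intro Max_ge) auto
  define N where "N = a (Suc T)"
  interpret prob_space M by fact
  interpret MM: pair_sigma_finite M M ..
  note rp = rademacher_sequence_props[OF M r]
  note [measurable] = rp(1) gaussian_sequence_measurable(1)[OF M g]
  let ?b = "\<lambda>n \<omega>'. \<Sum>i<k. r i \<omega>' * \<sigma> i n"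
  let ?F = "\<lambda>\<omega>' \<omega>. ennreal ((norm (\<Sum>n<N. g n \<omega> *\<^sub>R (?b n \<omega>' *\<^sub>R y n)))\<^sup>2)"
  define V where "V i \<omega> = (\<Sum>n<N. g n \<omega> *\<^sub>R (\<sigma> i n *\<^sub>R y n))" for i \<omega>
  have "(\<lambda>z. norm (0 + (\<Sum>n<N. (g n (snd z) * ?b n (fst z)) *\<^sub>R y n))) \<in> borel_measurable (M \<Otimes>\<^sub>M M)"
    by (rule borel_measurable_sequence_combination) measurable
  then have F: "case_prod ?F \<in> borel_measurable (M \<Otimes>\<^sub>M M)"
    by (simp add: case_prod_beta')
  have "AE \<omega>' in M. \<forall>n. r n \<omega>' = 1 \<or> r n \<omega>' = -1"
    using rp(2) by (simp add: AE_all_countable)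
  then have "AE \<omega>' in M. ennreal ((real k)\<^sup>2 * e) \<le> (\<integral>\<^sup>+\<omega>. ?F \<omega>' \<omega> \<partial>M)"
  proof eventually_elim
    case (elim \<omega>')
    define A where "A = {i. i < k \<and> r i \<omega>' = 1}"
    define s where "s = set_encode A"
    have A: "A \<subseteq> {..<k}" by (auto simp: A_def)
    have dec: "set_decode s = A" unfolding s_def using finite_subset[OF A] by (simp add: set_encode_inverse)
    have b: "?b n \<omega>' = real k" if n: "n \<in> I s" for n
    proof -
      have "(\<exists>s'. n \<in> I s' \<and> i \<in> set_decode s') \<longleftrightarrow> i \<in> A" for i
        using n I_disj dec by metis
      then have "r i \<omega>' * \<sigma> i n = 1" if "i < k" for i
        using that elim[rule_format, of i] by (auto simp: \<sigma>_def A_def)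
      then show ?thesis by simp
    qed
    have s: "s \<le> T" unfolding s_def by (rule T[OF A])
    have "Q (a s) \<le> N" unfolding N_def a_Suc[symmetric] using s by (intro a_mono) simp
    then have split: "[0..<N] = [0..<P (a s)] @ [P (a s)..<Q (a s)] @ [Q (a s)..<N]"
      using P_less_Q[of "a s"] upt_add_eq_append[of 0 "P (a s)" "N - P (a s)"]
        upt_add_eq_append[of "P (a s)" "Q (a s)" "N - Q (a s)"] by simp
    have "ennreal ((real k)\<^sup>2 * e) = ennreal ((real k)\<^sup>2) * ennreal e"
      using e by (simp add: ennreal_mult)
    also have "\<dots> \<le> ennreal ((real k)\<^sup>2) * gsq (map y [P (a s)..<Q (a s)]) 0"
      by (intro mult_left_mono PQ(2)) simp
    also have "\<dots> = gsq (map (\<lambda>n. real k *\<^sub>R y n) [P (a s)..<Q (a s)]) 0"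
      using gsq_scale[of "real k" "map y [P (a s)..<Q (a s)]" 0] by (simp add: comp_def)
    also have "\<dots> = gsq (map (\<lambda>n. ?b n \<omega>' *\<^sub>R y n) [P (a s)..<Q (a s)]) 0"
    proof -
      have "map (\<lambda>n. real k *\<^sub>R y n) [P (a s)..<Q (a s)] = map (\<lambda>n. ?b n \<omega>' *\<^sub>R y n) [P (a s)..<Q (a s)]"
        by (rule map_cong[OF refl]) (simp add: b I_def)
      then show ?thesis by (simp only:)
    qed
    also have "\<dots> \<le> gsq (map (\<lambda>n. ?b n \<omega>' *\<^sub>R y n) [0..<N]) 0"
      unfolding split by (intro gsq_mono_mset) simp
    also have "\<dots> = (\<integral>\<^sup>+\<omega>. ?F \<omega>' \<omega> \<partial>M)" by (rule gsq_map_upt[OF M g, symmetric])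
    finally show ?case .
  qed
  then have "(\<integral>\<^sup>+\<omega>'. ennreal ((real k)\<^sup>2 * e) \<partial>M) \<le> (\<integral>\<^sup>+\<omega>'. \<integral>\<^sup>+\<omega>. ?F \<omega>' \<omega> \<partial>M \<partial>M)"
    by (rule nn_integral_mono_AE)
  then have "ennreal ((real k)\<^sup>2 * e) \<le> (\<integral>\<^sup>+\<omega>'. \<integral>\<^sup>+\<omega>. ?F \<omega>' \<omega> \<partial>M \<partial>M)"
    by (simp add: emeasure_space_1)
  also have "\<dots> = (\<integral>\<^sup>+\<omega>. \<integral>\<^sup>+\<omega>'. ?F \<omega>' \<omega> \<partial>M \<partial>M)"
    by (rule MM.Fubini'[OF F, symmetric])
  also have "\<dots> \<le> (\<integral>\<^sup>+\<omega>. (\<Sum>i<k. ennreal (c\<^sup>2) * ennreal ((norm (V i \<omega>))\<^sup>2)) \<partial>M)"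
  proof (rule nn_integral_mono)
    fix \<omega>
    have "(\<Sum>n<N. g n \<omega> *\<^sub>R (?b n \<omega>' *\<^sub>R y n)) = (\<Sum>i<k. r i \<omega>' *\<^sub>R V i \<omega>)" for \<omega>'
    proof -
      have "(\<Sum>n<N. g n \<omega> *\<^sub>R (?b n \<omega>' *\<^sub>R y n)) = (\<Sum>n<N. \<Sum>i<k. r i \<omega>' *\<^sub>R (g n \<omega> *\<^sub>R (\<sigma> i n *\<^sub>R y n)))"
        by (simp add: scaleR_sum_left scaleR_sum_right ac_simps)
      also have "\<dots> = (\<Sum>i<k. \<Sum>n<N. r i \<omega>' *\<^sub>R (g n \<omega> *\<^sub>R (\<sigma> i n *\<^sub>R y n)))" by (rule sum.swap)
      finally show ?thesis by (simp only: V_def scaleR_sum_right)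
    qed
    then have "(\<integral>\<^sup>+\<omega>'. ?F \<omega>' \<omega> \<partial>M) = (\<integral>\<^sup>+\<omega>'. ennreal ((norm (\<Sum>i<k. r i \<omega>' *\<^sub>R V i \<omega>))\<^sup>2) \<partial>M)"
      by (simp only:)
    also have "\<dots> \<le> ennreal (c\<^sup>2 * (\<Sum>i<k. (norm (V i \<omega>))\<^sup>2))" by (rule t2)
    also have "\<dots> = (\<Sum>i<k. ennreal (c\<^sup>2) * ennreal ((norm (V i \<omega>))\<^sup>2))"
      by (simp add: sum_distrib_left flip: ennreal_mult sum_ennreal)
    finally show "(\<integral>\<^sup>+\<omega>'. ?F \<omega>' \<omega> \<partial>M) \<le> (\<Sum>i<k. ennreal (c\<^sup>2) * ennreal ((norm (V i \<omega>))\<^sup>2))" .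
  qed
  also have "\<dots> = (\<Sum>i<k. ennreal (c\<^sup>2) * (\<integral>\<^sup>+\<omega>. ennreal ((norm (V i \<omega>))\<^sup>2) \<partial>M))"
  proof -
    have [measurable]: "(\<lambda>\<omega>. norm (V i \<omega>)) \<in> borel_measurable M" for i
      using borel_measurable_sequence_combination[of g M 0 "\<lambda>n. \<sigma> i n *\<^sub>R y n" "{..<N}"] by (simp add: V_def)
    show ?thesis by (simp add: nn_integral_sum nn_integral_cmult)
  qed
  also have "\<dots> \<le> (\<Sum>i<k. ennreal (c\<^sup>2) * ennreal C)"
  proof (intro sum_mono mult_left_mono)
    fix i
    have "(\<integral>\<^sup>+\<omega>. ennreal ((norm (V i \<omega>))\<^sup>2) \<partial>M) = gsq (map (\<lambda>n. \<sigma> i n *\<^sub>R y n) [0..<N]) 0"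
      unfolding V_def by (rule gsq_map_upt[OF M g])
    also have "\<dots> = gsq (map y [0..<N]) 0" by (rule gsq_signs) (simp add: \<sigma>_def)
    also have "\<dots> \<le> ennreal C" by (rule C)
    finally show "(\<integral>\<^sup>+\<omega>. ennreal ((norm (V i \<omega>))\<^sup>2) \<partial>M) \<le> ennreal C" .
  qed simp
  also have "\<dots> = ennreal (real k * (c\<^sup>2 * C))"
    using C(2) by (simp add: ennreal_mult ennreal_of_nat_eq_real_of_nat)
  finally have "(real k)\<^sup>2 * e \<le> real k * (c\<^sup>2 * C)"
    using C(2) by (subst (asm) ennreal_le_iff) auto
  then have "real k * e \<le> c\<^sup>2 * C" using k0 by (simp add: power2_eq_square mult.assoc)
  with k show False by simp
qed

section \<open>Convergence in \<open>L\<^sub>2\<close>\<close>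

lemma strongly_measurable_sum:
  assumes "\<And>n. n \<in> I \<Longrightarrow> strongly_measurable M (X n)"
  shows "strongly_measurable M (\<lambda>\<omega>. \<Sum>n\<in>I. X n \<omega>)"
proof -
  obtain s where s: "\<And>n i. n \<in> I \<Longrightarrow> simple_function M (s n i)"
    "\<And>n \<omega>. n \<in> I \<Longrightarrow> \<omega> \<in> space M \<Longrightarrow> (\<lambda>i. s n i \<omega>) \<longlonglongrightarrow> X n \<omega>"
    using assms unfolding strongly_measurable_def by metis
  show ?thesis
    unfolding strongly_measurable_def
    by (rule exI[of _ "\<lambda>i \<omega>. \<Sum>n\<in>I. s n i \<omega>"])
      (auto intro!: simple_function_sum tendsto_sum s)
qed

lemma strongly_measurable_scaleR:
  assumes g: "g \<in> borel_measurable M"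
  shows "strongly_measurable M (\<lambda>\<omega>. (g \<omega> :: real) *\<^sub>R y)"
proof -
  obtain s where s: "\<And>i. simple_function M (s i)" "\<And>\<omega>. \<omega> \<in> space M \<Longrightarrow> (\<lambda>i. s i \<omega>) \<longlonglongrightarrow> g \<omega>"
    using borel_measurable_implies_sequence_metric[OF g, of 0] by metis
  have "simple_function M (\<lambda>\<omega>. s i \<omega> *\<^sub>R y)" for i
    using simple_function_compose1[OF s(1)[of i], of "\<lambda>t. t *\<^sub>R y"] by simp
  then show ?thesis
    unfolding strongly_measurable_def using s(2)
    by (intro exI[of _ "\<lambda>i \<omega>. s i \<omega> *\<^sub>R y"]) (auto intro!: tendsto_scaleR)
qed

lemma strongly_measurable_dist:
  assumes "strongly_measurable M X"
  shows "(\<lambda>\<omega>. dist (X \<omega>) d) \<in> borel_measurable M"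
proof -
  obtain s where s: "\<And>i. simple_function M (s i)" "\<And>\<omega>. \<omega> \<in> space M \<Longrightarrow> (\<lambda>i. s i \<omega>) \<longlonglongrightarrow> X \<omega>"
    using assms unfolding strongly_measurable_def by blast
  show ?thesis
  proof (rule borel_measurable_LIMSEQ_real)
    show "(\<lambda>i. dist (s i \<omega>) d) \<longlonglongrightarrow> dist (X \<omega>) d" if "\<omega> \<in> space M" for \<omega>
      by (intro tendsto_intros s that)
    show "(\<lambda>\<omega>. dist (s i \<omega>) d) \<in> borel_measurable M" for i
      using simple_function_compose1[OF s(1)[of i], of "\<lambda>z. dist z d"]
      by (rule borel_measurable_simple_function)
  qed
qed

lemma strongly_measurable_norm:
  "strongly_measurable M X \<Longrightarrow> (\<lambda>\<omega>. norm (X \<omega>)) \<in> borel_measurable M"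
  using strongly_measurable_dist[of M X 0] by simp

lemma strongly_measurable_diff:
  assumes "strongly_measurable M X" "strongly_measurable M Y"
  shows "strongly_measurable M (\<lambda>\<omega>. X \<omega> - Y \<omega>)"
proof -
  obtain s t where s: "\<And>i. simple_function M (s i)" "\<And>\<omega>. \<omega> \<in> space M \<Longrightarrow> (\<lambda>i. s i \<omega>) \<longlonglongrightarrow> X \<omega>"
    and t: "\<And>i. simple_function M (t i)" "\<And>\<omega>. \<omega> \<in> space M \<Longrightarrow> (\<lambda>i. t i \<omega>) \<longlonglongrightarrow> Y \<omega>"
    using assms unfolding strongly_measurable_def by metis
  show ?thesis
    unfolding strongly_measurable_def
    by (rule exI[of _ "\<lambda>i \<omega>. s i \<omega> - t i \<omega>"]) (auto intro!: simple_function_diff tendsto_diff s t)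
qed

text \<open>
  The \<open>i\<close>-th simple approximation maps \<open>\<omega>\<close> to the point closest to \<open>X \<omega>\<close> among the first points of an
  enumeration of \<open>D\<close>.
\<close>

lemma strongly_measurableI_separable:
  fixes X :: "'w \<Rightarrow> 'f::real_normed_vector"
  assumes D: "countable D" "\<And>\<omega>. \<omega> \<in> space M \<Longrightarrow> X \<omega> \<in> closure D"
    and meas: "\<And>d. d \<in> D \<Longrightarrow> (\<lambda>\<omega>. dist (X \<omega>) d) \<in> borel_measurable M"
  shows "strongly_measurable M X"
proof (cases "D = {}")
  case True
  then have "space M = {}" using D(2) by auto
  then show ?thesis
    unfolding strongly_measurable_def by (intro exI[of _ "\<lambda>_ _. 0"]) simp
next
  case False
  define e where "e = from_nat_into D"
  have e: "range e = D" unfolding e_def using D(1) False by (rule range_from_nat_into[rotated])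
  have [measurable]: "(\<lambda>\<omega>. dist (X \<omega>) (e j)) \<in> borel_measurable M" for j
    using e by (intro meas) auto
  define P where "P i \<omega> j \<longleftrightarrow> j \<le> i \<and> (\<forall>l\<in>{..i}. dist (X \<omega>) (e j) \<le> dist (X \<omega>) (e l))" for i \<omega> j
  define J where "J i \<omega> = (LEAST j. P i \<omega> j)" for i :: nat and \<omega>
  have P: "P i \<omega> (J i \<omega>)" for i \<omega>
  proof -
    obtain j where "j \<in> {..i}" "\<forall>l\<in>{..i}. dist (X \<omega>) (e j) \<le> dist (X \<omega>) (e l)"
      using ex_min_if_finite[of "(\<lambda>j. dist (X \<omega>) (e j)) ` {..i}"] by (auto simp: not_less)
    then have "P i \<omega> j" by (simp add: P_def)
    then show ?thesis unfolding J_def by (rule LeastI)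
  qed
  have J[measurable]: "J i \<in> M \<rightarrow>\<^sub>M count_space UNIV" for i
    unfolding J_def[abs_def] P_def by measurable
  have simple: "simple_function M (\<lambda>\<omega>. e (J i \<omega>))" for i
    unfolding simple_function_def
  proof (intro conjI ballI)
    have "(\<lambda>\<omega>. e (J i \<omega>)) ` space M \<subseteq> e ` {..i}" using P by (auto simp: P_def)
    then show "finite ((\<lambda>\<omega>. e (J i \<omega>)) ` space M)" by (rule finite_subset) simp
    show "(\<lambda>\<omega>. e (J i \<omega>)) -` {z} \<inter> space M \<in> sets M" for z
    proof -
      have "(\<lambda>\<omega>. e (J i \<omega>)) -` {z} \<inter> space M = J i -` (e -` {z}) \<inter> space M" by auto
      also have "\<dots> \<in> sets M" by (rule measurable_sets[OF J]) simp
      finally show ?thesis .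
    qed
  qed
  have conv: "(\<lambda>i. e (J i \<omega>)) \<longlonglongrightarrow> X \<omega>" if \<omega>: "\<omega> \<in> space M" for \<omega>
  proof (rule metric_LIMSEQ_I)
    fix \<epsilon> :: real assume "0 < \<epsilon>"
    then obtain d where "d \<in> D" "dist d (X \<omega>) < \<epsilon>" using D(2)[OF \<omega>] by (meson closure_approachable)
    then obtain j where j: "dist (X \<omega>) (e j) < \<epsilon>" using e by (auto simp: dist_commute)
    have "dist (e (J i \<omega>)) (X \<omega>) < \<epsilon>" if "i \<ge> j" for i
      using P[of i \<omega>] that j unfolding P_def by (metis atMost_iff dist_commute le_less_trans)
    then show "\<exists>n. \<forall>i\<ge>n. dist (e (J i \<omega>)) (X \<omega>) < \<epsilon>" by blast
  qed
  show ?thesis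
    unfolding strongly_measurable_def using simple conv by (intro exI[of _ "\<lambda>i \<omega>. e (J i \<omega>)"]) auto
qed

lemma strongly_measurable_limit:
  fixes X :: "'w \<Rightarrow> 'f::real_normed_vector"
  assumes S: "\<And>k::nat. strongly_measurable M (S k)" and A: "A \<in> sets M"
    and lim: "\<And>\<omega>. \<omega> \<in> A \<Longrightarrow> (\<lambda>k. S k \<omega>) \<longlonglongrightarrow> X \<omega>" and zero: "\<And>\<omega>. \<omega> \<notin> A \<Longrightarrow> X \<omega> = 0"
  shows "strongly_measurable M X"
proof -
  obtain s where s: "\<And>k i. simple_function M (s k i)" "\<And>k \<omega>. \<omega> \<in> space M \<Longrightarrow> (\<lambda>i. s k i \<omega>) \<longlonglongrightarrow> S k \<omega>"
    using S unfolding strongly_measurable_def by metis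
  define D where "D = insert 0 (\<Union>k i. s k i ` space M)"
  show ?thesis
  proof (rule strongly_measurableI_separable)
    show "countable D"
      using simple_functionD(1)[OF s(1)] unfolding D_def by (simp add: countable_finite)
    show "X \<omega> \<in> closure D" if \<omega>: "\<omega> \<in> space M" for \<omega>
    proof (cases "\<omega> \<in> A")
      case True
      have "S k \<omega> \<in> closure D" for k
      proof (rule Lim_in_closed_set[OF closed_closure _ _ s(2)[OF \<omega>]])
        have "s k i \<omega> \<in> D" for i using \<omega> by (auto simp: D_def)
        then show "\<forall>\<^sub>F i in sequentially. s k i \<omega> \<in> closure D"
          using closure_subset[of D] by (intro always_eventually) blast
      qed simp
      then show ?thesis
        by (intro Lim_in_closed_set[OF closed_closure _ _ lim[OF True]]) auto
    next
      case False
      then show ?thesis using closure_subset[of D] by (auto simp: zero D_def)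
    qed
    show "(\<lambda>\<omega>. dist (X \<omega>) d) \<in> borel_measurable M" for d
    proof (rule borel_measurable_LIMSEQ_real)
      note [measurable] = strongly_measurable_dist[OF S] A
      show "(\<lambda>\<omega>. if \<omega> \<in> A then dist (S k \<omega>) d else dist 0 d) \<in> borel_measurable M" for k
        by measurable
      show "(\<lambda>k. if \<omega> \<in> A then dist (S k \<omega>) d else dist 0 d) \<longlonglongrightarrow> dist (X \<omega>) d" if "\<omega> \<in> space M" for \<omega>
        by (cases "\<omega> \<in> A") (auto simp: zero intro: tendsto_dist lim)
    qed
  qed
qed

lemma in_L2_gaussian:
  assumes M: "prob_space M" and g: "gaussian_sequence M g"
  shows "in_L2 M (\<lambda>\<omega>. g n \<omega> *\<^sub>R y)"
proof -
  note [measurable] = gaussian_sequence_measurable(1)[OF M g]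
  have "(\<integral>\<^sup>+\<omega>. ennreal ((norm (g n \<omega> *\<^sub>R y))\<^sup>2) \<partial>M) = (\<integral>\<^sup>+\<omega>. ennreal ((norm y)\<^sup>2) * ennreal ((g n \<omega>)\<^sup>2) \<partial>M)"
    by (simp add: power_mult_distrib ennreal_mult mult.commute)
  also have "\<dots> = ennreal ((norm y)\<^sup>2)"
    by (simp add: nn_integral_cmult gaussian_second_moment[OF M g])
  finally show ?thesis by (simp add: in_L2_def strongly_measurable_scaleR)
qed

lemma ennreal_norm_diff_le:
  "ennreal ((norm x)\<^sup>2) \<le> 2 * ennreal ((norm (x - y))\<^sup>2) + 2 * ennreal ((norm y)\<^sup>2)"
proof -
  have "norm x \<le> norm (x - y) + norm y" using norm_triangle_ineq[of "x - y" y] by simp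
  then have "(norm x)\<^sup>2 \<le> (norm (x - y) + norm y)\<^sup>2" by (intro power_mono) auto
  also have "\<dots> \<le> 2 * (norm (x - y))\<^sup>2 + 2 * (norm y)\<^sup>2"
    using sum_squares_bound[of "norm (x - y)" "norm y"] by (simp add: power2_sum)
  finally have "ennreal ((norm x)\<^sup>2) \<le> ennreal (2 * (norm (x - y))\<^sup>2 + 2 * (norm y)\<^sup>2)"
    by (rule ennreal_leI)
  then show ?thesis by (simp add: ennreal_mult)
qed

lemma gaussian_increment:
  assumes M: "prob_space M" and g: "gaussian_sequence M g"
    and small: "\<And>p q. m \<le> p \<Longrightarrow> gsq (map y [p..<q]) 0 < ennreal e" and pq: "m \<le> p" "m \<le> q"
  shows "(\<integral>\<^sup>+\<omega>. ennreal ((norm ((\<Sum>n<q. g n \<omega> *\<^sub>R y n) - (\<Sum>n<p. g n \<omega> *\<^sub>R y n)))\<^sup>2) \<partial>M) < ennreal e"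
proof -
  have le: "(\<integral>\<^sup>+\<omega>. ennreal ((norm ((\<Sum>n<q. g n \<omega> *\<^sub>R y n) - (\<Sum>n<p. g n \<omega> *\<^sub>R y n)))\<^sup>2) \<partial>M) < ennreal e"
    if "p \<le> q" "m \<le> p" for p q
  proof -
    have "(\<Sum>n<q. g n \<omega> *\<^sub>R y n) - (\<Sum>n<p. g n \<omega> *\<^sub>R y n) = (\<Sum>n\<in>set [p..<q]. g n \<omega> *\<^sub>R y n)" for \<omega>
    proof -
      have "{..<q} - {..<p} = set [p..<q]" by auto
      then show ?thesis using sum_diff[of "{..<q}" "{..<p}" "\<lambda>n. g n \<omega> *\<^sub>R y n"] that by simp
    qed
    then show ?thesis using gaussian_sum_eq_gsq[OF M g, of "[p..<q]" y] small[OF that(2)] by simp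
  qed
  show ?thesis
  proof (cases "p \<le> q")
    case False
    then show ?thesis using le[of q p] pq by (simp add: norm_minus_commute)
  qed (use le pq in blast)
qed

text \<open>
  The Riesz-Fischer argument. Along a subsequence the increments \<open>d\<^sub>k\<close> satisfy
  \<open>E d\<^sub>k\<^sup>2 \<le> 4\<^sup>-\<^sup>k\<close>, so they are almost surely summable, and Fatou's lemma
  identifies the pointwise limit as the limit in \<open>L\<^sub>2\<close>.
\<close>

lemma gsq_Cauchy_imp_converges:
  fixes y :: "nat \<Rightarrow> 'f::banach"
  assumes M: "prob_space M" and g: "gaussian_sequence M g"
    and fin: "\<And>N. gsq (map y [0..<N]) 0 < \<infinity>"
    and Cauchy: "\<And>e. 0 < e \<Longrightarrow> \<exists>m. \<forall>p\<ge>m. \<forall>q. gsq (map y [p..<q]) 0 < ennreal e"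
  shows "series_converges_L2 M (\<lambda>n \<omega>. g n \<omega> *\<^sub>R y n)"
proof -
  interpret prob_space M by fact
  define S where "S N \<omega> = (\<Sum>n<N. g n \<omega> *\<^sub>R y n)" for N \<omega>
  have S_meas: "strongly_measurable M (S N)" for N
    unfolding S_def[abs_def]
    by (intro strongly_measurable_sum strongly_measurable_scaleR gaussian_sequence_measurable(1)[OF M g])
  note [measurable] = strongly_measurable_norm[OF strongly_measurable_diff[OF S_meas S_meas]]
    strongly_measurable_norm[OF S_meas]
  obtain m0 where m0: "\<And>e p q. 0 < e \<Longrightarrow> m0 e \<le> p \<Longrightarrow> gsq (map y [p..<q]) 0 < ennreal e"
    using Cauchy by metis
  have incr: "(\<integral>\<^sup>+\<omega>. ennreal ((norm (S q \<omega> - S p \<omega>))\<^sup>2) \<partial>M) < ennreal e"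
    if "0 < e" "m0 e \<le> p" "m0 e \<le> q" for e p q
    unfolding S_def by (rule gaussian_increment[OF M g m0]) (use that in auto)
  \<comment> \<open>The summand \<open>k\<close> makes the subsequence tend to infinity even if \<open>m0\<close> is bounded.\<close>
  define m where "m k = k + (\<Sum>j\<le>k. m0 ((1/4) ^ j))" for k :: nat
  have m_ge: "m0 ((1/4) ^ k) \<le> m k" for k
    unfolding m_def by (rule trans_le_add2) (intro member_le_sum, auto)
  have m_Suc: "m k \<le> m (Suc k)" for k by (simp add: m_def)
  have m_k: "k \<le> m k" for k by (simp add: m_def)
  define d where "d k \<omega> = norm (S (m (Suc k)) \<omega> - S (m k) \<omega>)" for k \<omega>
  have [measurable]: "d k \<in> borel_measurable M" for k unfolding d_def by measurable
  have d_int: "(\<integral>\<^sup>+\<omega>. ennreal ((d k \<omega>)\<^sup>2) \<partial>M) \<le> ennreal ((1/4) ^ k)" for k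
    unfolding d_def using m_ge[of k] m_Suc[of k] by (intro incr[THEN less_imp_le]) auto
  have d_int1: "(\<integral>\<^sup>+\<omega>. ennreal (d k \<omega>) \<partial>M) \<le> ennreal (2 * (1/2) ^ k)" for k
  proof -
    \<comment> \<open>Arithmetic-geometric mean inequality; it replaces the Cauchy-Schwarz inequality for integrals.\<close>
    have "ennreal (d k \<omega>) \<le> ennreal ((1/2) ^ k) + ennreal (2 ^ k) * ennreal ((d k \<omega>)\<^sup>2)" for \<omega>
    proof -
      define t where "t = (2::real) ^ k"
      have t: "0 < t" "(1/2::real) ^ k = 1 / t" by (simp_all add: t_def power_one_over)
      have "0 \<le> (t * d k \<omega> - 1)\<^sup>2" by simp
      then have "2 * (t * d k \<omega>) \<le> t\<^sup>2 * (d k \<omega>)\<^sup>2 + 1" by (simp add: power2_diff power_mult_distrib)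
      moreover have "0 \<le> t * d k \<omega>" using t by (simp add: d_def)
      ultimately have "t * d k \<omega> \<le> 1 + t * (t * (d k \<omega>)\<^sup>2)" by (simp add: power2_eq_square)
      then have "d k \<omega> \<le> 1 / t + t * (d k \<omega>)\<^sup>2" using t(1) by (simp add: field_simps)
      then have "ennreal (d k \<omega>) \<le> ennreal ((1/2) ^ k + 2 ^ k * (d k \<omega>)\<^sup>2)"
        unfolding t(2) t_def[symmetric] by (rule ennreal_leI)
      then show ?thesis by (simp add: ennreal_mult)
    qed
    then have "(\<integral>\<^sup>+\<omega>. ennreal (d k \<omega>) \<partial>M) \<le> (\<integral>\<^sup>+\<omega>. ennreal ((1/2) ^ k) + ennreal (2 ^ k) * ennreal ((d k \<omega>)\<^sup>2) \<partial>M)"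
      by (intro nn_integral_mono)
    also have "\<dots> = ennreal ((1/2) ^ k) + ennreal (2 ^ k) * (\<integral>\<^sup>+\<omega>. ennreal ((d k \<omega>)\<^sup>2) \<partial>M)"
      by (simp add: nn_integral_add nn_integral_cmult emeasure_space_1)
    also have "\<dots> \<le> ennreal ((1/2) ^ k) + ennreal (2 ^ k) * ennreal ((1/4) ^ k)"
      by (intro add_left_mono mult_left_mono d_int) simp
    also have "\<dots> = ennreal ((1/2) ^ k + 2 ^ k * (1/4) ^ k)" by (simp add: ennreal_mult)
    also have "(1/2::real) ^ k + 2 ^ k * (1/4) ^ k = 2 * (1/2) ^ k"
      by (simp flip: power_mult_distrib)
    finally show ?thesis .
  qed
  define A where "A = {\<omega> \<in> space M. (\<Sum>k. ennreal (d k \<omega>)) \<noteq> \<infinity>}"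
  have A[measurable]: "A \<in> sets M" unfolding A_def by measurable
  have "(\<integral>\<^sup>+\<omega>. (\<Sum>k. ennreal (d k \<omega>)) \<partial>M) = (\<Sum>k. \<integral>\<^sup>+\<omega>. ennreal (d k \<omega>) \<partial>M)"
    by (rule nn_integral_suminf) measurable
  also have "\<dots> \<le> (\<Sum>k. ennreal (2 * (1/2) ^ k))" by (intro suminf_le d_int1) auto
  also have "\<dots> < \<infinity>"
  proof -
    have "summable (\<lambda>k. 2 * (1/2::real) ^ k)" by (intro summable_mult summable_geometric) simp
    then show ?thesis by (simp add: suminf_ennreal2)
  qed
  finally have "AE \<omega> in M. (\<Sum>k. ennreal (d k \<omega>)) \<noteq> \<infinity>"
    by (intro nn_integral_noteq_infinite) auto
  then have AE_A: "AE \<omega> in M. \<omega> \<in> A" by (auto simp: A_def)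
  define X where "X \<omega> = (if \<omega> \<in> A then lim (\<lambda>k. S (m k) \<omega>) else 0)" for \<omega>
  have lim: "(\<lambda>k. S (m k) \<omega>) \<longlonglongrightarrow> X \<omega>" if "\<omega> \<in> A" for \<omega>
  proof -
    have "summable (\<lambda>k. d k \<omega>)"
      using that by (intro summable_suminf_not_top) (auto simp: A_def d_def)
    then have "summable (\<lambda>k. S (m (Suc k)) \<omega> - S (m k) \<omega>)"
      unfolding d_def by (rule summable_norm_cancel)
    then have "convergent (\<lambda>N. \<Sum>k<N. S (m (Suc k)) \<omega> - S (m k) \<omega>)"
      by (simp add: summable_iff_convergent)
    then have "convergent (\<lambda>N. S (m N) \<omega> - S (m 0) \<omega>)"
      by (simp only: sum_lessThan_telescope[of "\<lambda>k. S (m k) \<omega>"])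
    then have "convergent (\<lambda>N. S (m N) \<omega>)" by (simp add: convergent_diff_const_right_iff)
    then show ?thesis using that by (simp add: X_def convergent_LIMSEQ_iff)
  qed
  have X_meas: "strongly_measurable M X"
    by (rule strongly_measurable_limit[OF S_meas A lim]) (simp_all add: X_def)
  note [measurable] = strongly_measurable_norm[OF X_meas]
    strongly_measurable_norm[OF strongly_measurable_diff[OF S_meas X_meas]]
    strongly_measurable_norm[OF strongly_measurable_diff[OF X_meas S_meas]]
  have close: "(\<integral>\<^sup>+\<omega>. ennreal ((norm (S N \<omega> - X \<omega>))\<^sup>2) \<partial>M) \<le> ennreal e" if e: "0 < e" and N: "m0 e \<le> N" for e N
  proof -
    have "(\<integral>\<^sup>+\<omega>. ennreal ((norm (S N \<omega> - X \<omega>))\<^sup>2) \<partial>M)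
        = (\<integral>\<^sup>+\<omega>. liminf (\<lambda>k. ennreal ((norm (S N \<omega> - S (m k) \<omega>))\<^sup>2)) \<partial>M)"
    proof (rule nn_integral_cong_AE)
      show "AE \<omega> in M. ennreal ((norm (S N \<omega> - X \<omega>))\<^sup>2) = liminf (\<lambda>k. ennreal ((norm (S N \<omega> - S (m k) \<omega>))\<^sup>2))"
        using AE_A
      proof eventually_elim
        case (elim \<omega>)
        have "(\<lambda>k. ennreal ((norm (S N \<omega> - S (m k) \<omega>))\<^sup>2)) \<longlonglongrightarrow> ennreal ((norm (S N \<omega> - X \<omega>))\<^sup>2)"
          by (intro tendsto_ennrealI tendsto_intros lim elim)
        then show ?case by (intro lim_imp_Liminf[symmetric]) simp_all
      qed
    qed
    also have "\<dots> \<le> liminf (\<lambda>k. \<integral>\<^sup>+\<omega>. ennreal ((norm (S N \<omega> - S (m k) \<omega>))\<^sup>2) \<partial>M)"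
      by (rule nn_integral_liminf) measurable
    also have "\<dots> \<le> liminf (\<lambda>k::nat. ennreal e)"
    proof (rule Liminf_mono)
      show "\<forall>\<^sub>F k in sequentially. (\<integral>\<^sup>+\<omega>. ennreal ((norm (S N \<omega> - S (m k) \<omega>))\<^sup>2) \<partial>M) \<le> ennreal e"
        using eventually_ge_at_top[of "m0 e"]
      proof eventually_elim
        case (elim k)
        then have "m0 e \<le> m k" using m_k[of k] by simp
        then show ?case by (intro incr[THEN less_imp_le] e N)
      qed
    qed
    also have "\<dots> = ennreal e" by (simp add: Liminf_const)
    finally show ?thesis .
  qed
  have X_L2: "in_L2 M X"
  proof -
    define N where "N = m0 1"
    have "(\<integral>\<^sup>+\<omega>. ennreal ((norm (X \<omega>))\<^sup>2) \<partial>M)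
        \<le> (\<integral>\<^sup>+\<omega>. 2 * ennreal ((norm (S N \<omega> - X \<omega>))\<^sup>2) + 2 * ennreal ((norm (S N \<omega>))\<^sup>2) \<partial>M)"
      by (intro nn_integral_mono) (metis ennreal_norm_diff_le norm_minus_commute)
    also have "\<dots> = 2 * (\<integral>\<^sup>+\<omega>. ennreal ((norm (S N \<omega> - X \<omega>))\<^sup>2) \<partial>M) + 2 * (\<integral>\<^sup>+\<omega>. ennreal ((norm (S N \<omega>))\<^sup>2) \<partial>M)"
      by (simp add: nn_integral_add nn_integral_cmult)
    also have "\<dots> < \<infinity>"
    proof -
      have "(\<integral>\<^sup>+\<omega>. ennreal ((norm (S N \<omega> - X \<omega>))\<^sup>2) \<partial>M) < \<infinity>"
        using close[of 1 N] by (simp add: N_def le_less_trans)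
      moreover have "(\<integral>\<^sup>+\<omega>. ennreal ((norm (S N \<omega>))\<^sup>2) \<partial>M) < \<infinity>"
        unfolding S_def gsq_map_upt[OF M g] by (rule fin)
      ultimately show ?thesis by (simp add: ennreal_mult_less_top)
    qed
    finally show ?thesis using X_meas by (simp add: in_L2_def)
  qed
  have "(\<lambda>N. \<integral>\<^sup>+\<omega>. ennreal ((norm (S N \<omega> - X \<omega>))\<^sup>2) \<partial>M) \<longlonglongrightarrow> 0"
  proof (rule tendsto_zero_ennreal)
    fix e :: real assume e: "0 < e"
    show "\<forall>\<^sub>F N in sequentially. (\<integral>\<^sup>+\<omega>. ennreal ((norm (S N \<omega> - X \<omega>))\<^sup>2) \<partial>M) < ennreal e"
      using eventually_ge_at_top[of "m0 (e / 2)"]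
    proof eventually_elim
      case (elim N)
      have "(\<integral>\<^sup>+\<omega>. ennreal ((norm (S N \<omega> - X \<omega>))\<^sup>2) \<partial>M) \<le> ennreal (e / 2)"
        using e elim by (intro close) auto
      also have "\<dots> < ennreal e" using e by (simp add: ennreal_less_iff)
      finally show ?case .
    qed
  qed
  then show ?thesis
    unfolding series_converges_L2_def using in_L2_gaussian[OF M g] X_L2 by (auto simp: S_def)
qed

section \<open>From radonifying to pre-Hilbert-Schmidt operators\<close>

context hilbert_space
begin

lemma inner_add_right:
  "\<lbrakk>x \<in> carr H; y \<in> carr H; z \<in> carr H\<rbrakk> \<Longrightarrow> hinner H z (hadd H x y) = hinner H z x + hinner H z y"
  using inner_add_left inner_commute add_closed by metis

lemma inner_scale_right:
  "\<lbrakk>x \<in> carr H; y \<in> carr H\<rbrakk> \<Longrightarrow> hinner H y (hscale H a x) = a * hinner H y x"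
  using inner_scale_left inner_commute scale_closed by metis

lemma inner_nonneg: "x \<in> carr H \<Longrightarrow> 0 \<le> hinner H x x"
proof (cases "x = hzero H")
  case True
  assume x: "x \<in> carr H"
  have "hinner H x x + hinner H x x = hinner H x x"
    using inner_add_left[OF x x x] add_zero[OF x] True by simp
  then show ?thesis by simp
qed (use inner_pos less_imp_le in blast)

lemma norm_power2: "x \<in> carr H \<Longrightarrow> (hnorm H x)\<^sup>2 = hinner H x x"
  by (simp add: hnorm_def inner_nonneg)

lemma orthonormal_basis_exists: "\<exists>B. orthonormal_basis H B"
proof -
  define A where "A = {S. S \<subseteq> carr H \<and> (\<forall>b\<in>S. \<forall>c\<in>S. hinner H b c = (if b = c then 1 else 0))}"
  have "\<exists>B\<in>A. \<forall>S\<in>A. B \<subseteq> S \<longrightarrow> S = B"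
  proof (rule subset_Zorn')
    fix C assume C: "subset.chain A C"
    have CA: "C \<subseteq> A" using C by (simp add: subset.chain_def)
    have "hinner H b c = (if b = c then 1 else 0)" if bc: "b \<in> \<Union>C" "c \<in> \<Union>C" for b c
    proof -
      obtain S T where ST: "S \<in> C" "b \<in> S" "T \<in> C" "c \<in> T" using bc by blast
      then have "S \<subseteq> T \<or> T \<subseteq> S" using C by (simp add: subset_chain_def)
      then obtain U where "U \<in> C" "b \<in> U" "c \<in> U" using ST by blast
      then show ?thesis using CA unfolding A_def by blast
    qed
    moreover have "\<Union>C \<subseteq> carr H" using CA unfolding A_def by blast
    ultimately show "\<Union>C \<in> A" unfolding A_def by blast
  qed
  then obtain B where B: "B \<in> A" and max: "\<And>S. S \<in> A \<Longrightarrow> B \<subseteq> S \<Longrightarrow> S = B" by blast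
  have "x = hzero H" if x: "x \<in> carr H" "\<forall>b\<in>B. hinner H x b = 0" for x
  proof (rule ccontr)
    assume nz: "x \<noteq> hzero H"
    define t where "t = 1 / sqrt (hinner H x x)"
    define e where "e = hscale H t x"
    have e: "e \<in> carr H" unfolding e_def by (rule scale_closed[OF x(1)])
    have ee: "hinner H e e = 1"
      using inner_pos[OF x(1) nz] unfolding e_def
      by (simp add: inner_scale_left inner_scale_right scale_closed x(1) t_def)
    have eb: "hinner H e b = 0" "hinner H b e = 0" if b: "b \<in> B" for b
    proof -
      have bc: "b \<in> carr H" using b B by (auto simp: A_def)
      then show "hinner H e b = 0" unfolding e_def using x b by (simp add: inner_scale_left)
      then show "hinner H b e = 0" using inner_commute[OF bc e] by simp
    qed
    have "insert e B \<in> A"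
      using B e ee eb unfolding A_def by auto
    then have "e \<in> B" using max by blast
    then show False using eb(1) ee by simp
  qed
  then have "orthonormal_basis H B" using B unfolding orthonormal_basis_def A_def by blast
  then show ?thesis ..
qed

text \<open>
  With \<open>a\<^sub>n = f (v b\<^sub>n)\<close> and \<open>t = \<Sum>\<^sub>n a\<^sub>n b\<^sub>n\<close> one has \<open>f (v t) = \<Sum>\<^sub>n a\<^sub>n\<^sup>2 = \<parallel>t\<parallel>\<^sup>2\<close>, and boundedness
  of \<open>v\<close> bounds \<open>\<parallel>t\<parallel>\<close>.
\<close>

lemma bessel_weakly_2_summable:
  fixes v :: "'h \<Rightarrow> 'e::real_normed_vector"
  assumes v: "bounded_op_from H v" and b: "\<And>n. b n \<in> carr H"
    and orth: "\<And>m n::nat. hinner H (b m) (b n) = (if m = n then 1 else 0)"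
  shows "weakly_2_summable (\<lambda>n. v (b n))"
proof -
  obtain K where K: "\<And>x. x \<in> carr H \<Longrightarrow> norm (v x) \<le> K * hnorm H x"
    using v unfolding bounded_op_from_def by blast
  have v_add: "v (hadd H x y) = v x + v y" if "x \<in> carr H" "y \<in> carr H" for x y
    using v that unfolding bounded_op_from_def by blast
  have v_scale: "v (hscale H a x) = a *\<^sub>R v x" if "x \<in> carr H" for x a
    using v that unfolding bounded_op_from_def by blast
  have bound: "(\<Sum>n<N. (blinfun_apply f (v (b n)))\<^sup>2) \<le> K\<^sup>2" if f: "norm f \<le> 1" for N and f :: "'e \<Rightarrow>\<^sub>L real"
  proof -
    define a where "a n = blinfun_apply f (v (b n))" for n
    define t where "t = rec_nat (hscale H 0 (b 0)) (\<lambda>n s. hadd H s (hscale H (a n) (b n)))"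
    have t_0: "t 0 = hscale H 0 (b 0)" and t_Suc: "t (Suc n) = hadd H (t n) (hscale H (a n) (b n))" for n
      by (simp_all add: t_def)
    have t: "t n \<in> carr H" for n
      by (induction n) (simp_all add: t_0 t_Suc scale_closed add_closed b)
    have tb: "hinner H (t n) (b m) = (if m < n then a m else 0)" for n m
      by (induction n) (auto simp: t_0 t_Suc inner_add_left inner_scale_left scale_closed b t orth less_Suc_eq)
    have tt: "hinner H (t n) (t n) = (\<Sum>i<n. (a i)\<^sup>2)" for n
    proof (induction n)
      case 0
      show ?case by (simp add: t_0 inner_scale_left scale_closed b)
    next
      case (Suc n)
      have "hinner H (b n) (t n) = 0" using inner_commute[OF b t] by (simp add: tb)
      then show ?case
        by (simp add: t_Suc inner_add_left inner_add_right inner_scale_left inner_scale_right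
            scale_closed add_closed b t tb orth Suc power2_eq_square)
    qed
    have vt: "blinfun_apply f (v (t n)) = (\<Sum>i<n. (a i)\<^sup>2)" for n
      by (induction n)
        (simp_all add: t_0 t_Suc v_add v_scale scale_closed b t blinfun.add_right blinfun.scaleR_right
          a_def power2_eq_square)
    define s where "s = (\<Sum>n<N. (a n)\<^sup>2)"
    have s0: "0 \<le> s" by (simp add: s_def sum_nonneg)
    have "s = blinfun_apply f (v (t N))" by (simp add: s_def vt)
    also have "\<dots> \<le> norm f * norm (v (t N))"
      using norm_blinfun[of f "v (t N)"] by simp
    also have "\<dots> \<le> norm (v (t N))" using f by (simp add: mult_left_le_one_le)
    also have "\<dots> \<le> K * sqrt s" using K[OF t[of N]] by (simp add: hnorm_def tt s_def)
    finally have "s\<^sup>2 \<le> (K * sqrt s)\<^sup>2" using s0 by (intro power_mono)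
    then have "s * s \<le> K\<^sup>2 * s" using s0 by (simp add: power_mult_distrib power2_eq_square[of s])
    then have "s \<le> K\<^sup>2" using s0 by (cases "s = 0") (auto simp: mult_le_cancel_right)
    then show ?thesis by (simp add: s_def a_def)
  qed
  have "(SUP f \<in> {f :: 'e \<Rightarrow>\<^sub>L real. norm f \<le> 1}. \<Sum>n. ennreal (\<bar>blinfun_apply f (v (b n))\<bar>\<^sup>2)) \<le> ennreal (K\<^sup>2)"
  proof (rule SUP_least)
    fix f :: "'e \<Rightarrow>\<^sub>L real" assume "f \<in> {f. norm f \<le> 1}"
    then show "(\<Sum>n. ennreal (\<bar>blinfun_apply f (v (b n))\<bar>\<^sup>2)) \<le> ennreal (K\<^sup>2)"
      unfolding suminf_eq_SUP by (intro SUP_least) (simp add: sum_ennreal ennreal_leI bound)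
  qed
  then show ?thesis unfolding weakly_2_summable_def by (rule le_less_trans) simp
qed

lemma psd_form_pullback:
  fixes w :: "'f::real_normed_vector \<Rightarrow> 'h"
  assumes w: "bounded_op_into H w"
  shows "psd_form (\<lambda>x y. hinner H (w x) (w y))"
proof -
  have wc: "w x \<in> carr H" and wa: "w (x + y) = hadd H (w x) (w y)" and ws: "w (a *\<^sub>R x) = hscale H a (w x)"
    for x y a using w by (simp_all add: bounded_op_into_def)
  show ?thesis
    unfolding psd_form_def
    by (simp add: linear_iff wa ws wc inner_add_right inner_scale_right inner_nonneg inner_commute[OF wc wc])
qed

end

text \<open>
  For a quadratic form the cross terms cancel upon averaging over the signs of the Gaussian
  variables, so its second moment is the plain sum.
\<close>

lemma psd_form_le_gsq:
  assumes B: "psd_form B" and K: "\<And>x. B x x \<le> K * (norm x)\<^sup>2" "0 \<le> K"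
  shows "ennreal (B w w + (\<Sum>y\<leftarrow>ys. B y y)) \<le> ennreal K * gsq ys w"
proof (induction ys arbitrary: w)
  case Nil
  then show ?case using K by (simp add: ennreal_leI flip: ennreal_mult)
next
  case (Cons y ys)
  define s where "s = (\<Sum>y\<leftarrow>ys. B y y)"
  have pos: "0 \<le> B x x" for x by (rule psd_formD(3)[OF B])
  have s: "0 \<le> s" unfolding s_def by (rule sum_list_nonneg) (auto simp: pos)
  have second: "(\<integral>\<^sup>+t. ennreal (t\<^sup>2) \<partial>gauss) = 1" by (rule gauss_second_moment)
  have "2 * ennreal (B w w + (\<Sum>y\<leftarrow>y # ys. B y y)) = ennreal (2 * (B w w + s) + 2 * B y y)"
    using pos s ennreal_mult[of 2 "B w w + (B y y + s)"] by (simp add: s_def algebra_simps)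
  also have "\<dots> = ennreal (2 * (B w w + s)) + ennreal (2 * B y y) * (\<integral>\<^sup>+t. ennreal (t\<^sup>2) \<partial>gauss)"
    unfolding second using pos[of w] pos[of y] s by (subst ennreal_plus) simp_all
  also have "\<dots> = (\<integral>\<^sup>+t. ennreal (2 * (B w w + s)) + ennreal (2 * B y y) * ennreal (t\<^sup>2) \<partial>gauss)"
    by (simp add: nn_integral_add nn_integral_cmult gauss.emeasure_space_1[unfolded space_gauss])
  also have "\<dots> \<le> (\<integral>\<^sup>+t. ennreal K * gsq ys (w + t *\<^sub>R y) + ennreal K * gsq ys (w + t *\<^sub>R (- y)) \<partial>gauss)"
  proof (rule nn_integral_mono)
    fix t
    have "ennreal (2 * (B w w + s)) + ennreal (2 * B y y) * ennreal (t\<^sup>2)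
      = ennreal (2 * (B w w + s) + 2 * B y y * t\<^sup>2)"
      using pos s by (simp add: ennreal_mult ennreal_plus)
    also have "\<dots> = ennreal ((B (w + t *\<^sub>R y) (w + t *\<^sub>R y) + s) + (B (w - t *\<^sub>R y) (w - t *\<^sub>R y) + s))"
      by (simp add: psd_form_expand[OF B] algebra_simps)
    also have "\<dots> = ennreal (B (w + t *\<^sub>R y) (w + t *\<^sub>R y) + s) + ennreal (B (w + t *\<^sub>R (- y)) (w + t *\<^sub>R (- y)) + s)"
      unfolding scaleR_minus_right add_uminus_conv_diff by (rule ennreal_plus) (simp_all add: pos s)
    also have "\<dots> \<le> ennreal K * gsq ys (w + t *\<^sub>R y) + ennreal K * gsq ys (w + t *\<^sub>R (- y))"
      unfolding s_def by (intro add_mono Cons.IH)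
    finally show "ennreal (2 * (B w w + s)) + ennreal (2 * B y y) * ennreal (t\<^sup>2)
      \<le> ennreal K * gsq ys (w + t *\<^sub>R y) + ennreal K * gsq ys (w + t *\<^sub>R (- y))" .
  qed
  also have "\<dots> = ennreal K * gsq (y # ys) w + ennreal K * gsq ((- y) # ys) w"
    using measurable_gsq1[of ys w y] measurable_gsq1[of ys w "- y"]
    by (simp add: nn_integral_add nn_integral_cmult del: scaleR_minus_right)
  also have "\<dots> = 2 * (ennreal K * gsq (y # ys) w)"
    unfolding gsq_sign by (simp add: mult_2)
  finally show ?case by (simp add: ennreal_mult_le_mult_iff)
qed

lemma series_converges_L2_bounded:
  assumes conv: "series_converges_L2 M Y"
  obtains C where "C < \<infinity>" "\<forall>\<^sub>F N in sequentially. (\<integral>\<^sup>+\<omega>. ennreal ((norm (\<Sum>n<N. Y n \<omega>))\<^sup>2) \<partial>M) \<le> C"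
proof -
  obtain X where Y: "\<And>n. in_L2 M (Y n)" and X: "in_L2 M X"
    and lim: "(\<lambda>N. \<integral>\<^sup>+\<omega>. ennreal ((norm ((\<Sum>n<N. Y n \<omega>) - X \<omega>))\<^sup>2) \<partial>M) \<longlonglongrightarrow> 0"
    using conv unfolding series_converges_L2_def by blast
  have sm: "strongly_measurable M (\<lambda>\<omega>. \<Sum>n<N. Y n \<omega>)" for N
    using Y by (intro strongly_measurable_sum) (simp add: in_L2_def)
  have X_sm: "strongly_measurable M X" using X by (simp add: in_L2_def)
  note [measurable] = strongly_measurable_norm[OF X_sm] strongly_measurable_norm[OF strongly_measurable_diff[OF sm X_sm]]
  define C where "C = 2 * 1 + 2 * (\<integral>\<^sup>+\<omega>. ennreal ((norm (X \<omega>))\<^sup>2) \<partial>M)"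
  show thesis
  proof (rule that[of C])
    show "C < \<infinity>" using X by (simp add: C_def in_L2_def ennreal_mult_less_top)
    have "\<forall>\<^sub>F N in sequentially. (\<integral>\<^sup>+\<omega>. ennreal ((norm ((\<Sum>n<N. Y n \<omega>) - X \<omega>))\<^sup>2) \<partial>M) < 1"
      using lim by (rule order_tendstoD) simp
    then show "\<forall>\<^sub>F N in sequentially. (\<integral>\<^sup>+\<omega>. ennreal ((norm (\<Sum>n<N. Y n \<omega>))\<^sup>2) \<partial>M) \<le> C"
    proof eventually_elim
      case (elim N)
      have "(\<integral>\<^sup>+\<omega>. ennreal ((norm (\<Sum>n<N. Y n \<omega>))\<^sup>2) \<partial>M)
          \<le> (\<integral>\<^sup>+\<omega>. 2 * ennreal ((norm ((\<Sum>n<N. Y n \<omega>) - X \<omega>))\<^sup>2) + 2 * ennreal ((norm (X \<omega>))\<^sup>2) \<partial>M)"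
        by (intro nn_integral_mono ennreal_norm_diff_le)
      also have "\<dots> = 2 * (\<integral>\<^sup>+\<omega>. ennreal ((norm ((\<Sum>n<N. Y n \<omega>) - X \<omega>))\<^sup>2) \<partial>M) + 2 * (\<integral>\<^sup>+\<omega>. ennreal ((norm (X \<omega>))\<^sup>2) \<partial>M)"
        by (simp add: nn_integral_add nn_integral_cmult)
      also have "\<dots> \<le> C" unfolding C_def using elim by (intro add_right_mono mult_left_mono) auto
      finally show ?case .
    qed
  qed
qed

lemma summable_on_countable_subsets:
  fixes f :: "'a \<Rightarrow> real"
  assumes nonneg: "\<And>x. 0 \<le> f x" and C: "\<And>C. countable C \<Longrightarrow> infinite C \<Longrightarrow> C \<subseteq> B \<Longrightarrow> f summable_on C"
  shows "f summable_on B"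
proof (rule ccontr)
  assume not: "\<not> f summable_on B"
  have "\<exists>S. finite S \<and> S \<subseteq> B \<and> real n \<le> sum f S" for n
  proof (rule ccontr)
    assume no: "\<not> ?thesis"
    have "bdd_above (sum f ` {F. F \<subseteq> B \<and> finite F})"
    proof (rule bdd_aboveI2)
      fix F assume "F \<in> {F. F \<subseteq> B \<and> finite F}"
      then have "\<not> real n \<le> sum f F" using no by blast
      then show "sum f F \<le> real n" by simp
    qed
    then have "f summable_on B" using nonneg by (intro nonneg_bdd_above_summable_on)
    with not show False ..
  qed
  then obtain S where S: "\<And>n. finite (S n)" "\<And>n. S n \<subseteq> B" "\<And>n. real n \<le> sum f (S n)" by metis
  define U where "U = (\<Union>n. S n)"
  have cU: "countable U" "U \<subseteq> B" using S by (auto simp: U_def intro: countable_finite)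
  have sU: "f summable_on U"
    using C[OF cU(1) _ cU(2)] summable_on_finite by (cases "finite U") auto
  have "real n \<le> infsum f U" for n
  proof -
    have "sum f (S n) \<le> infsum f U"
      by (rule finite_sum_le_infsum[OF sU S(1)]) (auto simp: U_def nonneg)
    with S(3)[of n] show ?thesis by simp
  qed
  then show False by (metis not_le reals_Archimedean2)
qed

lemma gamma_radonifying_imp_pre_hilbert_schmidt:
  fixes u :: "'e::real_normed_vector \<Rightarrow>\<^sub>L 'f::real_normed_vector"
  assumes M: "prob_space M" and g: "gaussian_sequence M g" and u: "u \<in> gamma_radonifying M g"
  shows "u \<in> pre_hilbert_schmidt TYPE('h)"
  unfolding pre_hilbert_schmidt_def
proof (intro CollectI allI impI)
  fix H1 H2 :: "'h hilbert" and v :: "'h \<Rightarrow> 'e" and w :: "'f \<Rightarrow> 'h"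
  assume H1: "hilbert_space H1" and H2: "hilbert_space H2"
    and v: "bounded_op_from H1 v" and w: "bounded_op_into H2 w"
  interpret H1: hilbert_space H1 by fact
  interpret H2: hilbert_space H2 by fact
  obtain B where B: "orthonormal_basis H1 B" using H1.orthonormal_basis_exists ..
  define Q where "Q x y = hinner H2 (w x) (w y)" for x y
  have Q: "psd_form Q" unfolding Q_def by (rule H2.psd_form_pullback[OF w])
  have w_carr: "w x \<in> carr H2" for x using w by (simp add: bounded_op_into_def)
  obtain K0 where K0: "\<And>x. hnorm H2 (w x) \<le> K0 * norm x"
    using w unfolding bounded_op_into_def by blast
  have Q_le: "Q x x \<le> K0\<^sup>2 * (norm x)\<^sup>2" for x
  proof -
    have "(hnorm H2 (w x))\<^sup>2 \<le> (K0 * norm x)\<^sup>2"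
      using K0[of x] by (intro power_mono) (simp_all add: hnorm_def H2.inner_nonneg w_carr)
    then show ?thesis by (simp add: Q_def H2.norm_power2 w_carr power_mult_distrib)
  qed
  define f where "f b = Q (blinfun_apply u (v b)) (blinfun_apply u (v b))" for b
  have f_nonneg: "0 \<le> f b" for b unfolding f_def by (rule psd_formD(3)[OF Q])
  have "f summable_on B"
  proof (rule summable_on_countable_subsets[OF f_nonneg])
    fix C assume C: "countable C" "infinite C" "C \<subseteq> B"
    define b where "b = from_nat_into C"
    have bij: "bij_betw b UNIV C" unfolding b_def by (rule bij_betw_from_nat_into[OF C(1,2)])
    have bB: "b n \<in> B" for n using bij C(3) by (auto simp: bij_betw_def)
    have b_carr: "b n \<in> carr H1" for n using bB B by (auto simp: orthonormal_basis_def)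
    have b_eq: "b m = b n \<longleftrightarrow> m = n" for m n
      using bij by (auto simp: bij_betw_def inj_on_def)
    have orth: "hinner H1 (b m) (b n) = (if m = n then 1 else 0)" for m n
      using B bB[of m] bB[of n] b_eq[of m n] unfolding orthonormal_basis_def by simp
    define y where "y n = blinfun_apply u (v (b n))" for n
    have "weakly_2_summable (\<lambda>n. v (b n))"
      by (rule H1.bessel_weakly_2_summable[OF v b_carr orth])
    then have "series_converges_L2 M (\<lambda>n \<omega>. g n \<omega> *\<^sub>R y n)"
      using u unfolding gamma_radonifying_def y_def by blast
    then obtain K where K: "K < \<infinity>"
      and ev: "\<forall>\<^sub>F N in sequentially. (\<integral>\<^sup>+\<omega>. ennreal ((norm (\<Sum>n<N. g n \<omega> *\<^sub>R y n))\<^sup>2) \<partial>M) \<le> K"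
      by (rule series_converges_L2_bounded)
    obtain N0 where N0: "\<And>N. N0 \<le> N \<Longrightarrow> gsq (map y [0..<N]) 0 \<le> K"
      using ev unfolding eventually_sequentially gsq_map_upt[OF M g] by blast
    have le: "ennreal (\<Sum>n<N. f (b n)) \<le> ennreal (K0\<^sup>2) * K" for N
    proof -
      have "(\<Sum>n<N. f (b n)) \<le> (\<Sum>n<max N N0. f (b n))"
        by (intro sum_mono2) (auto simp: f_nonneg)
      also have "\<dots> = Q 0 0 + (\<Sum>y\<leftarrow>map y [0..<max N N0]. Q y y)"
        using linear_0[OF psd_formD(1)[OF Q]]
        by (simp add: interv_sum_list_conv_sum_set_nat comp_def atLeast0LessThan f_def y_def)
      finally have "ennreal (\<Sum>n<N. f (b n)) \<le> ennreal (Q 0 0 + (\<Sum>y\<leftarrow>map y [0..<max N N0]. Q y y))"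
        by (rule ennreal_leI)
      also have "\<dots> \<le> ennreal (K0\<^sup>2) * gsq (map y [0..<max N N0]) 0"
        by (rule psd_form_le_gsq[OF Q Q_le]) simp
      also have "\<dots> \<le> ennreal (K0\<^sup>2) * K" by (intro mult_left_mono N0) simp_all
      finally show ?thesis .
    qed
    have "summable (\<lambda>n. f (b n))"
    proof (rule summableI_nonneg_bounded)
      show "(\<Sum>n<N. f (b n)) \<le> enn2real (ennreal (K0\<^sup>2) * K)" for N
      proof -
        have "ennreal (K0\<^sup>2) * K < \<infinity>" using K by (simp add: ennreal_mult_less_top)
        from enn2real_mono[OF le[of N]] this show ?thesis by (simp add: sum_nonneg f_nonneg)
      qed
    qed (rule f_nonneg)
    then have "(\<lambda>n. f (b n)) summable_on UNIV"
      by (intro norm_summable_imp_summable_on) (simp add: f_nonneg)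
    then show "f summable_on C"
      using summable_on_reindex_bij_betw[OF bij, of f] by simp
  qed
  then have "(\<lambda>b. (hnorm H2 (w (blinfun_apply u (v b))))\<^sup>2) summable_on B"
    by (simp add: f_def[abs_def] Q_def H2.norm_power2 w_carr)
  then show "hilbert_schmidt H1 H2 (w \<circ> blinfun_apply u \<circ> v)"
    using B unfolding hilbert_schmidt_def by (auto simp: comp_def)
qed

section \<open>Equality of the two classes\<close>

theorem mainTheorem2:
  fixes M :: "'w measure"
    and r g :: "nat \<Rightarrow> 'w \<Rightarrow> real"
  assumes "prob_space M"
    and "rademacher_sequence M r"
    and "gaussian_sequence M g"
    and "type_2 M r TYPE('f::banach)"
    and "(UNIV :: real set) \<lesssim> (UNIV :: 'h set)"
  shows "pre_hilbert_schmidt TYPE('h)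
           = (gamma_radonifying M g :: ('e::banach \<Rightarrow>\<^sub>L 'f) set)"
proof
  show "gamma_radonifying M g \<subseteq> (pre_hilbert_schmidt TYPE('h) :: ('e \<Rightarrow>\<^sub>L 'f) set)"
    using gamma_radonifying_imp_pre_hilbert_schmidt[OF assms(1,3)] by blast
  obtain c where c: "0 < c" and t2: "\<And>N (x :: nat \<Rightarrow> 'f).
      (\<integral>\<^sup>+\<omega>. ennreal ((norm (\<Sum>n<N. r n \<omega> *\<^sub>R x n))\<^sup>2) \<partial>M) \<le> ennreal (c\<^sup>2 * (\<Sum>n<N. (norm (x n))\<^sup>2))"
    by (rule type_2_nn_integral[OF assms(1,2,4)]) blast
  note gt2 = gsq_type_2[OF assms(1,2,3) t2]
  show "pre_hilbert_schmidt TYPE('h) \<subseteq> (gamma_radonifying M g :: ('e \<Rightarrow>\<^sub>L 'f) set)"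
  proof
    fix u :: "'e \<Rightarrow>\<^sub>L 'f" assume u: "u \<in> pre_hilbert_schmidt TYPE('h)"
    show "u \<in> gamma_radonifying M g"
      unfolding gamma_radonifying_def
    proof (intro CollectI allI impI)
      fix x :: "nat \<Rightarrow> 'e" assume x: "weakly_2_summable x"
      obtain C where C: "0 \<le> C" "\<And>N. gsq (map (\<lambda>n. blinfun_apply u (x n)) [0..<N]) 0 \<le> ennreal C"
        using pre_hilbert_schmidt_gsq_bounded[OF u assms(5) x _ gt2] c by auto
      show "series_converges_L2 M (\<lambda>n \<omega>. g n \<omega> *\<^sub>R blinfun_apply u (x n))"
      proof (rule gsq_Cauchy_imp_converges[OF assms(1,3)])
        show "gsq (map (\<lambda>n. blinfun_apply u (x n)) [0..<N]) 0 < \<infinity>" for N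
          using C(2)[of N] by (simp add: le_less_trans)
        show "\<exists>m. \<forall>p\<ge>m. \<forall>q. gsq (map (\<lambda>n. blinfun_apply u (x n)) [p..<q]) 0 < ennreal e"
          if "0 < e" for e
          by (rule gsq_bounded_imp_Cauchy[OF assms(1,2,3) t2 C(2,1) that])
      qed
    qed
  qed
qed

end
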